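(* Let $p$ be a computable real number with $p \geq 1$. Then $\ell^p$ is computably categorical if and only if $p = 2$.
   Context: $\ell^p$ denotes the Banach space of all sequences $(a_n)_{n=0}^\infty$ of complex numbers with $\sum_{n=0}^\infty |a_n|^p<\infty$, with norm $\|(a_n)_n\| = (\sum_{n}|a_n|^p)^{1/p}$. For $n \in \mathbb{N}$, $e_n$ is the vector whose $(n+1)$st component is $1$ and all other components $0$; $E=\{e_0,e_1,\ldots\}$ is the standard generating set. A rational point is a complex number whose real and imaginary parts are rational. A generating set for $\ell^p$ is a subset whose linear span is dense in $\ell^p$. A generating set $F=\{f_0,f_1,\ldots\}$ (given as a sequence) is an effective generating set if there is an algorithm that, given rational points $\alpha_0,\ldots,\alpha_M$ and $k\in\mathbb{N}$, computes a rational $q$ with $|q-\|\sum_{j=0}^M\alpha_j f_j\||<2^{-k}$. For an effective generating set $F$, a rational ball with respect to $F$ is a ball $B(\sum_{j=0}^M\alpha_j f_j; r)$ with $\alpha_j$ rational points and $r$ a positive rational (inputs to algorithms are codes of $(r,M,\alpha_0,\ldots,\alpha_M)$). If $F$ and $G$ are effective generating sets, a map $T:\ell^p\to\ell^p$ is computable with respect to $(F,G)$ if there is an algorithm $P$ such that: (Approximation) given a rational ball with respect to $F$ as input, $P$ either does not halt or outputs a rational ball with respect to $G$; (Correctness) if $P$ on input $B_1$ outputs $B_2$, then $T(f)\in B_2$ for every $f\in B_1$; (Convergence) for every $f\in\ell^p$ and every neighborhood $U$ of $T(f)$, there is a rational ball $B_1$ with respect to $F$ containing $f$ such that $P$ halts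 on $B_1$ and outputs a rational ball included in $U$. $\ell^p$ is computably categorical if for every effective generating set $F$ for $\ell^p$ there is a surjective linear isometry of $\ell^p$ that is computable with respect to $(E,F)$. *)

theory Defs
  imports Complex_Main "HOL-Library.Nat_Bijection"
begin

section \<open>Partial recursive functions\<close>

text \<open>Unary partial recursive functions on the natural numbers, where \<^const>\<open>None\<close> is divergence.
  Several arguments are passed through the pairing function \<^const>\<open>prod_encode\<close>, so that the
  usual closure conditions (composition, primitive recursion, unbounded minimization) can all be
  stated for unary functions; the identity is the pairing of the two projections.\<close>

inductive partrec :: "(nat \<Rightarrow> nat option) \<Rightarrow> bool" where
  zero: "partrec (\<lambda>_. Some 0)"
| succ: "partrec (\<lambda>n. Some (Suc n))"
| left: "partrec (\<lambda>n. Some (fst (prod_decode n)))"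
| right: "partrec (\<lambda>n. Some (snd (prod_decode n)))"
| pair: "partrec f \<Longrightarrow> partrec g \<Longrightarrow>
    partrec (\<lambda>n. Option.bind (f n) (\<lambda>a. Option.bind (g n) (\<lambda>b. Some (prod_encode (a, b)))))"
| comp: "partrec f \<Longrightarrow> partrec g \<Longrightarrow> partrec (\<lambda>n. Option.bind (g n) f)"
| prec: "partrec f \<Longrightarrow> partrec g \<Longrightarrow>
    partrec (\<lambda>n. case prod_decode n of (a, m) \<Rightarrow>
      rec_nat (f a)
        (\<lambda>i r. Option.bind r (\<lambda>v. g (prod_encode (a, prod_encode (i, v))))) m)"
| mu: "partrec f \<Longrightarrow>
    partrec (\<lambda>a.
      if \<exists>n. f (prod_encode (a, n)) = Some 0 \<and> (\<forall>m<n. f (prod_encode (a, m)) \<noteq> None)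
      then Some (LEAST n. f (prod_encode (a, n)) = Some 0)
      else None)"

section \<open>Codes of finite rational data\<close>

text \<open>All codes are injective. Rationals are coded through their reduced fraction.\<close>

definition rat_code :: "rat \<Rightarrow> nat" where
  "rat_code q = (case quotient_of q of (a, b) \<Rightarrow> prod_encode (int_encode a, int_encode b))"

type_synonym rat_point = "rat \<times> rat"

definition point :: "rat_point \<Rightarrow> complex" where
  "point z = Complex (of_rat (fst z)) (of_rat (snd z))"

definition point_code :: "rat_point \<Rightarrow> nat" where
  "point_code z = prod_encode (rat_code (fst z), rat_code (snd z))"

definition points_code :: "rat_point list \<Rightarrow> nat" where
  "points_code zs = list_encode (map point_code zs)"

definition computable_real :: "real \<Rightarrow> bool" where
  "computable_real x \<longleftrightarrow>
    (\<exists>\<phi>. partrec \<phi> \<and> (\<forall>k. \<exists>q. \<phi> k = Some (rat_code q) \<and> \<bar>of_rat q - x\<bar> < 1 / 2 ^ k))"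

section \<open>The space of p-summable complex sequences\<close>

definition lp :: "real \<Rightarrow> (nat \<Rightarrow> complex) set" where
  "lp p = {a. summable (\<lambda>n. cmod (a n) powr p)}"

definition lp_norm :: "real \<Rightarrow> (nat \<Rightarrow> complex) \<Rightarrow> real" where
  "lp_norm p a = (\<Sum>n. cmod (a n) powr p) powr (1 / p)"

definition lp_ball :: "real \<Rightarrow> (nat \<Rightarrow> complex) \<Rightarrow> real \<Rightarrow> (nat \<Rightarrow> complex) set" where
  "lp_ball p c r = {f \<in> lp p. lp_norm p (\<lambda>n. f n - c n) < r}"

definition lp_neighborhood :: "real \<Rightarrow> (nat \<Rightarrow> complex) \<Rightarrow> (nat \<Rightarrow> complex) set \<Rightarrow> bool" where
  "lp_neighborhood p f U \<longleftrightarrow> U \<subseteq> lp p \<and> (\<exists>\<epsilon>>0. lp_ball p f \<epsilon> \<subseteq> U)"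

definition std_gen :: "nat \<Rightarrow> nat \<Rightarrow> complex" where
  "std_gen n = (\<lambda>m. if m = n then 1 else 0)"

definition lin_comb :: "(nat \<Rightarrow> nat \<Rightarrow> complex) \<Rightarrow> complex list \<Rightarrow> nat \<Rightarrow> complex" where
  "lin_comb F cs = (\<lambda>n. \<Sum>j<length cs. cs ! j * F j n)"

definition surj_linear_isometry :: "real \<Rightarrow> ((nat \<Rightarrow> complex) \<Rightarrow> (nat \<Rightarrow> complex)) \<Rightarrow> bool" where
  "surj_linear_isometry p T \<longleftrightarrow>
    T ` lp p = lp p \<and>
    (\<forall>f\<in>lp p. \<forall>g\<in>lp p. T (\<lambda>n. f n + g n) = (\<lambda>n. T f n + T g n)) \<and>
    (\<forall>c. \<forall>f\<in>lp p. T (\<lambda>n. c * f n) = (\<lambda>n. c * T f n)) \<and>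
    (\<forall>f\<in>lp p. lp_norm p (T f) = lp_norm p f)"

section \<open>Effective generating sets and computable maps\<close>

text \<open>A generating set is given by an enumeration of its elements, possibly with repetitions; its
  linear span is the set of all \<open>lin_comb F cs\<close>.\<close>

definition generating_set :: "real \<Rightarrow> (nat \<Rightarrow> nat \<Rightarrow> complex) \<Rightarrow> bool" where
  "generating_set p F \<longleftrightarrow>
    (\<forall>j. F j \<in> lp p) \<and>
    (\<forall>f\<in>lp p. \<forall>\<epsilon>>0. \<exists>cs. lin_comb F cs \<in> lp_ball p f \<epsilon>)"

definition effective_generating_set :: "real \<Rightarrow> (nat \<Rightarrow> nat \<Rightarrow> complex) \<Rightarrow> bool" where
  "effective_generating_set p F \<longleftrightarrow>
    generating_set p F \<and>
    (\<exists>\<phi>. partrec \<phi> \<and>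
      (\<forall>zs k. zs \<noteq> [] \<longrightarrow>
        (\<exists>q. \<phi> (prod_encode (points_code zs, k)) = Some (rat_code q) \<and>
             \<bar>of_rat q - lp_norm p (lin_comb F (map point zs))\<bar> < 1 / 2 ^ k)))"

text \<open>A pair \<open>(r, [\<alpha>\<^sub>0, \<dots>, \<alpha>\<^sub>M])\<close> stands for the tuple \<open>(r, M, \<alpha>\<^sub>0, \<dots>, \<alpha>\<^sub>M)\<close>; which ball it
  denotes depends on the generating set.\<close>

type_synonym rat_ball = "rat \<times> rat_point list"

definition rat_balls :: "rat_ball set" where
  "rat_balls = {(r, zs). r > 0 \<and> zs \<noteq> []}"

definition ball_code :: "rat_ball \<Rightarrow> nat" where
  "ball_code B = prod_encode (rat_code (fst B), points_code (snd B))"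

definition ball_set :: "real \<Rightarrow> (nat \<Rightarrow> nat \<Rightarrow> complex) \<Rightarrow> rat_ball \<Rightarrow> (nat \<Rightarrow> complex) set" where
  "ball_set p F B = lp_ball p (lin_comb F (map point (snd B))) (of_rat (fst B))"

text \<open>The three conjuncts on \<open>\<phi>\<close> are approximation, correctness and convergence.\<close>

definition computable_map ::
  "real \<Rightarrow> (nat \<Rightarrow> nat \<Rightarrow> complex) \<Rightarrow> (nat \<Rightarrow> nat \<Rightarrow> complex) \<Rightarrow>
    ((nat \<Rightarrow> complex) \<Rightarrow> (nat \<Rightarrow> complex)) \<Rightarrow> bool" where
  "computable_map p F G T \<longleftrightarrow>
    (\<exists>\<phi>. partrec \<phi> \<and>
      (\<forall>B1\<in>rat_balls. \<forall>y. \<phi> (ball_code B1) = Some y \<longrightarrow> y \<in> ball_code ` rat_balls) \<and>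
      (\<forall>B1\<in>rat_balls. \<forall>B2\<in>rat_balls. \<phi> (ball_code B1) = Some (ball_code B2) \<longrightarrow>
        (\<forall>f\<in>ball_set p F B1. T f \<in> ball_set p G B2)) \<and>
      (\<forall>f\<in>lp p. \<forall>U. lp_neighborhood p (T f) U \<longrightarrow>
        (\<exists>B1\<in>rat_balls. \<exists>B2\<in>rat_balls. f \<in> ball_set p F B1 \<and>
          \<phi> (ball_code B1) = Some (ball_code B2) \<and> ball_set p G B2 \<subseteq> U)))"

definition computably_categorical :: "real \<Rightarrow> bool" where
  "computably_categorical p \<longleftrightarrow>
    (\<forall>F. effective_generating_set p F \<longrightarrow>
      (\<exists>T. surj_linear_isometry p T \<and> computable_map p std_gen F T))"

end

theory Submission
  imports Defs "HOL-Analysis.Analysis"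
begin

text \<open>
  For \<open>p \<noteq> 2\<close> a surjective linear isometry preserves disjointness of supports, hence sends some
  \<open>e\<^sub>k\<close> to a unimodular multiple of \<open>e\<^sub>0\<close>. Let \<open>u\<^sub>i\<close> be small rational weights that enumerate an
  undecidable set, and let \<open>\<gamma> = \<Sum> u\<^sub>i powr p\<close>, which is not a computable real. The unit vector
  \<open>f\<^sub>0 = (1 - \<gamma>) powr (1 / p) e\<^sub>0 + \<Sum> u\<^sub>i e\<^sub>i\<^sub>+\<^sub>1\<close> together with \<open>e\<^sub>1, e\<^sub>2, \<dots>\<close> is an effective generating
  set. A computable isometry would approximate a multiple of \<open>e\<^sub>0\<close> by combinations of it, and the
  coefficients of \<open>f\<^sub>0\<close> would then compute \<open>\<gamma>\<close>.

  For \<open>p = 2\<close> one searches for rational combinations of the given generators that are orthonormal up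
  to rapidly decreasing errors and have dense span; such vectors always exist, since exact ones do.
  They are so well conditioned that their Gram-Schmidt orthonormalization is computable, and sending
  the standard basis to the resulting orthonormal basis is the required isometry.

  Computability of a function is established by showing that its graph is semidecidable and searching,
  so that no algorithm has to be written down. The undecidable set comes from a universal
  semidecidable relation, whose witnesses are lists of evaluation facts that justify each other.
\<close>

section \<open>Computable functions and semidecidable predicates\<close>

text \<open>For p = 2 the obstacle is that neither the vanishing of a vector nor the linear
  dependence of generators can be decided from approximate norms, so Gram-Schmidt applied to the
  given generators is not an algorithm. Strict inequalities between computable reals can be
  confirmed, and they survive small changes of the coefficients. The searches therefore ask only for
  such inequalities and for decidable facts about rationals; an exact real solution shows that they
  end. For p \<noteq> 2 the number \<gamma> is hidden where norms do not see it: the zeroth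
  generator has total mass 1, so coordinate 0 and the infinite tail together contribute an amount
  given by a finite sum. \<gamma> reappears in the coefficient 1 / c that expresses
  \<open>e\<^sub>0\<close> through the generators, and the rigidity of isometries forces an
  algorithm for T to approximate the modulus of that coefficient. Partial sums bound \<gamma> from
  below in any case; an upper bound closer than the weight attached to e tells after which stage e
  can no longer be enumerated.\<close>

definition recursive :: "(nat \<Rightarrow> nat) \<Rightarrow> bool" where
  "recursive f \<longleftrightarrow> partrec (\<lambda>n. Some (f n))"

lemma recursive_comp: "recursive f \<Longrightarrow> recursive g \<Longrightarrow> recursive (\<lambda>n. f (g n))"
  unfolding recursive_def by (drule (1) partrec.comp) simp

lemma recursive_pair:
  "recursive f \<Longrightarrow> recursive g \<Longrightarrow> recursive (\<lambda>n. prod_encode (f n, g n))"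
  unfolding recursive_def by (drule (1) partrec.pair) simp

lemma recursive_fst: "recursive (\<lambda>n. fst (prod_decode n))"
  and recursive_snd: "recursive (\<lambda>n. snd (prod_decode n))"
  and recursive_Suc: "recursive Suc"
  unfolding recursive_def by (fact partrec.left partrec.right partrec.succ)+

lemma recursive_id: "recursive (\<lambda>n. n)"
  using recursive_pair[OF recursive_fst recursive_snd] by simp

lemma recursive_const: "recursive (\<lambda>n. k)"
proof (induction k)
  case 0
  show ?case unfolding recursive_def by (rule partrec.zero)
next
  case (Suc k)
  show ?case using recursive_comp[OF recursive_Suc Suc] .
qed

text \<open>The recursion scheme has a single parameter. Taking the whole argument n as that
  parameter lets start value, step and depth all depend on n.\<close>

lemma recursive_rec_nat:
  assumes "recursive f" "recursive g" "recursive h"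
  shows "recursive (\<lambda>n. rec_nat (f n) (\<lambda>i r. g (prod_encode (n, prod_encode (i, r)))) (h n))"
proof -
  have eq: "rec_nat (Some a) (\<lambda>i r. Option.bind r (\<lambda>v. Some (G i v))) m = Some (rec_nat a G m)"
    for a m :: nat and G
    by (induction m) auto
  have "recursive (\<lambda>n. case prod_decode n of (a, m) \<Rightarrow>
      rec_nat (f a) (\<lambda>i r. g (prod_encode (a, prod_encode (i, r)))) m)"
    using partrec.prec[OF assms(1)[unfolded recursive_def] assms(2)[unfolded recursive_def]]
    by (simp add: recursive_def eq case_prod_unfold)
  from recursive_comp[OF this recursive_pair[OF recursive_id assms(3)]] show ?thesis by simp
qed

lemma recursive_Least:
  assumes "recursive f" "\<And>a. \<exists>n. f (prod_encode (a, n)) = 0"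
  shows "recursive (\<lambda>a. LEAST n. f (prod_encode (a, n)) = 0)"
  using partrec.mu[OF assms(1)[unfolded recursive_def]] assms(2) by (simp add: recursive_def)

text \<open>The map \<open>dec\<close> is total: junk codes are sent to arbitrary elements.\<close>

class coded =
  fixes enc :: "'a \<Rightarrow> nat" and dec :: "nat \<Rightarrow> 'a"
  assumes dec_enc [simp]: "dec (enc x) = x"
    and recursive_enc_dec: "recursive (\<lambda>n. enc (dec n))"

lemma enc_eq_iff [simp]: "enc x = enc y \<longleftrightarrow> x = y"
  by (metis dec_enc)

instantiation nat :: coded
begin
definition "enc (n::nat) = n"
definition "dec (n::nat) = n"
instance by standard (simp_all add: enc_nat_def dec_nat_def recursive_id)
end

instantiation prod :: (coded, coded) coded
begin
definition "enc x = prod_encode (enc (fst x), enc (snd x))"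
definition "dec n = (dec (fst (prod_decode n)), dec (snd (prod_decode n)))"
instance
proof
  show "recursive (\<lambda>n. enc (dec n :: 'a \<times> 'b))"
    unfolding enc_prod_def dec_prod_def fst_conv snd_conv
    by (intro recursive_pair recursive_comp[OF recursive_enc_dec] recursive_fst recursive_snd)
qed (simp add: enc_prod_def dec_prod_def)
end

text \<open>A conditional is a recursion whose step discards the accumulator: every positive depth
  returns the second branch.\<close>

lemma recursive_if: "recursive h \<Longrightarrow> recursive f \<Longrightarrow> recursive g \<Longrightarrow>
  recursive (\<lambda>n. if h n = 0 then f n else g n)"
proof -
  assume a: "recursive h" "recursive f" "recursive g"
  have "recursive (\<lambda>n. rec_nat (f n) (\<lambda>i r. g (fst (prod_decode (prod_encode (n, prod_encode (i, r)))))) (h n))"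
    by (rule recursive_rec_nat[where g = "\<lambda>n. g (fst (prod_decode n))"])
       (intro a recursive_comp[OF a(3)] recursive_fst)+
  moreover have "rec_nat (f n) (\<lambda>i r. g (fst (prod_decode (prod_encode (n, prod_encode (i, r)))))) (h n) =
     (if h n = 0 then f n else g n)" for n by (cases "h n") auto
  ultimately show ?thesis by simp
qed

instantiation bool :: coded
begin
definition "enc b = (if b then 1 else 0::nat)"
definition "dec n \<longleftrightarrow> n \<noteq> (0::nat)"
instance
proof
  have "recursive (\<lambda>n. if n = 0 then 0 else 1)"
    by (intro recursive_if recursive_id recursive_const)
  thus "recursive (\<lambda>n. enc (dec n :: bool))"
    by (rule back_subst[of recursive]) (auto simp: enc_bool_def dec_bool_def)
qed (simp add: enc_bool_def dec_bool_def)
end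

instantiation int :: coded
begin
definition "enc = int_encode"
definition "dec = int_decode"
instance by standard (simp_all add: enc_int_def dec_int_def recursive_id)
end

section \<open>Computable functions between coded types\<close>

definition computable :: "('a::coded \<Rightarrow> 'b::coded) \<Rightarrow> bool" where
  "computable f \<longleftrightarrow> recursive (\<lambda>n. enc (f (dec n)))"

named_theorems comp_intros

lemma computable_nat_iff: "computable (f :: nat \<Rightarrow> nat) \<longleftrightarrow> recursive f"
  by (simp add: computable_def enc_nat_def dec_nat_def)

lemma computable_comp: "computable f \<Longrightarrow> computable g \<Longrightarrow> computable (\<lambda>x. f (g x))"
  unfolding computable_def by (drule (1) recursive_comp) simp

lemma computable_id [comp_intros]: "computable (\<lambda>x. x)"
  unfolding computable_def by (rule recursive_enc_dec)

lemma computable_const [comp_intros]: "computable (\<lambda>x. c)"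
  unfolding computable_def by (rule recursive_const)

lemma computable_Pair [comp_intros]:
  "computable f \<Longrightarrow> computable g \<Longrightarrow> computable (\<lambda>x. (f x, g x))"
  unfolding computable_def enc_prod_def fst_conv snd_conv by (rule recursive_pair)

lemma computable_fst [comp_intros]:
  fixes f :: "'a::coded \<Rightarrow> 'b::coded \<times> 'c::coded"
  assumes "computable f" shows "computable (\<lambda>x. fst (f x))"
proof (rule computable_comp[OF _ assms])
  show "computable (fst :: 'b \<times> 'c \<Rightarrow> 'b)"
    unfolding computable_def dec_prod_def fst_conv
    by (intro recursive_comp[OF recursive_enc_dec] recursive_fst)
qed

lemma computable_snd [comp_intros]:
  fixes f :: "'a::coded \<Rightarrow> 'b::coded \<times> 'c::coded"
  assumes "computable f" shows "computable (\<lambda>x. snd (f x))"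
proof (rule computable_comp[OF _ assms])
  show "computable (snd :: 'b \<times> 'c \<Rightarrow> 'c)"
    unfolding computable_def dec_prod_def snd_conv
    by (intro recursive_comp[OF recursive_enc_dec] recursive_snd)
qed

lemma computable_enc [comp_intros]: "computable f \<Longrightarrow> computable (\<lambda>x. enc (f x))"
  unfolding computable_def by (simp add: enc_nat_def)

lemma computable_dec [comp_intros]: "computable f \<Longrightarrow> computable (\<lambda>x. dec (f x))"
  unfolding computable_def by (drule recursive_comp[OF recursive_enc_dec]) (simp add: enc_nat_def)

lemma computable_Suc [comp_intros]: "computable f \<Longrightarrow> computable (\<lambda>x. Suc (f x))"
  by (rule computable_comp) (simp_all add: computable_nat_iff recursive_Suc)

lemma computable_rec_nat [comp_intros]:
  fixes f :: "'a::coded \<Rightarrow> 'b::coded"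
  assumes f: "computable f" and g: "computable (\<lambda>z. g (fst z) (fst (snd z)) (snd (snd z)))"
    and h: "computable h"
  shows "computable (\<lambda>x. rec_nat (f x) (g x) (h x))"
proof -
  let ?G = "\<lambda>n. enc (g (dec (fst (prod_decode n))) (fst (prod_decode (snd (prod_decode n))))
     (dec (snd (prod_decode (snd (prod_decode n))))) :: 'b)"
  have "recursive ?G"
    using g by (simp add: computable_def dec_prod_def dec_nat_def)
  moreover have "recursive (\<lambda>n. enc (f (dec n)))" "recursive (\<lambda>n. h (dec n))"
    using f h by (simp_all add: computable_def enc_nat_def)
  ultimately have *: "recursive (\<lambda>n. rec_nat (enc (f (dec n)))
      (\<lambda>i r. ?G (prod_encode (n, prod_encode (i, r)))) (h (dec n)))"
    by (intro recursive_rec_nat)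
  have eq: "rec_nat (enc (f (dec n))) (\<lambda>i r. ?G (prod_encode (n, prod_encode (i, r)))) m =
      enc (rec_nat (f (dec n)) (g (dec n)) m)" for n m
    by (induction m) simp_all
  from * show ?thesis unfolding eq computable_def .
qed

lemma computable_if [comp_intros]:
  assumes P: "computable P" and f: "computable f" and g: "computable g"
  shows "computable (\<lambda>x. if P x then f x else g x)"
proof -
  have "recursive (\<lambda>n. if enc (P (dec n)) = 0 then enc (g (dec n)) else enc (f (dec n)))"
    using assms unfolding computable_def by (intro recursive_if)
  thus ?thesis unfolding computable_def
    by (rule back_subst[of recursive]) (auto simp: enc_bool_def)
qed

lemma computable_not [comp_intros]: "computable P \<Longrightarrow> computable (\<lambda>x. \<not> P x)"
  by (rule back_subst[of computable, OF computable_if[of P "\<lambda>_. False" "\<lambda>_. True"]]) (auto simp: computable_const)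

lemma computable_conj [comp_intros]:
  "computable P \<Longrightarrow> computable Q \<Longrightarrow> computable (\<lambda>x. P x \<and> Q x)"
  by (rule back_subst[of computable, OF computable_if[of P Q "\<lambda>_. False"]]) (auto simp: computable_const)

lemma computable_disj [comp_intros]:
  "computable P \<Longrightarrow> computable Q \<Longrightarrow> computable (\<lambda>x. P x \<or> Q x)"
  by (rule back_subst[of computable, OF computable_if[of P "\<lambda>_. True" Q]]) (auto simp: computable_const)

lemma computable_imp [comp_intros]:
  "computable P \<Longrightarrow> computable Q \<Longrightarrow> computable (\<lambda>x. P x \<longrightarrow> Q x)"
  unfolding imp_conv_disj by (intro comp_intros)

lemma computable_all_less [comp_intros]:
  fixes P :: "'a::coded \<Rightarrow> nat \<Rightarrow> bool"
  assumes "computable (\<lambda>z. P (fst z) (snd z))" and f: "computable f"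
  shows "computable (\<lambda>x. \<forall>i<f x. P x i)"
proof -
  have "computable (\<lambda>z. P (fst z) (fst (snd z)) :: bool)"
    using computable_comp[OF assms(1), of "\<lambda>z. (fst z, fst (snd z))"] by (simp add: comp_intros)
  hence "computable (\<lambda>x. rec_nat True (\<lambda>i r. P x i \<and> r) (f x))"
    by (intro comp_intros f)
  moreover have "rec_nat True (\<lambda>i r. P x i \<and> r) n = (\<forall>i<n. P x i)" for x n
    by (induction n) (auto simp: less_Suc_eq)
  ultimately show ?thesis by simp
qed

lemma computable_ex_less [comp_intros]:
  fixes P :: "'a::coded \<Rightarrow> nat \<Rightarrow> bool"
  assumes "computable (\<lambda>z. P (fst z) (snd z))" and f: "computable f"
  shows "computable (\<lambda>x. \<exists>i<f x. P x i)"
  using computable_not[OF computable_all_less[OF computable_not[OF assms(1)] f]] by simp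

lemma computable_Least [comp_intros]:
  fixes P :: "'a::coded \<Rightarrow> nat \<Rightarrow> bool"
  assumes "computable (\<lambda>z. P (fst z) (snd z))" and ex: "\<And>x. \<exists>n. P x n"
  shows "computable (\<lambda>x. LEAST n. P x n)"
proof -
  \<comment> \<open>Minimization looks for the value 0, which is the code of \<open>False\<close>;
    hence the negation.\<close>
  have "recursive (\<lambda>n. enc (\<not> P (dec (fst (prod_decode n))) (snd (prod_decode n))))" (is "recursive ?f")
    using computable_not[OF assms(1)] by (simp add: computable_def dec_prod_def dec_nat_def)
  moreover have eq: "?f (prod_encode (a, n)) = 0 \<longleftrightarrow> P (dec a) n" for a n
    by (simp add: enc_bool_def)
  ultimately have "recursive (\<lambda>a. LEAST n. ?f (prod_encode (a, n)) = 0)"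
    using ex by (intro recursive_Least) (simp_all only: eq)
  thus ?thesis by (simp only: eq computable_def enc_nat_def)
qed

subsection \<open>Natural numbers\<close>

lemma computable_add_nat [comp_intros]:
  fixes f g :: "'a::coded \<Rightarrow> nat"
  assumes f: "computable f" and g: "computable g" shows "computable (\<lambda>x. f x + g x)"
proof -
  have "computable (\<lambda>x. rec_nat (f x) (\<lambda>_. Suc) (g x))" by (intro comp_intros f g)
  moreover have "rec_nat a (\<lambda>_. Suc) b = a + b" for a b by (induction b) auto
  ultimately show ?thesis by simp
qed

lemma computable_mult_nat [comp_intros]:
  fixes f g :: "'a::coded \<Rightarrow> nat"
  assumes f: "computable f" and g: "computable g" shows "computable (\<lambda>x. f x * g x)"
proof -
  have "computable (\<lambda>x. rec_nat 0 (\<lambda>_ r. f x + r) (g x))"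
    by (intro comp_intros f g computable_comp[OF f])
  moreover have "rec_nat 0 (\<lambda>_ r. a + r) b = a * b" for a b by (induction b) auto
  ultimately show ?thesis by simp
qed

lemma computable_pred [comp_intros]:
  assumes f: "computable f" shows "computable (\<lambda>x. f x - Suc 0)"
proof -
  have "computable (\<lambda>x. rec_nat 0 (\<lambda>i _. i) (f x))" by (intro comp_intros f)
  moreover have "rec_nat 0 (\<lambda>i _. i) b = b - Suc 0" for b by (induction b) auto
  ultimately show ?thesis by simp
qed

lemma computable_diff_nat [comp_intros]:
  fixes f g :: "'a::coded \<Rightarrow> nat"
  assumes f: "computable f" and g: "computable g" shows "computable (\<lambda>x. f x - g x)"
proof -
  have "computable (\<lambda>x. rec_nat (f x) (\<lambda>_ r. r - Suc 0) (g x))" by (intro comp_intros f g)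
  moreover have "rec_nat a (\<lambda>_ r. r - Suc 0) b = a - b" for a b by (induction b) auto
  ultimately show ?thesis by simp
qed

lemma computable_le_nat [comp_intros]:
  fixes f g :: "'a::coded \<Rightarrow> nat"
  assumes f: "computable f" and g: "computable g" shows "computable (\<lambda>x. f x \<le> g x)"
proof -
  have "computable (\<lambda>x. \<not> (dec (f x - g x) :: bool))" by (intro comp_intros f g)
  moreover have "\<not> (dec (a - b) :: bool) \<longleftrightarrow> a \<le> b" for a b by (auto simp: dec_bool_def)
  ultimately show ?thesis by simp
qed

lemma computable_less_nat [comp_intros]:
  fixes f g :: "'a::coded \<Rightarrow> nat"
  shows "computable f \<Longrightarrow> computable g \<Longrightarrow> computable (\<lambda>x. f x < g x)"
  by (drule (1) computable_le_nat[OF computable_Suc]) (simp add: Suc_le_eq)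

lemma computable_eq [comp_intros]:
  fixes f g :: "'a::coded \<Rightarrow> 'b::coded"
  assumes "computable f" "computable g" shows "computable (\<lambda>x. f x = g x)"
proof -
  have "computable (\<lambda>x. enc (f x) \<le> enc (g x) \<and> enc (g x) \<le> enc (f x))"
    by (intro comp_intros assms)
  moreover have "a \<le> b \<and> b \<le> a \<longleftrightarrow> a = b" for a b :: nat by auto
  ultimately show ?thesis by simp
qed

lemma computable_all_le [comp_intros]:
  fixes P :: "'a::coded \<Rightarrow> nat \<Rightarrow> bool"
  assumes "computable (\<lambda>z. P (fst z) (snd z))" and f: "computable f"
  shows "computable (\<lambda>x. \<forall>i\<le>f x. P x i)"
  using computable_all_less[OF assms(1) computable_Suc[OF f]] by (simp add: less_Suc_eq_le)

lemma computable_ex_le [comp_intros]: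
  fixes P :: "'a::coded \<Rightarrow> nat \<Rightarrow> bool"
  assumes "computable (\<lambda>z. P (fst z) (snd z))" and f: "computable f"
  shows "computable (\<lambda>x. \<exists>i\<le>f x. P x i)"
  using computable_ex_less[OF assms(1) computable_Suc[OF f]] by (simp add: less_Suc_eq_le)

lemma computable_dvd_nat [comp_intros]:
  fixes f g :: "'a::coded \<Rightarrow> nat"
  assumes f: "computable f" and g: "computable g" shows "computable (\<lambda>x. f x dvd g x)"
proof -
  have "computable (\<lambda>x. \<exists>k\<le>g x. g x = f x * k)"
    by (intro comp_intros computable_comp[OF f] computable_comp[OF g] g)
  moreover have "(\<exists>k\<le>b. b = a * k) \<longleftrightarrow> a dvd b" for a b :: nat
    by (cases "a = 0"; cases "b = 0") (auto simp: dvd_def)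
  ultimately show ?thesis by simp
qed

lemma computable_coprime_nat [comp_intros]:
  fixes f g :: "'a::coded \<Rightarrow> nat"
  assumes f: "computable f" and g: "computable g" and pos: "\<And>x. 0 < g x"
  shows "computable (\<lambda>x. coprime (f x) (g x))"
proof -
  have "computable (\<lambda>x. \<forall>d\<le>g x. d dvd f x \<and> d dvd g x \<longrightarrow> d = 1)"
    by (intro comp_intros computable_comp[OF f] computable_comp[OF g] g)
  moreover have "(\<forall>d\<le>b. d dvd a \<and> d dvd b \<longrightarrow> d = 1) \<longleftrightarrow> coprime a b" if "b > 0" for a b :: nat
    using that by (auto simp: coprime_def dest: dvd_imp_le)
  ultimately show ?thesis using pos by simp
qed

text \<open>A total function with decidable graph is computed by searching for its value. This
  replaces explicit algorithms, for instance for reducing fractions.\<close>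

lemma computable_graph:
  fixes f :: "'a::coded \<Rightarrow> 'b::coded"
  assumes "computable (\<lambda>z. P (fst z) (snd z))" and iff: "\<And>x y. P x y \<longleftrightarrow> y = f x"
  shows "computable f"
proof -
  have "computable (\<lambda>z. P (fst z) (dec (snd z)))"
    using computable_comp[OF assms(1), of "\<lambda>z. (fst z, dec (snd z))"] by (simp add: comp_intros)
  moreover have ex: "\<exists>n. P x (dec n)" for x
    using iff by (metis dec_enc)
  ultimately have "computable (\<lambda>x. dec (LEAST n. P x (dec n)) :: 'b)"
    by (intro computable_dec computable_Least) auto
  moreover have "dec (LEAST n. P x (dec n)) = f x" for x
    using LeastI_ex[OF ex[of x]] by (simp add: iff)
  ultimately show ?thesis by simp
qed

subsection \<open>Integers and rationals\<close>

lemma computable_int [comp_intros]: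
  assumes "computable f" shows "computable (\<lambda>x. int (f x))"
proof (rule computable_comp[OF _ assms])
  have "computable (\<lambda>n::nat. 2 * n)" by (intro comp_intros)
  thus "computable int"
    by (simp add: computable_def enc_int_def enc_nat_def dec_nat_def int_encode_def sum_encode_def)
qed

text \<open>The odd half of the coding of integers: - n - 1 has code 2 n + 1, just as
  \<open>int n\<close> has code 2 n.\<close>

lemma computable_neg_int:
  assumes "computable f" shows "computable (\<lambda>x. - int (f x) - 1)"
proof (rule computable_comp[OF _ assms])
  have "computable (\<lambda>n::nat. Suc (2 * n))" by (intro comp_intros)
  thus "computable (\<lambda>n. - int n - 1)"
    by (simp add: computable_def enc_int_def enc_nat_def dec_nat_def int_encode_def sum_encode_def)
qed

lemma enc_int_neg: "enc (- int m - 1) = Suc (2 * m)"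
  by (simp add: enc_int_def int_encode_def sum_encode_def)

lemma computable_nat [comp_intros]:
  assumes f: "computable f" shows "computable (\<lambda>x. nat (f x))"
proof (rule computable_comp[OF _ f])
  show "computable nat"
  proof (rule computable_graph)
    \<comment> \<open>Since - m - 1 has code 2 m + 1, the code of the integer bounds the search for
      m.\<close>
    show "computable (\<lambda>z. fst z = int (snd z) \<or>
        snd z = 0 \<and> (\<exists>m\<le>enc (fst z). fst z = - int m - 1))"
      by (intro comp_intros computable_neg_int)
    show "(x = int y \<or> y = 0 \<and> (\<exists>m\<le>enc x. x = - int m - 1)) \<longleftrightarrow> y = nat x" for x y
    proof (cases "x \<ge> 0")
      case False
      hence x: "x = - int (nat (- x - 1)) - 1" by simp
      have "nat (- x - 1) \<le> enc x" using enc_int_neg[of "nat (- x - 1)"] x by simp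
      hence "\<exists>m\<le>enc x. x = - int m - 1" using x by blast
      thus ?thesis using False by auto
    qed auto
  qed
qed

lemma computable_nat_uminus [comp_intros]:
  assumes f: "computable f" shows "computable (\<lambda>x. nat (- f x))"
proof (rule computable_comp[OF _ f])
  show "computable (\<lambda>x. nat (- x))"
  proof (rule computable_graph)
    show "computable (\<lambda>z. (fst z = int (nat (fst z)) \<and> snd z = 0) \<or>
        (0 < snd z \<and> fst z = - int (snd z - Suc 0) - 1))"
      by (intro comp_intros computable_neg_int)
    show "((x = int (nat x) \<and> y = 0) \<or> (0 < y \<and> x = - int (y - Suc 0) - 1)) \<longleftrightarrow> y = nat (- x)" for x y
      by auto
  qed
qed

text \<open>Addition, negation and multiplication of integers are computed on positive and negative
  parts, which are natural numbers, and recombined by this difference.\<close>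

lemma computable_diff_int_nat:
  fixes f g :: "'a::coded \<Rightarrow> nat"
  assumes f: "computable f" and g: "computable g"
  shows "computable (\<lambda>x. int (f x) - int (g x))"
proof -
  have "computable (\<lambda>x. if g x \<le> f x then int (f x - g x) else - int (g x - f x - Suc 0) - 1)"
    by (intro comp_intros f g computable_neg_int)
  moreover have "(if b \<le> a then int (a - b) else - int (b - a - Suc 0) - 1) = int a - int b" for a b
    by auto
  ultimately show ?thesis by simp
qed

lemma computable_add_int [comp_intros]:
  fixes f g :: "'a::coded \<Rightarrow> int"
  assumes f: "computable f" and g: "computable g" shows "computable (\<lambda>x. f x + g x)"
proof -
  have "computable (\<lambda>x. int (nat (f x) + nat (g x)) - int (nat (- f x) + nat (- g x)))"
    by (intro computable_diff_int_nat comp_intros f g)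
  moreover have "int (nat a + nat b) - int (nat (- a) + nat (- b)) = a + b" for a b by simp
  ultimately show ?thesis by simp
qed

lemma computable_uminus_int [comp_intros]:
  fixes f :: "'a::coded \<Rightarrow> int"
  assumes f: "computable f" shows "computable (\<lambda>x. - f x)"
proof -
  have "computable (\<lambda>x. int (nat (- f x)) - int (nat (f x)))"
    by (intro computable_diff_int_nat comp_intros f)
  moreover have "int (nat (- a)) - int (nat a) = - a" for a by simp
  ultimately show ?thesis by simp
qed

lemma computable_mult_int [comp_intros]:
  fixes f g :: "'a::coded \<Rightarrow> int"
  assumes f: "computable f" and g: "computable g" shows "computable (\<lambda>x. f x * g x)"
proof -
  have "computable (\<lambda>x. int (nat (f x) * nat (g x) + nat (- f x) * nat (- g x)) -
      int (nat (f x) * nat (- g x) + nat (- f x) * nat (g x)))"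
    by (intro computable_diff_int_nat comp_intros f g)
  moreover have "int (nat a * nat b + nat (- a) * nat (- b)) -
      int (nat a * nat (- b) + nat (- a) * nat b) = a * b" for a b
    by (cases "a \<ge> 0"; cases "b \<ge> 0") auto
  ultimately show ?thesis by simp
qed

lemma computable_less_int [comp_intros]:
  fixes f g :: "'a::coded \<Rightarrow> int"
  assumes f: "computable f" and g: "computable g" shows "computable (\<lambda>x. f x < g x)"
proof -
  have "computable (\<lambda>x. 0 < nat (g x + - f x))" by (intro comp_intros f g)
  thus ?thesis by simp
qed

lemma quotient_of_Fract_iff:
  assumes "b \<noteq> 0"
  shows "quotient_of (Fract a b) = y \<longleftrightarrow>
    snd y > 0 \<and> coprime (fst y) (snd y) \<and> a * snd y = fst y * b"
proof
  assume *: "quotient_of (Fract a b) = y"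
  have pos: "snd y > 0" using * quotient_of_denom_pos' by blast
  have "Fract (fst y) (snd y) = Fract a b" using Fract_quotient_of[of "Fract a b"] * by simp
  thus "snd y > 0 \<and> coprime (fst y) (snd y) \<and> a * snd y = fst y * b"
    using pos * assms quotient_of_coprime[of "Fract a b" "fst y" "snd y"] by (simp add: eq_rat)
next
  assume *: "snd y > 0 \<and> coprime (fst y) (snd y) \<and> a * snd y = fst y * b"
  hence "Fract a b = Fract (fst y) (snd y)" using assms by (simp add: eq_rat)
  thus "quotient_of (Fract a b) = y" using * quotient_of_unique[of "Fract a b"]
    by (metis Fract_quotient_of quotient_of_coprime quotient_of_denom_pos' prod.collapse)
qed

lemma computable_quotient_of_Fract:
  "computable (\<lambda>z. quotient_of (Fract (fst z) (snd z)))"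
proof (rule computable_graph)
  \<comment> \<open>\<open>Fract a 0\<close> is 0, with reduced form \<open>(0, 1)\<close>. The
    \<open>Suc\<close> makes the denominator positive for all candidates, as
    \<open>computable_coprime_nat\<close> demands.\<close>
  let ?P = "\<lambda>z y. if snd z = 0 then y = (0, 1) else
    0 < snd y \<and> coprime (nat (fst y) + nat (- fst y)) (Suc (nat (snd y) - Suc 0)) \<and>
    fst z * snd y = fst y * snd z"
  show "computable (\<lambda>z. ?P (fst z) (snd z))"
    by (intro comp_intros) simp
  show "?P z y \<longleftrightarrow> y = quotient_of (Fract (fst z) (snd z))" for z y
  proof (cases "snd z = 0")
    case True
    thus ?thesis by (simp add: rat_number_collapse)
  next
    case False
    have "coprime (nat u + nat (- u)) (Suc (nat v - Suc 0)) \<longleftrightarrow> coprime u v" if "v > 0" for u v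
    proof -
      have *: "int (nat u + nat (- u)) = \<bar>u\<bar>" "int (Suc (nat v - Suc 0)) = v" using that by auto
      have "coprime (int (nat u + nat (- u))) (int (Suc (nat v - Suc 0))) \<longleftrightarrow> coprime u v"
        unfolding * by simp
      thus ?thesis by (simp only: coprime_int_iff)
    qed
    thus ?thesis using quotient_of_Fract_iff[OF False, of "fst z" y] False by auto
  qed
qed

instantiation rat :: coded
begin
definition "enc q = enc (quotient_of q)"
definition "dec n = (case dec n of (a, b) \<Rightarrow> Fract a b)"
instance
proof
  show "recursive (\<lambda>n. enc (dec n :: rat))"
    using computable_quotient_of_Fract
    by (simp add: computable_def enc_rat_def dec_rat_def case_prod_unfold)
qed (simp add: enc_rat_def dec_rat_def case_prod_unfold)
end

lemma enc_rat_eq_rat_code: "enc q = rat_code q"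
  by (simp add: enc_rat_def rat_code_def enc_prod_def enc_int_def case_prod_unfold)

lemma computable_quotient_of [comp_intros]:
  "computable f \<Longrightarrow> computable (\<lambda>x. quotient_of (f x))"
  by (simp add: computable_def enc_rat_def)

lemma computable_Fract [comp_intros]:
  assumes "computable f" "computable g" shows "computable (\<lambda>x. Fract (f x) (g x))"
  using computable_comp[OF computable_quotient_of_Fract computable_Pair[OF assms]]
  by (simp add: computable_def enc_rat_def)

abbreviation "numer q \<equiv> fst (quotient_of q)"
abbreviation "denom q \<equiv> snd (quotient_of q)"

lemma denom_nonzero: "denom q \<noteq> 0" 
  using quotient_of_denom_pos'[of q] by simp

lemma computable_add_rat [comp_intros]:
  fixes f g :: "'a::coded \<Rightarrow> rat"
  assumes f: "computable f" and g: "computable g" shows "computable (\<lambda>x. f x + g x)"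
proof -
  have "computable (\<lambda>x. Fract (numer (f x) * denom (g x) + numer (g x) * denom (f x)) (denom (f x) * denom (g x)))"
    by (intro comp_intros f g)
  moreover have "Fract (numer a * denom b + numer b * denom a) (denom a * denom b) = a + b" for a b
    using add_rat[OF denom_nonzero[of a] denom_nonzero[of b], of "numer a" "numer b"] by simp
  ultimately show ?thesis by simp
qed

lemma computable_mult_rat [comp_intros]:
  fixes f g :: "'a::coded \<Rightarrow> rat"
  assumes f: "computable f" and g: "computable g" shows "computable (\<lambda>x. f x * g x)"
proof -
  have "computable (\<lambda>x. Fract (numer (f x) * numer (g x)) (denom (f x) * denom (g x)))"
    by (intro comp_intros f g)
  moreover have "Fract (numer a * numer b) (denom a * denom b) = a * b" for a b
    using mult_rat[of "numer a" "denom a" "numer b" "denom b"] by simp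
  ultimately show ?thesis by simp
qed

lemma computable_uminus_rat [comp_intros]:
  fixes f :: "'a::coded \<Rightarrow> rat"
  assumes f: "computable f" shows "computable (\<lambda>x. - f x)"
  using computable_mult_rat[OF computable_const[of "-1"] f] by simp

lemma computable_diff_rat [comp_intros]:
  fixes f g :: "'a::coded \<Rightarrow> rat"
  assumes f: "computable f" and g: "computable g" shows "computable (\<lambda>x. f x - g x)"
  using computable_add_rat[OF f computable_uminus_rat[OF g]] by simp

lemma computable_inverse_rat [comp_intros]:
  fixes f :: "'a::coded \<Rightarrow> rat"
  assumes f: "computable f" shows "computable (\<lambda>x. inverse (f x))"
proof -
  have "computable (\<lambda>x. Fract (denom (f x)) (numer (f x)))" by (intro comp_intros f)
  moreover have "Fract (denom a) (numer a) = inverse a" for a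
    using inverse_rat[of "numer a" "denom a"] by simp
  ultimately show ?thesis by simp
qed

lemma computable_divide_rat [comp_intros]:
  fixes f g :: "'a::coded \<Rightarrow> rat"
  assumes f: "computable f" and g: "computable g" shows "computable (\<lambda>x. f x / g x)"
  using computable_mult_rat[OF f computable_inverse_rat[OF g]] by (simp add: divide_inverse)

lemma computable_less_rat [comp_intros]:
  fixes f g :: "'a::coded \<Rightarrow> rat"
  assumes f: "computable f" and g: "computable g" shows "computable (\<lambda>x. f x < g x)"
proof -
  have "computable (\<lambda>x. numer (f x) * denom (g x) < numer (g x) * denom (f x))"
    by (intro comp_intros f g)
  moreover have "numer a * denom b < numer b * denom a \<longleftrightarrow> a < b" for a b
  proof -
    have "Fract (numer a) (denom a) < Fract (numer b) (denom b) \<longleftrightarrow>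
      (numer a * denom b) * (denom a * denom b) < (numer b * denom a) * (denom a * denom b)"
      using less_rat[OF denom_nonzero[of a] denom_nonzero[of b]] .
    moreover have "0 < denom a * denom b" using quotient_of_denom_pos' by simp
    ultimately show ?thesis by (simp add: mult_less_cancel_right)
  qed
  ultimately show ?thesis by simp
qed

lemma computable_le_rat [comp_intros]:
  fixes f g :: "'a::coded \<Rightarrow> rat"
  assumes f: "computable f" and g: "computable g" shows "computable (\<lambda>x. f x \<le> g x)"
  using computable_not[OF computable_less_rat[OF g f]] by (simp add: not_less)

lemma computable_power_rat [comp_intros]:
  fixes f :: "'a::coded \<Rightarrow> rat"
  assumes f: "computable f" and g: "computable g" shows "computable (\<lambda>x. f x ^ g x)"
proof -
  have "computable (\<lambda>x. rec_nat 1 (\<lambda>_ r. f x * r) (g x))"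
    by (intro comp_intros f g computable_comp[OF f])
  moreover have "rec_nat 1 (\<lambda>_ r. a * r) b = a ^ b" for a :: rat and b by (induction b) auto
  ultimately show ?thesis by simp
qed

lemma computable_of_nat_rat [comp_intros]:
  assumes f: "computable f" shows "computable (\<lambda>x. rat_of_nat (f x))"
proof -
  have "computable (\<lambda>x. Fract (int (f x)) 1)" by (intro comp_intros f)
  thus ?thesis by (simp add: of_nat_rat)
qed

lemma computable_sum_rat [comp_intros]:
  fixes f :: "'a::coded \<Rightarrow> nat \<Rightarrow> rat"
  assumes f: "computable (\<lambda>z. f (fst z) (snd z))" and g: "computable g"
  shows "computable (\<lambda>x. \<Sum>i<g x. f x i)"
proof -
  have f': "computable (\<lambda>z. f (fst z) (fst (snd z)))"
    using computable_comp[OF f, of "\<lambda>z. (fst z, fst (snd z))"] by (simp add: comp_intros)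
  have "computable (\<lambda>x. rec_nat 0 (\<lambda>i r. r + f x i) (g x))"
    by (intro comp_intros g f')
  moreover have "rec_nat 0 (\<lambda>i r. r + h i) b = (\<Sum>i<b. h i)" for h :: "nat \<Rightarrow> rat" and b
    by (induction b) auto
  ultimately show ?thesis by simp
qed

subsection \<open>Lists\<close>

text \<open>The code of a list bounds the number of rounds needed to consume it, so that folding
  becomes a recursion of known depth.\<close>

lemma length_le_list_encode: "length xs \<le> list_encode xs"
proof (induction xs)
  case (Cons x xs)
  thus ?case using le_prod_encode_2[of "list_encode xs" x] by simp
qed simp

lemma computable_fold_list_decode:
  fixes f :: "'a::coded \<Rightarrow> 'b::coded"
  assumes f: "computable f" and g: "computable (\<lambda>z. g (fst z) (fst (snd z)) (snd (snd z)))"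
    and h: "computable h"
  shows "computable (\<lambda>x. fold (g x) (list_decode (h x)) (f x))"
proof -
  let ?hd = "\<lambda>r. fst (dec (r - Suc 0) :: nat \<times> nat)" and ?tl = "\<lambda>r. snd (dec (r - Suc 0) :: nat \<times> nat)"
  \<comment> \<open>The state holds the code of the unread suffix and the accumulator. Code 0 is the
    empty list, so surplus rounds change nothing.\<close>
  let ?step = "\<lambda>x s. if fst s = 0 then s else (?tl (fst s), g x (?hd (fst s)) (snd s))"
  have "computable (\<lambda>z. g (fst z) (?hd (fst (snd (snd z)))) (snd (snd (snd z))))"
    using computable_comp[OF g, of "\<lambda>z. (fst z, ?hd (fst (snd (snd z))), snd (snd (snd z)))"]
    by (simp add: comp_intros)
  hence "computable (\<lambda>x. snd (rec_nat (h x, f x) (\<lambda>_ s. ?step x s) (h x)))"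
    by (intro comp_intros f h)
  moreover have "snd (rec_nat (h x, f x) (\<lambda>_ s. ?step x s) (h x)) = fold (g x) (list_decode (h x)) (f x)" for x
  proof -
    obtain xs where xs: "h x = list_encode xs" by (metis list_decode_inverse)
    have *: "rec_nat (list_encode ys, a) (\<lambda>_ s. ?step x s) n = (list_encode (drop n ys), fold (g x) (take n ys) a)" for n ys a
    proof (induction n)
      case (Suc n)
      show ?case
      proof (cases "n < length ys")
        case True
        hence d: "drop n ys = ys ! n # drop (Suc n) ys" by (simp add: Cons_nth_drop_Suc)
        show ?thesis using True by (simp add: Suc d take_Suc_conv_app_nth dec_prod_def dec_nat_def)
      next
        case False
        thus ?thesis by (simp add: Suc)
      qed
    qed simp
    show ?thesis unfolding xs * using length_le_list_encode[of xs] by simp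
  qed
  ultimately show ?thesis by simp
qed

text \<open>Consing onto an accumulator reverses the list; a second pass with the identity restores
  the order.\<close>

lemma recursive_map_list_code:
  assumes "recursive h" shows "recursive (\<lambda>n. list_encode (map h (list_decode n)))"
proof -
  have snoc: "fold (\<lambda>x acc. Suc (prod_encode (k x, acc))) xs (list_encode ys) = list_encode (rev (map k xs) @ ys)"
    for k xs ys
  proof (induction xs arbitrary: ys)
    case (Cons a xs)
    show ?case using Cons[of "k a # ys"] by simp
  qed simp
  have rev: "recursive (\<lambda>n. list_encode (rev (map k (list_decode n))))" if "recursive k" for k
  proof -
    have k: "computable k" using that by (simp add: computable_nat_iff)
    have "computable (\<lambda>n::nat. fold (\<lambda>x acc. Suc (enc (k x, acc))) (list_decode n) 0)"
      by (intro computable_fold_list_decode comp_intros computable_comp[OF k])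
    thus ?thesis using snoc[of k _ "[]"] by (simp add: computable_nat_iff enc_prod_def enc_nat_def)
  qed
  from recursive_comp[OF rev[OF recursive_id] rev[OF assms]] show ?thesis by (simp add: rev_map)
qed

instantiation list :: (coded) coded
begin
definition "enc xs = list_encode (map enc xs)"
definition "dec n = map dec (list_decode n)"
instance
proof
  show "recursive (\<lambda>n. enc (dec n :: 'a list))"
    using recursive_map_list_code[OF recursive_enc_dec] by (simp add: enc_list_def dec_list_def o_def)
qed (simp add: enc_list_def dec_list_def o_def)
end

lemma computable_Cons [comp_intros]:
  "computable f \<Longrightarrow> computable g \<Longrightarrow> computable (\<lambda>x. f x # g x)"
  unfolding computable_def enc_list_def list.map list_encode.simps
  by (intro recursive_comp[OF recursive_Suc] recursive_pair)

lemma computable_fold [comp_intros]: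
  fixes f :: "'a::coded \<Rightarrow> 'b::coded" and h :: "'a \<Rightarrow> 'c::coded list"
  assumes f: "computable f" and g: "computable (\<lambda>z. g (fst z) (fst (snd z)) (snd (snd z)))"
    and h: "computable h"
  shows "computable (\<lambda>x. fold (g x) (h x) (f x))"
proof -
  have "computable (\<lambda>z. g (fst z) (dec (fst (snd z))) (snd (snd z)))"
    using computable_comp[OF g, of "\<lambda>z. (fst z, dec (fst (snd z)), snd (snd z))"]
    by (simp add: comp_intros)
  hence "computable (\<lambda>x. fold (\<lambda>n. g x (dec n)) (list_decode (enc (h x))) (f x))"
    by (intro computable_fold_list_decode comp_intros f h)
  thus ?thesis by (simp add: enc_list_def fold_map o_def)
qed

lemma computable_rev [comp_intros]:
  assumes "computable h" shows "computable (\<lambda>x. rev (h x))"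
proof -
  have "computable (\<lambda>x. fold (\<lambda>a b. a # b) (h x) [])" by (intro comp_intros assms)
  thus ?thesis by (simp add: fold_Cons_rev)
qed

lemma computable_append [comp_intros]:
  assumes "computable g" "computable h" shows "computable (\<lambda>x. g x @ h x)"
proof -
  have "computable (\<lambda>x. fold (\<lambda>a b. a # b) (rev (g x)) (h x))" by (intro comp_intros assms)
  thus ?thesis by (simp add: fold_Cons_rev)
qed

lemma computable_map [comp_intros]:
  fixes f :: "'a::coded \<Rightarrow> 'b::coded \<Rightarrow> 'c::coded"
  assumes f: "computable (\<lambda>z. f (fst z) (snd z))" and h: "computable h"
  shows "computable (\<lambda>x. map (f x) (h x))"
proof -
  have f': "computable (\<lambda>z. f (fst z) (fst (snd z)))"
    using computable_comp[OF f, of "\<lambda>z. (fst z, fst (snd z))"] by (simp add: comp_intros)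
  have "computable (\<lambda>x. rev (fold (\<lambda>a b. f x a # b) (h x) []))" by (intro comp_intros h f')
  moreover have "fold (\<lambda>a b. k a # b) xs ys = rev (map k xs) @ ys" for k :: "'b \<Rightarrow> 'c" and xs ys
    by (induction xs arbitrary: ys) auto
  ultimately show ?thesis by simp
qed

lemma computable_length [comp_intros]:
  assumes "computable h" shows "computable (\<lambda>x. length (h x))"
proof -
  have "computable (\<lambda>x. fold (\<lambda>_ b. Suc b) (h x) 0)" by (intro comp_intros assms)
  moreover have "fold (\<lambda>_ b. Suc b) xs n = n + length xs" for xs :: "'b list" and n
    by (induction xs arbitrary: n) auto
  ultimately show ?thesis by simp
qed

lemma computable_in_set [comp_intros]:
  assumes f: "computable f" and h: "computable h" shows "computable (\<lambda>x. f x \<in> set (h x))"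
proof -
  have "computable (\<lambda>x. fold (\<lambda>a b. f x = a \<or> b) (h x) False)"
    by (intro comp_intros f h computable_comp[OF f])
  moreover have "fold (\<lambda>a b. y = a \<or> b) xs c \<longleftrightarrow> y \<in> set xs \<or> c" for y :: 'b and xs c
    by (induction xs arbitrary: c) auto
  ultimately show ?thesis by simp
qed

lemma computable_tl [comp_intros]:
  fixes h :: "'a::coded \<Rightarrow> 'b::coded list"
  assumes "computable h" shows "computable (\<lambda>x. tl (h x))"
proof -
  have eq: "dec (snd (dec (enc xs - Suc 0) :: nat \<times> nat)) = tl xs" for xs :: "'b list"
  proof (cases xs)
    case Nil
    have "prod_decode 0 = (0, 0)" by (simp add: prod_decode_def prod_decode_aux.simps)
    thus ?thesis using Nil by (simp add: enc_list_def dec_list_def dec_prod_def dec_nat_def)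
  qed (simp add: enc_list_def dec_list_def dec_prod_def dec_nat_def o_def)
  have "computable (\<lambda>x. dec (snd (dec (enc (h x) - Suc 0) :: nat \<times> nat)) :: 'b list)"
    by (intro comp_intros assms)
  thus ?thesis unfolding eq .
qed

lemma computable_drop [comp_intros]:
  assumes f: "computable f" and h: "computable h" shows "computable (\<lambda>x. drop (f x) (h x))"
proof -
  have "computable (\<lambda>x. rec_nat (h x) (\<lambda>_ r. tl r) (f x))" by (intro comp_intros f h)
  moreover have "rec_nat xs (\<lambda>_ r. tl r) n = drop n xs" for xs :: "'b list" and n
    by (induction n) (auto simp: drop_Suc tl_drop)
  ultimately show ?thesis by simp
qed

text \<open>Indexing beyond the end is unspecified for \<open>!\<close>, so nothing could be proved
  about its computability; a default makes lookup total.\<close>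

definition lnth :: "'a::coded list \<Rightarrow> nat \<Rightarrow> 'a" where
  "lnth xs i = (if i < length xs then xs ! i else dec 0)"

lemma lnth_eq [simp]: "i < length xs \<Longrightarrow> lnth xs i = xs ! i"
  by (simp add: lnth_def)

lemma computable_lnth [comp_intros]:
  fixes h :: "'a::coded \<Rightarrow> 'b::coded list"
  assumes f: "computable f" and h: "computable h" shows "computable (\<lambda>x. lnth (h x) (f x))"
proof -
  have "computable (\<lambda>x. if f x < length (h x)
      then dec (fst (dec (enc (drop (f x) (h x)) - Suc 0) :: nat \<times> nat)) else dec 0 :: 'b)"
    by (intro comp_intros f h)
  moreover have "dec (fst (dec (enc (drop i xs) - Suc 0) :: nat \<times> nat)) = xs ! i"
    if "i < length xs" for i and xs :: "'b list"
    by (simp add: Cons_nth_drop_Suc[OF that, symmetric] enc_list_def dec_prod_def dec_nat_def)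
  ultimately show ?thesis by (simp add: lnth_def cong: if_cong)
qed

subsection \<open>Semidecidable predicates\<close>

text \<open>Recursive enumerability as the projection of a decidable relation. In this form closure
  under existential quantifiers amounts to packing witnesses into one number.\<close>

definition semidec :: "('a::coded \<Rightarrow> bool) \<Rightarrow> bool" where
  "semidec P \<longleftrightarrow> (\<exists>R :: 'a \<times> nat \<Rightarrow> bool. computable R \<and> (\<forall>x. P x \<longleftrightarrow> (\<exists>n. R (x, n))))"

named_theorems semi_intros

lemma semidec_computable:
  assumes "computable P" shows "semidec P"
  unfolding semidec_def
  by (rule exI[of _ "\<lambda>z. P (fst z)"]) (intro conjI computable_comp[OF assms] comp_intros, simp)

lemma semidec_comp:
  assumes "semidec P" and f: "computable f" shows "semidec (\<lambda>x. P (f x))"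
proof -
  from assms(1) obtain R where R: "computable R" "\<And>x. P x \<longleftrightarrow> (\<exists>n. R (x, n::nat))"
    unfolding semidec_def by blast
  have "computable (\<lambda>z. R (f (fst z), snd z))"
    by (intro computable_comp[OF R(1)] computable_comp[OF f] comp_intros)
  thus ?thesis unfolding semidec_def
    by (intro exI[of _ "\<lambda>z. R (f (fst z), snd z)"]) (simp add: R(2))
qed

lemma semidec_ex [semi_intros]:
  fixes P :: "'a::coded \<Rightarrow> 'b::coded \<Rightarrow> bool"
  assumes "semidec (\<lambda>z. P (fst z) (snd z))" shows "semidec (\<lambda>x. \<exists>y. P x y)"
proof -
  from assms obtain R :: "('a \<times> 'b) \<times> nat \<Rightarrow> bool"
    where R: "computable R" "\<And>x y. P x y \<longleftrightarrow> (\<exists>n. R ((x, y), n))"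
    unfolding semidec_def by auto
  have "computable (\<lambda>z. case dec (snd z) of (y, n) \<Rightarrow> R ((fst z, y), n))" (is "computable ?R")
    unfolding case_prod_unfold by (intro computable_comp[OF R(1)] comp_intros)
  moreover have "(\<exists>y. P x y) \<longleftrightarrow> (\<exists>n. ?R (x, n))" for x
  proof
    assume "\<exists>y. P x y"
    then obtain y n where "R ((x, y), n)" using R(2) by blast
    thus "\<exists>n. ?R (x, n)" by (intro exI[of _ "enc (y, n)"]) (simp only: snd_conv fst_conv dec_enc case_prod_conv)
  qed (auto simp: R(2) case_prod_unfold)
  ultimately show ?thesis unfolding semidec_def by blast
qed

lemma semidec_conj [semi_intros]:
  assumes "semidec P" "semidec Q" shows "semidec (\<lambda>x. P x \<and> Q x)"
proof -
  from assms obtain R S where R: "computable R" "\<And>x. P x \<longleftrightarrow> (\<exists>n. R (x, n::nat))"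
    and S: "computable S" "\<And>x. Q x \<longleftrightarrow> (\<exists>n. S (x, n::nat))"
    unfolding semidec_def by blast
  have "semidec (\<lambda>x. \<exists>n m. R (x, n) \<and> S (x, m))"
    by (intro semidec_ex semidec_computable computable_conj
        computable_comp[OF R(1)] computable_comp[OF S(1)] comp_intros)
  thus ?thesis by (simp add: R(2) S(2))
qed

lemma semidec_disj [semi_intros]:
  assumes "semidec P" "semidec Q" shows "semidec (\<lambda>x. P x \<or> Q x)"
proof -
  from assms obtain R S where R: "computable R" "\<And>x. P x \<longleftrightarrow> (\<exists>n. R (x, n::nat))"
    and S: "computable S" "\<And>x. Q x \<longleftrightarrow> (\<exists>n. S (x, n::nat))"
    unfolding semidec_def by blast
  have "semidec (\<lambda>x. \<exists>n. R (x, n) \<or> S (x, n))"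
    by (intro semidec_ex semidec_computable computable_disj
        computable_comp[OF R(1)] computable_comp[OF S(1)] comp_intros)
  thus ?thesis by (simp add: R(2) S(2) ex_disj_distrib)
qed

text \<open>Finitely many witnesses have a common bound, so the unbounded existential moves in front
  of the bounded universal quantifier.\<close>

lemma semidec_all_less [semi_intros]:
  fixes P :: "'a::coded \<Rightarrow> nat \<Rightarrow> bool"
  assumes "semidec (\<lambda>z. P (fst z) (snd z))" and f: "computable f"
  shows "semidec (\<lambda>x. \<forall>i<f x. P x i)"
proof -
  from assms(1) obtain R :: "('a \<times> nat) \<times> nat \<Rightarrow> bool"
    where R: "computable R" "\<And>x y. P x y \<longleftrightarrow> (\<exists>n. R ((x, y), n))"
    unfolding semidec_def by auto
  have "semidec (\<lambda>x. \<exists>m::nat. \<forall>i<f x. \<exists>n<m. R ((x, i), n))"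
    by (intro semidec_ex semidec_computable computable_comp[OF R(1)] computable_comp[OF f] comp_intros)
  moreover have "(\<exists>m::nat. \<forall>i<k. \<exists>n<m. R ((x, i), n)) \<longleftrightarrow> (\<forall>i<k. P x i)" for x k
  proof (induction k)
    case (Suc k)
    show ?case (is "(\<exists>m. ?A m) \<longleftrightarrow> ?B")
    proof
      assume ?B
      then obtain m n where m: "\<forall>i<k. \<exists>n<m. R ((x, i), n)" and n: "R ((x, k), n)"
        using Suc R(2) by (metis less_Suc_eq)
      have "?A (max m (Suc n))" using m n by (metis less_Suc_eq less_max_iff_disj)
      thus "\<exists>m. ?A m" ..
    qed (auto simp: R(2))
  qed simp
  ultimately show ?thesis by simp
qed

lemma semidec_eq [semi_intros]:
  "computable f \<Longrightarrow> computable g \<Longrightarrow> semidec (\<lambda>x. f x = g x)"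
  by (intro semidec_computable comp_intros)

lemma semidec_neq [semi_intros]:
  "computable f \<Longrightarrow> computable g \<Longrightarrow> semidec (\<lambda>x. f x \<noteq> g x)"
  by (intro semidec_computable comp_intros)

lemma semidec_less_nat [semi_intros]:
  fixes f g :: "'a::coded \<Rightarrow> nat"
  shows "computable f \<Longrightarrow> computable g \<Longrightarrow> semidec (\<lambda>x. f x < g x)"
  by (intro semidec_computable comp_intros)

lemma semidec_less_rat [semi_intros]:
  fixes f g :: "'a::coded \<Rightarrow> rat"
  shows "computable f \<Longrightarrow> computable g \<Longrightarrow> semidec (\<lambda>x. f x < g x)"
  by (intro semidec_computable comp_intros)

lemma semidec_le_rat [semi_intros]:
  fixes f g :: "'a::coded \<Rightarrow> rat"
  shows "computable f \<Longrightarrow> computable g \<Longrightarrow> semidec (\<lambda>x. f x \<le> g x)"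
  by (intro semidec_computable comp_intros)

lemma semidec_in_set [semi_intros]:
  "computable f \<Longrightarrow> computable g \<Longrightarrow> semidec (\<lambda>x. f x \<in> set (g x))"
  by (intro semidec_computable comp_intros)

text \<open>The selector searches through all candidates and all witnesses simultaneously.\<close>

lemma semidec_choice:
  fixes P :: "'a::coded \<Rightarrow> 'b::coded \<Rightarrow> bool"
  assumes "semidec (\<lambda>z. P (fst z) (snd z))" and ex: "\<And>x. \<exists>y. P x y"
  obtains f where "computable f" "\<And>x. P x (f x)"
proof -
  from assms(1) obtain R :: "('a \<times> 'b) \<times> nat \<Rightarrow> bool"
    where R: "computable R" "\<And>x y. P x y \<longleftrightarrow> (\<exists>n. R ((x, y), n))"
    unfolding semidec_def by auto
  define S where "S x n = (case dec n of (y, m) \<Rightarrow> R ((x, y), m))" for x n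
  have "computable (\<lambda>z. S (fst z) (snd z))"
    unfolding S_def case_prod_unfold by (intro computable_comp[OF R(1)] comp_intros)
  moreover have ex': "\<exists>n. S x n" for x
  proof -
    obtain y n where "R ((x, y), n)" using ex R(2) by blast
    thus ?thesis by (intro exI[of _ "enc (y, n)"]) (simp add: S_def)
  qed
  ultimately have "computable (\<lambda>x. fst (dec (LEAST n. S x n) :: 'b \<times> nat))"
    by (intro comp_intros)
  moreover have "P x (fst (dec (LEAST n. S x n) :: 'b \<times> nat))" for x
    using LeastI_ex[OF ex'[of x]] R(2) unfolding S_def case_prod_unfold by blast
  ultimately show thesis by (rule that)
qed

subsection \<open>A universal semidecidable relation\<close>

definition program :: "nat \<Rightarrow> nat \<Rightarrow> nat \<Rightarrow> nat" where
  "program t a b = enc (t, a, b)"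

abbreviation pr :: "nat \<Rightarrow> nat \<Rightarrow> nat" where "pr a b \<equiv> enc (a, b)"

lemma program_eq_iff [simp]: "program t a b = program t' a' b' \<longleftrightarrow> t = t' \<and> a = a' \<and> b = b'"
  unfolding program_def enc_eq_iff by simp

text \<open>The tags 0 to 7 stand for the constructors of \<^const>\<open>partrec\<close>, in the order of its definition.\<close>

definition eval_step :: "(nat \<Rightarrow> nat \<Rightarrow> nat \<Rightarrow> bool) \<Rightarrow> nat \<Rightarrow> nat \<Rightarrow> nat \<Rightarrow> bool" where
  "eval_step X e n v \<longleftrightarrow>
    (\<exists>f g. e = program 0 f g \<and> v = 0) \<or>
    (\<exists>f g. e = program 1 f g \<and> v = Suc n) \<or>
    (\<exists>f g m. e = program 2 f g \<and> n = pr v m) \<or>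
    (\<exists>f g m. e = program 3 f g \<and> n = pr m v) \<or>
    (\<exists>f g v1 v2. e = program 4 f g \<and> v = pr v1 v2 \<and> X f n v1 \<and> X g n v2) \<or>
    (\<exists>f g w. e = program 5 f g \<and> X g n w \<and> X f w v) \<or>
    (\<exists>f g a. e = program 6 f g \<and> n = pr a 0 \<and> X f a v) \<or>
    (\<exists>f g a i r. e = program 6 f g \<and> n = pr a (Suc i) \<and> X e (pr a i) r \<and> X g (pr a (pr i r)) v) \<or>
    (\<exists>f g. e = program 7 f g \<and> (\<forall>m<v. \<exists>w. X f (pr n m) (Suc w)) \<and> X f (pr n v) 0)"

lemma eval_step_mono:
  assumes "X \<le> Y" shows "eval_step X e n v \<longrightarrow> eval_step Y e n v"
proof -
  have XY: "X e n v \<longrightarrow> Y e n v" for e n v using assms by (auto simp: le_fun_def)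
  show ?thesis
    unfolding eval_step_def by (intro disj_mono conj_mono ex_mono all_mono imp_mono XY imp_refl)
qed

inductive eval :: "nat \<Rightarrow> nat \<Rightarrow> nat \<Rightarrow> bool" where
  step: "eval_step eval e n v \<Longrightarrow> eval e n v"
  monos eval_step_mono

lemma eval_iff: "eval e n v \<longleftrightarrow> eval_step eval e n v"
  using eval.cases eval.step by blast

abbreviation in_list :: "(nat \<times> nat \<times> nat) list \<Rightarrow> nat \<Rightarrow> nat \<Rightarrow> nat \<Rightarrow> bool" where
  "in_list L e n v \<equiv> (e, n, v) \<in> set L"

text \<open>This is the purpose of abstracting \<open>eval_step\<close> over a relation: with
  membership in a finite list in its place, one evaluation step is built from decidable facts by
  existential and bounded quantifiers.\<close>

lemma semidec_eval_step [semi_intros]: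
  assumes "computable L" "computable e" "computable n" "computable v"
  shows "semidec (\<lambda>x. eval_step (in_list (L x)) (e x) (n x) (v x))"
proof -
  have "semidec (\<lambda>z. eval_step (in_list (fst z)) (fst (snd z)) (fst (snd (snd z))) (snd (snd (snd z))))"
    unfolding eval_step_def program_def by (intro semi_intros comp_intros)
  from semidec_comp[OF this, of "\<lambda>x. (L x, e x, n x, v x)"] show ?thesis
    using assms by (simp add: comp_intros)
qed

text \<open>Certificates for \<^const>\<open>eval\<close>: lists in which every entry follows from later ones.\<close>

inductive eval_trace :: "(nat \<times> nat \<times> nat) list \<Rightarrow> bool" where
  "eval_trace []"
| "eval_trace L \<Longrightarrow> eval_step (in_list L) e n v \<Longrightarrow> eval_trace ((e, n, v) # L)"

lemma eval_trace_sound: "eval_trace L \<Longrightarrow> in_list L \<le> eval"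
proof (induction rule: eval_trace.induct)
  case (2 L e n v)
  hence "eval e n v" using eval_step_mono[of "in_list L" eval e n v] by (auto intro: eval.step)
  thus ?case using 2 by (auto simp: le_fun_def)
qed (simp add: le_fun_def)

lemma eval_trace_append: "eval_trace L \<Longrightarrow> eval_trace M \<Longrightarrow> eval_trace (L @ M)"
proof (induction rule: eval_trace.induct)
  case (2 L e n v)
  have "eval_step (in_list (L @ M)) e n v"
    using eval_step_mono[of "in_list L" "in_list (L @ M)" e n v] 2 by (auto simp: le_fun_def)
  thus ?case using 2 by (auto intro: eval_trace.intros)
qed simp

text \<open>Every rule has finitely many premises, so their traces can be concatenated and the new
  fact put in front. \<open>Xall\<close> serves minimization, where the number of premises depends
  on the value.\<close>

lemma eval_trace_complete: "eval e n v \<Longrightarrow> \<exists>L. eval_trace L \<and> in_list L e n v"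
proof (induction rule: eval.induct)
  case (step e n v)
  define X where "X = (\<lambda>e n v. \<exists>L. eval_trace L \<and> in_list L e n v)"
  have X2: "\<exists>L. eval_trace L \<and> in_list L e n v \<and> in_list L e' n' v'" if "X e n v" "X e' n' v'" for e n v e' n' v'
  proof -
    from that obtain L M where "eval_trace L" "eval_trace M" "in_list L e n v" "in_list M e' n' v'"
      unfolding X_def by blast
    thus ?thesis by (intro exI[of _ "L @ M"]) (simp add: eval_trace_append)
  qed
  have Xall: "\<exists>L. eval_trace L \<and> (\<forall>m<k. \<exists>w. in_list L f (pr n m) (Suc w)) \<and> in_list L f' n' v'"
    if "\<forall>m<k. \<exists>w. X f (pr n m) (Suc w)" "X f' n' v'" for f n k f' n' v'
    using that
  proof (induction k)
    case 0
    thus ?case unfolding X_def by auto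
  next
    case (Suc k)
    then obtain L where L: "eval_trace L" "\<forall>m<k. \<exists>w. in_list L f (pr n m) (Suc w)" "in_list L f' n' v'"
      by auto
    from Suc.prems obtain M w where M: "eval_trace M" "in_list M f (pr n k) (Suc w)"
      unfolding X_def by blast
    have "\<forall>m<Suc k. \<exists>w. in_list (L @ M) f (pr n m) (Suc w)"
      using L M by (auto simp: less_Suc_eq)
    thus ?case using L M by (intro exI[of _ "L @ M"]) (simp add: eval_trace_append)
  qed
  have nil: "eval_trace []" by (rule eval_trace.intros)
  have "eval_step X e n v"
    by (rule mp[OF eval_step_mono step]) (auto simp: le_fun_def X_def)
  hence "\<exists>L. eval_trace L \<and> eval_step (in_list L) e n v"
    unfolding eval_step_def
  proof (elim disjE exE conjE, goal_cases)
    case (5 f g v1 v2)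
    from X2[OF 5(3,4)] show ?case using 5(1,2) by auto
  next
    case (6 f g w)
    from X2[OF 6(2,3)] show ?case using 6(1) by auto
  next
    case (7 f g a)
    thus ?case unfolding X_def by auto
  next
    case (8 f g a i r)
    from X2[OF 8(3,4)] show ?case using 8(1,2) by auto
  next
    case (9 f g)
    from Xall[OF 9(2,3)] show ?case using 9(1) by auto
  qed (use nil in auto)
  then obtain L where "eval_trace L" "eval_step (in_list L) e n v" by blast
  thus ?case by (intro exI[of _ "(e, n, v) # L"]) (auto intro: eval_trace.intros)
qed

text \<open>Replaces the inductive predicate by a bounded quantifier over positions, to which the
  closure rules of \<open>semidec\<close> apply.\<close>

lemma eval_trace_iff: "eval_trace L \<longleftrightarrow> (\<forall>i<length L.
  eval_step (in_list (drop (Suc i) L)) (fst (lnth L i)) (fst (snd (lnth L i))) (snd (snd (lnth L i))))"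
proof (induction L)
  case (Cons x L)
  have "eval_trace (x # L) \<longleftrightarrow> eval_trace L \<and> eval_step (in_list L) (fst x) (fst (snd x)) (snd (snd x))"
    by (cases x) (auto elim: eval_trace.cases intro: eval_trace.intros)
  also have "\<dots> \<longleftrightarrow> (\<forall>i<length (x # L). eval_step (in_list (drop (Suc i) (x # L))) (fst (lnth (x # L) i))
      (fst (snd (lnth (x # L) i))) (snd (snd (lnth (x # L) i))))"
    unfolding Cons length_Cons All_less_Suc2 by (auto simp: lnth_def)
  finally show ?case .
qed (auto intro: eval_trace.intros)

lemma semidec_eval [semi_intros]:
  assumes "computable e" "computable n" "computable v"
  shows "semidec (\<lambda>x. eval (e x) (n x) (v x))"
proof -
  have "eval e n v \<longleftrightarrow> (\<exists>L. eval_trace L \<and> (e, n, v) \<in> set L)" for e n v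
    using eval_trace_sound[unfolded le_fun_def le_bool_def] eval_trace_complete by blast
  moreover have "semidec (\<lambda>x. \<exists>L. eval_trace L \<and> (e x, n x, v x) \<in> set L)"
    unfolding eval_trace_iff
    by (intro semi_intros comp_intros assms[THEN computable_comp])
  ultimately show ?thesis by simp
qed


text \<open>Every partial recursive function has an index. Each constructor corresponds to one tag,
  and unary constructors fill the spare slots of \<open>program\<close> with 0.\<close>

lemma partrec_eval: "partrec \<phi> \<Longrightarrow> \<exists>e. \<forall>n v. \<phi> n = Some v \<longleftrightarrow> eval e n v"
proof (induction rule: partrec.induct)
  case zero
  show ?case by (rule exI[of _ "program 0 0 0"], subst eval_iff) (auto simp: eval_step_def)
next
  case succ
  show ?case by (rule exI[of _ "program 1 0 0"], subst eval_iff) (auto simp: eval_step_def)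
next
  case left
  have "fst (prod_decode n) = v \<longleftrightarrow> (\<exists>m. n = pr v m)" for n v
    by (auto simp: enc_prod_def enc_nat_def intro: exI[of _ "snd (prod_decode n)"])
  thus ?case by (intro exI[of _ "program 2 0 0"], subst eval_iff) (auto simp: eval_step_def)
next
  case right
  have "snd (prod_decode n) = v \<longleftrightarrow> (\<exists>m. n = pr m v)" for n v
    by (auto simp: enc_prod_def enc_nat_def intro: exI[of _ "fst (prod_decode n)"])
  thus ?case by (intro exI[of _ "program 3 0 0"], subst eval_iff) (auto simp: eval_step_def)
next
  case (pair \<phi> \<psi>)
  then obtain f g where "\<And>n v. \<phi> n = Some v \<longleftrightarrow> eval f n v" "\<And>n v. \<psi> n = Some v \<longleftrightarrow> eval g n v"
    by blast
  thus ?case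
    by (intro exI[of _ "program 4 f g"], subst eval_iff)
       (auto simp: eval_step_def enc_prod_def enc_nat_def bind_eq_Some_conv)
next
  case (comp \<phi> \<psi>)
  then obtain f g where "\<And>n v. \<phi> n = Some v \<longleftrightarrow> eval f n v" "\<And>n v. \<psi> n = Some v \<longleftrightarrow> eval g n v"
    by blast
  thus ?case
    by (intro exI[of _ "program 5 f g"], subst eval_iff)
       (auto simp: eval_step_def bind_eq_Some_conv)
next
  case (prec \<phi> \<psi>)
  then obtain f g where fg: "\<And>n v. \<phi> n = Some v \<longleftrightarrow> eval f n v" "\<And>n v. \<psi> n = Some v \<longleftrightarrow> eval g n v"
    by blast
  have 0: "eval (program 6 f g) (pr a 0) v \<longleftrightarrow> eval f a v" for a v
    by (subst eval_iff) (auto simp: eval_step_def)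
  have Suc: "eval (program 6 f g) (pr a (Suc i)) v \<longleftrightarrow>
    (\<exists>r. eval (program 6 f g) (pr a i) r \<and> eval g (pr a (pr i r)) v)" for a i v
    by (subst eval_iff) (auto simp: eval_step_def)
  let ?R = "\<lambda>a m. rec_nat (\<phi> a) (\<lambda>i r. Option.bind r (\<lambda>v. \<psi> (prod_encode (a, prod_encode (i, v))))) m"
  have *: "?R a m = Some v \<longleftrightarrow> eval (program 6 f g) (pr a m) v" for a m v
  proof (induction m arbitrary: v)
    case (Suc m)
    thus ?case unfolding \<open>\<And>v i a. eval _ (pr a (Suc i)) v \<longleftrightarrow> _\<close>
      by (simp add: bind_eq_Some_conv fg enc_prod_def enc_nat_def)
  qed (simp add: 0 fg)
  have "(case prod_decode n of (a, m) \<Rightarrow> ?R a m) = Some v \<longleftrightarrow> eval (program 6 f g) n v" for n v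
    using *[of "fst (prod_decode n)" "snd (prod_decode n)" v]
    by (simp add: enc_prod_def enc_nat_def case_prod_unfold)
  thus ?case by blast
next
  case (mu \<phi>)
  then obtain f where f: "\<And>n v. \<phi> n = Some v \<longleftrightarrow> eval f n v" by blast
  \<comment> \<open>\<open>mu\<close> speaks of a least zero and of definedness below some zero. The
    positive form, in which all earlier values are successors, is the one that a monotone inductive
    definition admits.\<close>
  let ?P = "\<lambda>a v. \<phi> (prod_encode (a, v)) = Some 0 \<and> (\<forall>m<v. \<exists>w. \<phi> (prod_encode (a, m)) = Some (Suc w))"
  let ?E = "\<lambda>a. \<exists>n. \<phi> (prod_encode (a, n)) = Some 0 \<and> (\<forall>m<n. \<phi> (prod_encode (a, m)) \<noteq> None)"
  let ?L = "\<lambda>a. LEAST n. \<phi> (prod_encode (a, n)) = Some 0"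
  have "(if ?E a then Some (?L a) else None) = Some v \<longleftrightarrow> ?P a v" for a v
  proof
    assume *: "?P a v"
    have "?L a = v"
    proof (rule Least_equality)
      fix m assume "\<phi> (prod_encode (a, m)) = Some 0"
      thus "v \<le> m" using * by (metis not_le old.nat.distinct(1) option.inject)
    qed (use * in blast)
    moreover have "?E a" using * by (intro exI[of _ v]) auto
    ultimately show "(if ?E a then Some (?L a) else None) = Some v" by simp
  next
    assume "(if ?E a then Some (?L a) else None) = Some v"
    hence E: "?E a" and v: "v = ?L a" by (auto split: if_splits)
    then obtain n where n: "\<phi> (prod_encode (a, n)) = Some 0" "\<forall>m<n. \<phi> (prod_encode (a, m)) \<noteq> None"
      by blast
    have "\<phi> (prod_encode (a, v)) = Some 0" unfolding v by (rule LeastI[of _ n]) (fact n)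
    moreover have "v \<le> n" unfolding v by (rule Least_le) (fact n)
    moreover have "\<exists>w. \<phi> (prod_encode (a, m)) = Some (Suc w)" if "m < v" for m
    proof -
      from that n \<open>v \<le> n\<close> obtain y where y: "\<phi> (prod_encode (a, m)) = Some y" by fastforce
      have "y \<noteq> 0" using not_less_Least[of m "\<lambda>n. \<phi> (prod_encode (a, n)) = Some 0"] that y v by auto
      thus ?thesis using y by (cases y) auto
    qed
    ultimately show "?P a v" by blast
  qed
  moreover have "eval (program 7 f 0) a v \<longleftrightarrow> ?P a v" for a v
    by (subst eval_iff) (auto simp: eval_step_def f enc_prod_def enc_nat_def)
  ultimately show ?case by blast
qed

lemma semidec_partrec [semi_intros]:
  assumes "partrec \<phi>" and "computable f" "computable g"
  shows "semidec (\<lambda>x. \<phi> (f x) = Some (g x))"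
proof -
  obtain e where "\<And>n v. \<phi> n = Some v \<longleftrightarrow> eval e n v" using partrec_eval[OF assms(1)] by blast
  thus ?thesis using assms(2,3) by (simp add: semi_intros comp_intros)
qed

text \<open>Diagonalization: the function that takes the value 0 exactly where
  \<open>eval e e 0\<close> fails would have an index d, contradictory at d itself.\<close>

lemma undecidable_halting: "\<not> computable (\<lambda>e. eval e e 0)"
proof
  assume "computable (\<lambda>e. eval e e 0)"
  hence "computable (\<lambda>e. if eval e e 0 then 1 else 0 :: nat)" by (intro comp_intros)
  hence "partrec (\<lambda>e. Some (if eval e e 0 then 1 else 0))"
    by (simp add: computable_nat_iff recursive_def)
  then obtain d where "\<And>n v. Some (if eval n n 0 then 1 else 0) = Some v \<longleftrightarrow> eval d n v"
    using partrec_eval by blast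
  from this[of d 0] show False by (simp split: if_splits)
qed

subsection \<open>Computable real-valued functions\<close>

text \<open>Working with semidecidable rational cuts instead of approximating sequences makes closure
  properties a matter of first-order definability.\<close>

definition creal :: "('a::coded \<Rightarrow> real) \<Rightarrow> bool" where
  "creal f \<longleftrightarrow> semidec (\<lambda>z. of_rat (snd z) < f (fst z)) \<and> semidec (\<lambda>z. f (fst z) < of_rat (snd z))"

named_theorems creal_intros

lemma creal_lower:
  assumes "creal f" "computable g" "computable q" shows "semidec (\<lambda>x. of_rat (q x) < f (g x))"
  using semidec_comp[of "\<lambda>z. of_rat (snd z) < f (fst z)" "\<lambda>x. (g x, q x)"] assms
  by (simp add: creal_def comp_intros)

lemma creal_upper:
  assumes "creal f" "computable g" "computable q" shows "semidec (\<lambda>x. f (g x) < of_rat (q x))"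
  using semidec_comp[of "\<lambda>z. f (fst z) < of_rat (snd z)" "\<lambda>x. (g x, q x)"] assms
  by (simp add: creal_def comp_intros)

lemma creal_comp:
  assumes f: "creal f" and g: "computable g" shows "creal (\<lambda>x. f (g x))"
  unfolding creal_def[of "\<lambda>x. f (g x)"]
  by (intro conjI creal_lower[OF f] creal_upper[OF f] computable_comp[OF g] comp_intros)

lemma semidec_less_real [semi_intros]:
  fixes f g :: "'a::coded \<Rightarrow> real"
  assumes "creal f" "creal g" shows "semidec (\<lambda>x. f x < g x)"
proof -
  have "semidec (\<lambda>x. \<exists>q. f x < of_rat q \<and> of_rat q < g x)"
    by (intro semi_intros creal_upper[OF assms(1)] creal_lower[OF assms(2)] comp_intros)
  moreover have "(\<exists>q. f x < of_rat q \<and> of_rat q < g x) \<longleftrightarrow> f x < g x" for x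
    using of_rat_dense[of "f x" "g x"] by auto
  ultimately show ?thesis by simp
qed

lemma creal_of_rat [creal_intros]:
  assumes f: "computable f" shows "creal (\<lambda>x. of_rat (f x))"
  unfolding creal_def of_rat_less
  by (intro conjI semi_intros comp_intros computable_comp[OF f])

lemma creal_0 [creal_intros]: "creal (\<lambda>x. 0)" and creal_1 [creal_intros]: "creal (\<lambda>x. 1)"
  using creal_of_rat[OF computable_const[of 0]] creal_of_rat[OF computable_const[of 1]] by auto

lemma creal_uminus [creal_intros]:
  assumes "creal f" shows "creal (\<lambda>x. - f x)"
proof -
  have "of_rat q < - y \<longleftrightarrow> y < of_rat (- q)" "- y < of_rat q \<longleftrightarrow> of_rat (- q) < y" for y :: real and q
    by (auto simp: of_rat_minus)
  thus ?thesis unfolding creal_def[of "\<lambda>x. - f x"]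
    by (simp only:) (intro conjI creal_lower[OF assms] creal_upper[OF assms] comp_intros)
qed

lemma creal_add [creal_intros]:
  assumes f: "creal f" and g: "creal g" shows "creal (\<lambda>x. f x + g x)"
proof -
  have "of_rat q < y + z \<longleftrightarrow> (\<exists>a b. of_rat a < y \<and> of_rat b < z \<and> q \<le> a + b)" for q and y z :: real
  proof
    assume "of_rat q < y + z"
    then obtain a where a: "of_rat q - z < of_rat a" "of_rat a < y"
      using of_rat_dense[of "of_rat q - z" y] by auto
    thus "\<exists>a b. of_rat a < y \<and> of_rat b < z \<and> q \<le> a + b"
      by (intro exI[of _ a] exI[of _ "q - a"]) (auto simp: of_rat_diff)
  next
    assume "\<exists>a b. of_rat a < y \<and> of_rat b < z \<and> q \<le> a + b"
    then obtain a b where ab: "of_rat a < y" "of_rat b < z" "q \<le> a + b" by blast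
    have "of_rat q \<le> (of_rat (a + b) :: real)" using ab(3) by (simp only: of_rat_less_eq)
    thus "of_rat q < y + z" using ab by (simp add: of_rat_add)
  qed
  moreover have "y + z < of_rat q \<longleftrightarrow> (\<exists>a b. y < of_rat a \<and> z < of_rat b \<and> a + b \<le> q)" for q and y z :: real
  proof
    assume "y + z < of_rat q"
    then obtain a where a: "y < of_rat a" "of_rat a < of_rat q - z"
      using of_rat_dense[of y "of_rat q - z"] by auto
    thus "\<exists>a b. y < of_rat a \<and> z < of_rat b \<and> a + b \<le> q"
      by (intro exI[of _ a] exI[of _ "q - a"]) (auto simp: of_rat_diff)
  next
    assume "\<exists>a b. y < of_rat a \<and> z < of_rat b \<and> a + b \<le> q"
    then obtain a b where ab: "y < of_rat a" "z < of_rat b" "a + b \<le> q" by blast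
    have "(of_rat (a + b) :: real) \<le> of_rat q" using ab(3) by (simp only: of_rat_less_eq)
    thus "y + z < of_rat q" using ab by (simp add: of_rat_add)
  qed
  ultimately show ?thesis unfolding creal_def[of "\<lambda>x. f x + g x"]
    by (simp only:)
       (intro conjI semi_intros creal_lower[OF f] creal_upper[OF f] creal_lower[OF g] creal_upper[OF g] comp_intros)
qed

lemma creal_diff [creal_intros]: "creal f \<Longrightarrow> creal g \<Longrightarrow> creal (\<lambda>x. f x - g x)"
  using creal_add[OF _ creal_uminus] by simp

text \<open>The number of summands varies with x, so closure under binary sums is not enough. A list
  of rational lower bounds, one per summand, witnesses the lower cut uniformly; the empty sum leaves
  no slack and is treated apart. Upper cuts follow by negation.\<close>

lemma creal_sum [creal_intros]:
  fixes f :: "'a::coded \<Rightarrow> nat \<Rightarrow> real"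
  assumes f: "creal (\<lambda>z. f (fst z) (snd z))" and n: "computable n"
  shows "creal (\<lambda>x. \<Sum>i<n x. f x i)"
proof -
  have lower: "semidec (\<lambda>z. of_rat (snd z) < (\<Sum>i<n (fst z). g (fst z) i))"
    if g: "creal (\<lambda>z. g (fst z) (snd z))" for g :: "'a \<Rightarrow> nat \<Rightarrow> real"
  proof -
    have *: "of_rat q < (\<Sum>i<m. h i) \<longleftrightarrow>
      (\<exists>as. (\<forall>i<m. of_rat (lnth as i) < h i) \<and> (if m = 0 then q < 0 else q \<le> (\<Sum>i<m. lnth as i)))"
      for q m and h :: "nat \<Rightarrow> real"
    proof
      assume L: "of_rat q < (\<Sum>i<m. h i)"
      show "\<exists>as. (\<forall>i<m. of_rat (lnth as i) < h i) \<and> (if m = 0 then q < 0 else q \<le> (\<Sum>i<m. lnth as i))"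
      proof (cases "m = 0")
        case False
        \<comment> \<open>The available slack is shared equally among the summands.\<close>
        define d where "d = ((\<Sum>i<m. h i) - of_rat q) / m"
        have "d > 0" using L False by (simp add: d_def)
        hence "\<exists>a. h i - d < of_rat a \<and> of_rat a < h i" for i
          using of_rat_dense[of "h i - d" "h i"] by auto
        then obtain a where a: "\<And>i. h i - d < of_rat (a i)" "\<And>i. of_rat (a i) < h i" by metis
        have "of_rat q = (\<Sum>i<m. h i - d)" using False by (simp add: sum_subtractf d_def)
        also have "\<dots> \<le> (\<Sum>i<m. of_rat (a i))" by (intro sum_mono less_imp_le a)
        finally have "of_rat q \<le> (of_rat (\<Sum>i<m. a i) :: real)" by (simp add: of_rat_sum)
        hence "q \<le> (\<Sum>i<m. a i)" by (simp only: of_rat_less_eq)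
        thus ?thesis using False a by (intro exI[of _ "map a [0..<m]"]) simp
      qed (use L in simp)
    next
      assume "\<exists>as. (\<forall>i<m. of_rat (lnth as i) < h i) \<and> (if m = 0 then q < 0 else q \<le> (\<Sum>i<m. lnth as i))"
      then obtain as where as: "\<And>i. i < m \<Longrightarrow> of_rat (lnth as i) < h i"
        "if m = 0 then q < 0 else q \<le> (\<Sum>i<m. lnth as i)" by blast
      show "of_rat q < (\<Sum>i<m. h i)"
      proof (cases "m = 0")
        case False
        have "of_rat q \<le> (of_rat (\<Sum>i<m. lnth as i) :: real)" using as False by (simp add: of_rat_less_eq)
        also have "\<dots> = (\<Sum>i<m. of_rat (lnth as i))" by (simp add: of_rat_sum)
        also have "\<dots> < (\<Sum>i<m. h i)" using as False by (intro sum_strict_mono) auto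
        finally show ?thesis .
      qed (use as in simp)
    qed
    have 1: "semidec (\<lambda>w. of_rat (lnth (snd (fst w)) (snd w)) < g (fst (fst (fst w))) (snd w))"
      using creal_lower[OF g, of "\<lambda>w. (fst (fst (fst w)), snd w)" "\<lambda>w. lnth (snd (fst w)) (snd w)"]
      by (simp add: comp_intros)
    have 2: "semidec (\<lambda>z :: ('a \<times> rat) \<times> rat list. if n (fst (fst z)) = 0 then snd (fst z) < 0
        else snd (fst z) \<le> (\<Sum>i<n (fst (fst z)). lnth (snd z) i))"
      by (intro semidec_computable comp_intros computable_comp[OF n])
    have "semidec (\<lambda>z. \<exists>as. (\<forall>i<n (fst z). of_rat (lnth as i) < g (fst z) i) \<and>
        (if n (fst z) = 0 then snd z < 0 else snd z \<le> (\<Sum>i<n (fst z). lnth as i)))"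
      by (intro semidec_ex semidec_conj semidec_all_less 1 2 computable_comp[OF n] comp_intros)
    thus ?thesis unfolding * .
  qed
  have "semidec (\<lambda>z. of_rat (- snd z) < (\<Sum>i<n (fst z). - f (fst z) i))"
    using semidec_comp[OF lower[OF creal_uminus[OF f]], of "\<lambda>z. (fst z, - snd z)"]
    by (simp add: comp_intros)
  moreover have "of_rat (- q) < (\<Sum>i<m. - h i) \<longleftrightarrow> (\<Sum>i<m. h i) < of_rat q" for q m and h :: "nat \<Rightarrow> real"
    by (simp add: sum_negf of_rat_minus)
  ultimately show ?thesis unfolding creal_def using lower[OF f] by simp
qed

lemma creal_if [creal_intros]:
  assumes P: "computable P" and f: "creal f" and g: "creal g"
  shows "creal (\<lambda>x. if P x then f x else g x)"
proof -
  have 1: "of_rat q < (if b then y else z) \<longleftrightarrow> b \<and> of_rat q < y \<or> \<not> b \<and> of_rat q < z"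
    and 2: "(if b then y else z) < of_rat q \<longleftrightarrow> b \<and> y < of_rat q \<or> \<not> b \<and> z < of_rat q" for q b and y z :: real
    by auto
  have P1: "semidec (\<lambda>z. P (fst z))" and P2: "semidec (\<lambda>z. \<not> P (fst z))"
    by (intro semidec_computable comp_intros computable_comp[OF P])+
  show ?thesis unfolding creal_def[of "\<lambda>x. if P x then f x else g x"] 1 2
    by (intro conjI semidec_conj semidec_disj creal_lower[OF f] creal_upper[OF f] creal_lower[OF g]
       creal_upper[OF g] P1 P2 comp_intros)
qed

text \<open>The approximations may come from a relation with several values, so a partial recursive
  function can enter through its semidecidable graph.\<close>

lemma creal_approx:
  fixes f :: "'a::coded \<Rightarrow> real"
  assumes A: "semidec (\<lambda>z. A (fst z) (fst (snd z)) (snd (snd z)))"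
    and approx: "\<And>x k q. A x k q \<Longrightarrow> \<bar>of_rat q - f x\<bar> < 1 / 2 ^ k" and ex: "\<And>x k. \<exists>q. A x k q"
  shows "creal f"
proof -
  \<comment> \<open>The factor 2 pays for the error of the approximation and for the margin
    \<open>1 / 2 ^ k\<close> by which it is shifted in the cuts.\<close>
  have tends: "\<exists>k. 2 / 2 ^ k < e" if "e > 0" for e :: real
    using real_arch_pow_inv[of "e / 2" "1 / 2"] that by (auto simp: power_divide field_simps)
  have pow: "of_rat (1 / 2 ^ k) = (1 / 2 ^ k :: real)" for k
    by (simp add: of_rat_divide of_rat_power)
  have "of_rat q < f x \<longleftrightarrow> (\<exists>k a. A x k a \<and> q \<le> a - 1 / 2 ^ k)" for q x
  proof
    assume "of_rat q < f x"
    then obtain k where k: "2 / 2 ^ k < f x - of_rat q" using tends[of "f x - of_rat q"] by auto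
    obtain a where a: "A x k a" using ex by blast
    have "of_rat q \<le> (of_rat (a - 1 / 2 ^ k) :: real)"
      unfolding of_rat_diff pow using approx[OF a] k by (simp add: abs_if split: if_splits)
    thus "\<exists>k a. A x k a \<and> q \<le> a - 1 / 2 ^ k" using a by (auto simp only: of_rat_less_eq)
  next
    assume "\<exists>k a. A x k a \<and> q \<le> a - 1 / 2 ^ k"
    then obtain k a where a: "A x k a" "q \<le> a - 1 / 2 ^ k" by blast
    have "of_rat q \<le> (of_rat (a - 1 / 2 ^ k) :: real)" using a(2) by (simp only: of_rat_less_eq)
    thus "of_rat q < f x" unfolding of_rat_diff pow using approx[OF a(1)] by (simp add: abs_if split: if_splits)
  qed
  moreover have "f x < of_rat q \<longleftrightarrow> (\<exists>k a. A x k a \<and> a + 1 / 2 ^ k \<le> q)" for q x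
  proof
    assume "f x < of_rat q"
    then obtain k where k: "2 / 2 ^ k < of_rat q - f x" using tends[of "of_rat q - f x"] by auto
    obtain a where a: "A x k a" using ex by blast
    have "(of_rat (a + 1 / 2 ^ k) :: real) \<le> of_rat q"
      unfolding of_rat_add pow using approx[OF a] k by (simp add: abs_if split: if_splits)
    thus "\<exists>k a. A x k a \<and> a + 1 / 2 ^ k \<le> q" using a by (auto simp only: of_rat_less_eq)
  next
    assume "\<exists>k a. A x k a \<and> a + 1 / 2 ^ k \<le> q"
    then obtain k a where a: "A x k a" "a + 1 / 2 ^ k \<le> q" by blast
    have "(of_rat (a + 1 / 2 ^ k) :: real) \<le> of_rat q" using a(2) by (simp only: of_rat_less_eq)
    thus "f x < of_rat q" unfolding of_rat_add pow using approx[OF a(1)] by (simp add: abs_if split: if_splits)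
  qed
  moreover have "semidec (\<lambda>z. A (fst (fst (fst z))) (snd (fst z)) (snd z))"
    using semidec_comp[OF A, of "\<lambda>z. (fst (fst (fst z)), snd (fst z), snd z)"] by (simp add: comp_intros)
  ultimately show ?thesis unfolding creal_def
    by (simp only:) (intro conjI semi_intros comp_intros; assumption)
qed

lemma creal_computable_real: "computable_real x \<Longrightarrow> creal (\<lambda>_. x)"
proof -
  assume "computable_real x"
  then obtain \<phi> where \<phi>: "partrec \<phi>" "\<And>k. \<exists>q. \<phi> k = Some (rat_code q) \<and> \<bar>of_rat q - x\<bar> < 1 / 2 ^ k"
    unfolding computable_real_def by blast
  show ?thesis
  proof (rule creal_approx)
    show "semidec (\<lambda>z. \<phi> (fst (snd z)) = Some (enc (snd (snd z) :: rat)))"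
      by (intro semidec_partrec[OF \<phi>(1)] comp_intros)
    show "\<exists>q :: rat. \<phi> k = Some (enc q)" for k
      using \<phi>(2)[of k] by (auto simp: enc_rat_eq_rat_code)
    show "\<bar>of_rat q - x\<bar> < 1 / 2 ^ k" if "\<phi> k = Some (enc q)" for k and q :: rat
    proof -
      obtain q' where q': "\<phi> k = Some (enc q')" "\<bar>of_rat q' - x\<bar> < 1 / 2 ^ k"
        using \<phi>(2)[of k] by (auto simp: enc_rat_eq_rat_code)
      hence "q' = q" using that by simp
      thus ?thesis using q' by simp
    qed
  qed
qed

lemma creal_mult_rat:
  assumes f: "creal f" and c: "c > 0" shows "creal (\<lambda>x. of_rat c * f x)"
proof -
  have "of_rat q < of_rat c * y \<longleftrightarrow> of_rat (q / c) < y" "of_rat c * y < of_rat q \<longleftrightarrow> y < of_rat (q / c)"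
    for q and y :: real
    using c by (simp_all add: of_rat_divide field_simps)
  thus ?thesis unfolding creal_def[of "\<lambda>x. of_rat c * f x"]
    by (simp only:) (intro conjI creal_lower[OF f] creal_upper[OF f] comp_intros)
qed

text \<open>Squaring is monotone on nonnegative reals; a rational strictly between the value of f
  and the square root of q witnesses either cut.\<close>

lemma creal_square:
  assumes f: "creal f" and nonneg: "\<And>x. f x \<ge> 0" shows "creal (\<lambda>x. (f x)\<^sup>2)"
proof -
  have "of_rat q < y\<^sup>2 \<longleftrightarrow> q < 0 \<or> (\<exists>a. 0 \<le> a \<and> of_rat a < y \<and> q < a ^ 2)" if y: "y \<ge> 0" for q and y :: real
  proof
    assume L: "of_rat q < y\<^sup>2"
    show "q < 0 \<or> (\<exists>a. 0 \<le> a \<and> of_rat a < y \<and> q < a ^ 2)"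
    proof (cases "q < 0")
      case False
      hence "0 \<le> sqrt (of_rat q)" "sqrt (of_rat q) < y"
        using L y by (auto simp: real_less_lsqrt real_sqrt_less_iff intro: real_less_lsqrt)
      then obtain a where a: "sqrt (of_rat q) < of_rat a" "of_rat a < y" using of_rat_dense by blast
      have "0 < (of_rat a :: real)" using a(1) \<open>0 \<le> sqrt (of_rat q)\<close> by linarith
      hence "of_rat q < (of_rat a :: real)\<^sup>2" using a(1) real_sqrt_less_iff[of "of_rat q" "(of_rat a)\<^sup>2"] by simp
      hence "of_rat q < (of_rat (a ^ 2) :: real)" by (simp add: of_rat_power)
      hence "q < a ^ 2" by (simp only: of_rat_less)
      moreover have "0 \<le> a" using \<open>0 < (of_rat a :: real)\<close> by simp
      ultimately show ?thesis using a by blast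
    qed simp
  next
    assume "q < 0 \<or> (\<exists>a. 0 \<le> a \<and> of_rat a < y \<and> q < a ^ 2)"
    thus "of_rat q < y\<^sup>2"
    proof
      assume "q < 0"
      hence "of_rat q < (0::real)" by simp
      thus ?thesis by (rule order_less_le_trans) simp
    next
      assume "\<exists>a. 0 \<le> a \<and> of_rat a < y \<and> q < a ^ 2"
      then obtain a where a: "0 \<le> a" "of_rat a < y" "q < a ^ 2" by blast
      have "of_rat q < (of_rat (a ^ 2) :: real)" using a(3) by (simp only: of_rat_less)
      also have "\<dots> = (of_rat a)\<^sup>2" by (simp add: of_rat_power)
      also have "\<dots> \<le> y\<^sup>2" using a by (intro power_mono) auto
      finally show ?thesis .
    qed
  qed
  moreover have "y\<^sup>2 < of_rat q \<longleftrightarrow> (\<exists>a. 0 \<le> a \<and> y < of_rat a \<and> a ^ 2 \<le> q)" if y: "y \<ge> 0" for q and y :: real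
  proof
    assume L: "y\<^sup>2 < of_rat q"
    hence "y < sqrt (of_rat q)" by (simp add: real_less_rsqrt)
    then obtain a where a: "y < of_rat a" "of_rat a < sqrt (of_rat q)" using of_rat_dense by blast
    have "0 < (of_rat a :: real)" using a y by linarith
    moreover have "(of_rat a)\<^sup>2 \<le> (of_rat q :: real)"
      using power_mono[of "of_rat a" "sqrt (of_rat q)" 2] a(2) calculation order_trans[OF zero_le_power2 less_imp_le[OF L]]
      by simp
    hence "(of_rat (a ^ 2) :: real) \<le> of_rat q" by (simp add: of_rat_power)
    ultimately show "\<exists>a. 0 \<le> a \<and> y < of_rat a \<and> a ^ 2 \<le> q" using a
      by (intro exI[of _ a]) (simp only: of_rat_less_eq zero_less_of_rat_iff less_imp_le)
  next
    assume "\<exists>a. 0 \<le> a \<and> y < of_rat a \<and> a ^ 2 \<le> q"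
    then obtain a where a: "0 \<le> a" "y < of_rat a" "a ^ 2 \<le> q" by blast
    have "y\<^sup>2 < (of_rat a)\<^sup>2" using a y by (intro power_strict_mono) auto
    also have "\<dots> = of_rat (a ^ 2)" by (simp add: of_rat_power)
    also have "\<dots> \<le> of_rat q" using a(3) by (simp only: of_rat_less_eq)
    finally show "y\<^sup>2 < of_rat q" .
  qed
  ultimately show ?thesis unfolding creal_def[of "\<lambda>x. (f x)\<^sup>2"] using nonneg
    by (simp only:) (intro conjI semi_intros creal_lower[OF f] creal_upper[OF f] comp_intros)
qed

lemma nat_fraction_between:
  fixes a b :: real
  assumes "a < b" "0 < b"
  obtains m n :: nat where "0 < n" "a < m / n" "m / n < b"
proof -
  obtain t where t: "max a 0 < of_rat t" "of_rat t < b" using of_rat_dense[of "max a 0" b] assms by auto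
  hence "0 < (of_rat t :: real)" by linarith
  hence tp: "t > 0" by simp
  obtain u v where uv: "quotient_of t = (u, v)" by force
  hence v: "v > 0" by (rule quotient_of_denom_pos)
  have tuv: "t = of_int u / of_int v" using uv by (rule quotient_of_div)
  hence "u > 0" using tp v by (simp add: zero_less_divide_iff)
  hence "of_rat t = real (nat u) / real (nat v)" using v by (simp add: tuv of_rat_divide)
  thus thesis using t v by (intro that[of "nat v" "nat u"]) auto
qed

text \<open>The real exponent y is replaced by a fraction m / n on the side where the power gets
  smaller: below y for q \<ge> 1, above y for q \<le> 1. Clearing n leaves a comparison of natural
  powers, decidable for rationals.\<close>

lemma less_powr_iff_power_less:
  fixes q r y :: real
  assumes q: "q > 0" and r: "r > 0" and y: "y > 0"
  shows "r < q powr y \<longleftrightarrow>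
    (\<exists>(m::nat) (n::nat). 0 < n \<and> (1 \<le> q \<and> m / n < y \<or> q \<le> 1 \<and> y < m / n) \<and> r ^ n < q ^ m)"
proof
  assume "r < q powr y"
  hence L: "ln r < y * ln q" using q r ln_less_cancel_iff[of r "q powr y"] by (simp add: ln_powr)
  have pow: "r ^ n < q ^ m" if "ln r < (m / n) * ln q" "n > 0" for m n :: nat
  proof -
    have "n * ln r < m * ln q" using that by (simp add: field_simps)
    hence "ln (r ^ n) < ln (q ^ m)" using q r by (simp add: ln_realpow)
    thus ?thesis using q r by simp
  qed
  consider "q = 1" | "q > 1" | "q < 1" by linarith
  thus "\<exists>(m::nat) (n::nat). 0 < n \<and> (1 \<le> q \<and> m / n < y \<or> q \<le> 1 \<and> y < m / n) \<and> r ^ n < q ^ m"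
  proof cases
    case 1
    obtain m n :: nat where mn: "0 < n" "m / n < y" using nat_fraction_between[OF y y] .
    have "r ^ n < q ^ m" using pow[of m n] L 1 mn by simp
    thus ?thesis using mn 1 by blast
  next
    case 2
    hence "ln r / ln q < y" using L by (simp add: pos_divide_less_eq)
    then obtain m n :: nat where mn: "0 < n" "ln r / ln q < m / n" "m / n < y"
      using y by (rule nat_fraction_between)
    hence "ln r < (m / n) * ln q" using 2 by (simp add: pos_divide_less_eq)
    hence "r ^ n < q ^ m" using pow mn by blast
    thus ?thesis using mn 2 less_imp_le by blast
  next
    case 3
    hence neg: "ln q < 0" using q by simp
    hence *: "y < ln r / ln q" using L by (simp add: neg_less_divide_eq)
    obtain m n :: nat where mn: "0 < n" "y < m / n" "m / n < ln r / ln q"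
      using nat_fraction_between[OF * order.strict_trans[OF y *]] .
    have "ln r < (m / n) * ln q" using mn(3) neg by (simp add: neg_less_divide_eq)
    hence "r ^ n < q ^ m" using pow mn by blast
    thus ?thesis using mn 3 less_imp_le by blast
  qed
next
  assume "\<exists>(m::nat) (n::nat). 0 < n \<and> (1 \<le> q \<and> m / n < y \<or> q \<le> 1 \<and> y < m / n) \<and> r ^ n < q ^ m"
  then obtain m n :: nat where n: "0 < n" and c: "1 \<le> q \<and> m / n < y \<or> q \<le> 1 \<and> y < m / n" and lt: "r ^ n < q ^ m"
    by blast
  have "ln (r ^ n) < ln (q ^ m)" using lt q r by simp
  hence "ln r < (m / n) * ln q" using n q r by (simp add: ln_realpow field_simps)
  also have "\<dots> \<le> y * ln q"
    using c
  proof
    assume "1 \<le> q \<and> m / n < y"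
    thus ?thesis by (intro mult_right_mono) simp_all
  next
    assume "q \<le> 1 \<and> y < m / n"
    thus ?thesis using q by (intro mult_right_mono_neg) simp_all
  qed
  finally have "ln r < ln (q powr y)" using q by (simp add: ln_powr)
  thus "r < q powr y" using q r ln_less_cancel_iff[of r "q powr y"] by simp
qed

text \<open>Upper cuts reduce to lower cuts by passing to reciprocals. The cases q = 0 and r \<le> 0
  are split off, because \<open>less_powr_iff_power_less\<close> is about positive numbers.\<close>

lemma creal_powr:
  fixes f :: "'a::coded \<Rightarrow> rat"
  assumes f: "computable f" and nonneg: "\<And>x. 0 \<le> f x" and y: "creal (\<lambda>_::nat. y)" "y > 0"
  shows "creal (\<lambda>x. of_rat (f x) powr y)"
proof -
  let ?L = "\<lambda>q r. \<exists>(m::nat) (n::nat). 0 < n \<and> (1 \<le> q \<and> of_rat (of_nat m / of_nat n) < y \<or>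
    q \<le> 1 \<and> y < of_rat (of_nat m / of_nat n)) \<and> r ^ n < q ^ m"
  have L: "of_rat r < of_rat q powr y \<longleftrightarrow> ?L q r" if "q > 0" "r > 0" for q r
  proof -
    have 1: "1 \<le> (of_rat q :: real) \<longleftrightarrow> 1 \<le> q" "(of_rat q :: real) \<le> 1 \<longleftrightarrow> q \<le> 1" by simp_all
    have 2: "of_rat r ^ n < (of_rat q :: real) ^ m \<longleftrightarrow> r ^ n < q ^ m" for m n
      by (simp only: of_rat_power[symmetric] of_rat_less)
    show ?thesis using less_powr_iff_power_less[of "of_rat q" "of_rat r" y] that y(2)
      unfolding 1 2 by (simp add: of_rat_divide)
  qed
  have lower: "of_rat r < of_rat q powr y \<longleftrightarrow> (0 < q \<and> 0 < r \<and> ?L q r) \<or> r < 0 \<or> (r \<le> 0 \<and> 0 < q)"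
    if "0 \<le> q" for q r
  proof (cases "0 < q")
    case q: True
    hence pos: "0 < (of_rat q powr y)" by simp
    show ?thesis
    proof (cases "0 < r")
      case False
      hence "of_rat r \<le> (0::real)" by simp
      hence "of_rat r < of_rat q powr y" using pos by linarith
      thus ?thesis using False q by simp
    qed (use L[of q r] q in simp)
  next
    case False
    thus ?thesis using that y by simp
  qed
  have upper: "of_rat q powr y < of_rat r \<longleftrightarrow> 0 < r \<and> (q = 0 \<or> 0 < q \<and> ?L (inverse q) (inverse r))"
    if "0 \<le> q" for q r
  proof (cases "0 < q \<and> 0 < r")
    case True
    hence "of_rat q powr y < of_rat r \<longleftrightarrow> of_rat (inverse r) < of_rat (inverse q) powr y"
      using inverse_less_iff_less[of "of_rat r :: real" "of_rat q powr y"]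
      by (simp add: of_rat_inverse inverse_powr del: inverse_less_iff_less)
    thus ?thesis using L[of "inverse q" "inverse r"] True by auto
  next
    case False
    show ?thesis
    proof (cases "r \<le> 0")
      case True
      hence "of_rat r \<le> (0::real)" by simp
      hence "\<not> of_rat q powr y < of_rat r" using powr_ge_zero[of "of_rat q" y] by linarith
      thus ?thesis using True by simp
    qed (use False that y in simp)
  qed
  have y1: "semidec (\<lambda>z. y < of_rat (g z))" and y2: "semidec (\<lambda>z. of_rat (g z) < y)" if "computable g" 
    for g :: "'b::coded \<Rightarrow> rat"
    using creal_upper[OF y(1) computable_const that] creal_lower[OF y(1) computable_const that] by auto
  show ?thesis unfolding creal_def[of "\<lambda>x. of_rat (f x) powr y"] using lower nonneg upper
    by (simp only:) (intro conjI semi_intros y1 y2 comp_intros computable_comp[OF f])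
qed

section \<open>The spaces of p-summable sequences\<close>

text \<open>The p-th power of the norm. Without the outer root it adds up over coordinates, which
  all later computations of norms exploit.\<close>

definition psum :: "real \<Rightarrow> (nat \<Rightarrow> complex) \<Rightarrow> real" where
  "psum p f = (\<Sum>n. cmod (f n) powr p)"

lemma lp_iff: "f \<in> lp p \<longleftrightarrow> summable (\<lambda>n. cmod (f n) powr p)"
  by (simp add: lp_def)

lemma lp_norm_eq: "lp_norm p f = psum p f powr (1 / p)"
  by (simp add: lp_norm_def psum_def)

lemma psum_nonneg: "f \<in> lp p \<Longrightarrow> psum p f \<ge> 0"
  unfolding psum_def lp_iff by (rule suminf_nonneg) simp_all

lemma powr_less_iff:
  fixes x y p :: real
  assumes "p > 0" "x \<ge> 0" "y \<ge> 0" shows "x powr p < y powr p \<longleftrightarrow> x < y"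
proof (cases "x < y")
  case True
  thus ?thesis using powr_less_mono2[of p x y] assms by simp
next
  case False
  hence "y powr p \<le> x powr p" using assms by (intro powr_mono2) auto
  thus ?thesis using False by simp
qed

lemma lp_norm_nonneg [simp]: "lp_norm p f \<ge> 0"
  by (simp add: lp_norm_eq)

lemma lp_norm_powr:
  assumes "f \<in> lp p" "p \<ge> 1" shows "lp_norm p f powr p = psum p f"
  using assms psum_nonneg[of f p] by (simp add: lp_norm_eq powr_powr)

lemma lp_norm_less_iff:
  assumes "f \<in> lp p" "p \<ge> 1" "r \<ge> 0" shows "lp_norm p f < r \<longleftrightarrow> psum p f < r powr p"
  using powr_less_iff[of p "lp_norm p f" r] assms by (simp add: lp_norm_powr)

lemma lp_norm_le_iff:
  assumes "f \<in> lp p" "p \<ge> 1" "r \<ge> 0" shows "lp_norm p f \<le> r \<longleftrightarrow> psum p f \<le> r powr p"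
proof -
  have "r < lp_norm p f \<longleftrightarrow> r powr p < psum p f"
    using powr_less_iff[of p r "lp_norm p f"] assms by (simp add: lp_norm_powr)
  thus ?thesis by (simp add: not_less[symmetric])
qed

lemma cmult_in_lp [intro]: "f \<in> lp p \<Longrightarrow> (\<lambda>n. c * f n) \<in> lp p"
  by (simp add: lp_iff norm_mult powr_mult summable_mult)

lemma psum_cmult: "f \<in> lp p \<Longrightarrow> psum p (\<lambda>n. c * f n) = cmod c powr p * psum p f"
  by (simp add: lp_iff psum_def norm_mult powr_mult suminf_mult)

lemma lp_norm_cmult:
  "f \<in> lp p \<Longrightarrow> p \<ge> 1 \<Longrightarrow> lp_norm p (\<lambda>n. c * f n) = cmod c * lp_norm p f"
  by (simp add: lp_norm_eq psum_cmult powr_mult psum_nonneg powr_powr)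

lemma uminus_in_lp [intro]: "f \<in> lp p \<Longrightarrow> (\<lambda>n. - f n) \<in> lp p"
  by (simp add: lp_iff)

section \<open>Minkowski's inequality\<close>

lemma powr_convex_nonneg:
  fixes x y s t p :: real
  assumes p: "p \<ge> 1" and x: "x \<ge> 0" and y: "y \<ge> 0" and s: "s \<ge> 0" and t: "t \<ge> 0" and st: "s + t = 1"
  shows "(s * x + t * y) powr p \<le> s * x powr p + t * y powr p"
proof -
  \<comment> \<open>Where x or y is 0, convexity comes down to \<open>u powr p \<le> u\<close> on
    the unit interval.\<close>
  have zero: "(u * z) powr p \<le> u * z powr p" if "0 \<le> u" "u \<le> 1" "0 \<le> z" for u z :: real
  proof -
    have "u powr p \<le> u powr 1" using that p powr_mono'[of 1 p u] by (cases "u = 0") auto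
    hence "u powr p * z powr p \<le> u * z powr p" using that by (intro mult_right_mono) auto
    thus ?thesis using that by (simp add: powr_mult)
  qed
  consider "x = 0" | "y = 0" | "x > 0" "y > 0" using x y by linarith
  thus ?thesis
  proof cases
    case 1
    thus ?thesis using zero[of t y] s t st y p by simp
  next
    case 2
    thus ?thesis using zero[of s x] s t st x p by simp
  next
    case 3
    have "t \<le> 1" "s = 1 - t" using s st by auto
    thus ?thesis using convex_onD[OF powr_convex[OF p], of t x y] 3 t by simp
  qed
qed

text \<open>(x + y) / (s + t) is a convex combination of x / s and y / t. Summed over coordinates,
  with s and t just above the two norms, this gives the triangle inequality.\<close>

lemma powr_sum_le:
  fixes x y s t p :: real
  assumes p: "p \<ge> 1" and s: "s > 0" and t: "t > 0" and x: "x \<ge> 0" and y: "y \<ge> 0"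
  shows "(x + y) powr p \<le> (s + t) powr p * (s / (s + t) * (x powr p / s powr p) + t / (s + t) * (y powr p / t powr p))"
proof -
  have "(x + y) powr p = ((s + t) * (s / (s + t) * (x / s) + t / (s + t) * (y / t))) powr p"
  proof -
    have "s + t \<noteq> 0" "s \<noteq> 0" "t \<noteq> 0" using s t by linarith+
    hence "(s + t) * (s / (s + t) * (x / s) + t / (s + t) * (y / t)) = x + y" by (simp add: distrib_left)
    thus ?thesis by simp
  qed
  also have "\<dots> = (s + t) powr p * (s / (s + t) * (x / s) + t / (s + t) * (y / t)) powr p"
    by (rule powr_mult)
  also have "\<dots> \<le> (s + t) powr p * (s / (s + t) * (x / s) powr p + t / (s + t) * (y / t) powr p)"
    using p s t x y by (intro mult_left_mono powr_convex_nonneg) (auto simp: add_divide_distrib[symmetric])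
  finally show ?thesis using s t x y by (simp add: powr_divide)
qed

lemma psum_add_le:
  assumes p: "p \<ge> 1" and s: "s > 0" and t: "t > 0" and f: "f \<in> lp p" and g: "g \<in> lp p"
    and fs: "psum p f \<le> s powr p" and gt: "psum p g \<le> t powr p"
  shows "(\<lambda>n. f n + g n) \<in> lp p" "psum p (\<lambda>n. f n + g n) \<le> (s + t) powr p"
proof -
  let ?B = "\<lambda>n. (s + t) powr p * (s / (s + t) * (cmod (f n) powr p / s powr p)
      + t / (s + t) * (cmod (g n) powr p / t powr p))"
  have sumf: "summable (\<lambda>n. cmod (f n) powr p)" and sumg: "summable (\<lambda>n. cmod (g n) powr p)"
    using f g by (auto simp: lp_iff)
  have "(\<lambda>n. cmod (f n) powr p) sums psum p f" "(\<lambda>n. cmod (g n) powr p) sums psum p g"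
    using sumf sumg by (auto simp: psum_def)
  hence B: "?B sums ((s + t) powr p * (s / (s + t) * (psum p f / s powr p) + t / (s + t) * (psum p g / t powr p)))"
    by (intro sums_mult sums_add sums_divide)
  have le: "cmod (f n + g n) powr p \<le> ?B n" for n
  proof -
    have "cmod (f n + g n) powr p \<le> (cmod (f n) + cmod (g n)) powr p"
      using p by (intro powr_mono2 norm_triangle_ineq) auto
    also have "\<dots> \<le> ?B n" by (intro powr_sum_le p s t) auto
    finally show ?thesis .
  qed
  show mem: "(\<lambda>n. f n + g n) \<in> lp p"
    unfolding lp_iff by (rule summable_comparison_test'[OF sums_summable[OF B], of 0]) (use le in auto)
  have "psum p (\<lambda>n. f n + g n) \<le> (\<Sum>n. ?B n)"
    unfolding psum_def using mem by (intro suminf_le le sums_summable[OF B]) (simp add: lp_iff)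
  also have "\<dots> = (s + t) powr p * (s / (s + t) * (psum p f / s powr p) + t / (s + t) * (psum p g / t powr p))"
    using B by (rule sums_unique[symmetric])
  also have "\<dots> \<le> (s + t) powr p * (s / (s + t) * 1 + t / (s + t) * 1)"
    using s t fs gt by (intro mult_left_mono add_mono) auto
  also have "\<dots> = (s + t) powr p" using s t by (simp add: add_divide_distrib[symmetric])
  finally show "psum p (\<lambda>n. f n + g n) \<le> (s + t) powr p" .
qed

lemma add_lp:
  assumes p: "p \<ge> 1" and f: "f \<in> lp p" and g: "g \<in> lp p"
  shows add_in_lp: "(\<lambda>n. f n + g n) \<in> lp p"
    and lp_norm_triangle: "lp_norm p (\<lambda>n. f n + g n) \<le> lp_norm p f + lp_norm p g"
proof -
  \<comment> \<open>The slack e keeps both radii positive even for vectors of norm 0.\<close>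
  have *: "psum p h \<le> (lp_norm p h + e) powr p" if "h \<in> lp p" "e > 0" for h and e :: real
  proof -
    have "lp_norm p h powr p \<le> (lp_norm p h + e) powr p" using p that by (intro powr_mono2) auto
    thus ?thesis using lp_norm_powr[OF that(1) p] by simp
  qed
  have pos: "0 < lp_norm p h + e" if "e > 0" for h and e :: real
    using that lp_norm_nonneg[of p h] by linarith
  note add = psum_add_le[OF p pos pos f g *[OF f] *[OF g]]
  show mem: "(\<lambda>n. f n + g n) \<in> lp p" by (rule add(1)[of 1 1]) auto
  show "lp_norm p (\<lambda>n. f n + g n) \<le> lp_norm p f + lp_norm p g"
  proof (rule field_le_epsilon)
    fix e :: real assume "e > 0"
    hence "psum p (\<lambda>n. f n + g n) \<le> ((lp_norm p f + e / 2) + (lp_norm p g + e / 2)) powr p"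
      by (intro add(2)) auto
    thus "lp_norm p (\<lambda>n. f n + g n) \<le> lp_norm p f + lp_norm p g + e"
      using \<open>e > 0\<close> by (subst lp_norm_le_iff[OF mem p]) (auto simp: algebra_simps)
  qed
qed

lemma diff_in_lp: "p \<ge> 1 \<Longrightarrow> f \<in> lp p \<Longrightarrow> g \<in> lp p \<Longrightarrow> (\<lambda>n. f n - g n) \<in> lp p"
  using add_in_lp[OF _ _ uminus_in_lp] by simp

lemma lp_norm_minus_commute: "lp_norm p (\<lambda>n. f n - g n) = lp_norm p (\<lambda>n. g n - f n)"
  by (simp add: lp_norm_def norm_minus_commute)

lemma lp_norm_diff_triangle:
  assumes "p \<ge> 1" "f \<in> lp p" "g \<in> lp p" "h \<in> lp p"
  shows "lp_norm p (\<lambda>n. f n - h n) \<le> lp_norm p (\<lambda>n. f n - g n) + lp_norm p (\<lambda>n. g n - h n)"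
  using lp_norm_triangle[OF assms(1) diff_in_lp[OF assms(1,2,3)] diff_in_lp[OF assms(1,3,4)]] by simp

lemma finite_support_lp:
  assumes "\<And>n. n \<ge> N \<Longrightarrow> f n = 0"
  shows finite_support_in_lp: "f \<in> lp p" and psum_finite_support: "psum p f = (\<Sum>n<N. cmod (f n) powr p)"
proof -
  have "(\<lambda>n. cmod (f n) powr p) sums (\<Sum>n<N. cmod (f n) powr p)"
    by (rule sums_finite) (use assms in \<open>auto simp: not_less\<close>)
  thus "f \<in> lp p" "psum p f = (\<Sum>n<N. cmod (f n) powr p)"
    by (auto simp: lp_iff psum_def sums_iff)
qed

lemma zero_in_lp: "(\<lambda>_. 0) \<in> lp p"
  by (simp add: lp_iff)

lemma cmod_le_lp_norm:
  assumes f: "f \<in> lp p" and p: "p \<ge> 1" shows "cmod (f n) \<le> lp_norm p f"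
proof -
  have "(\<Sum>i\<in>{n}. cmod (f i) powr p) \<le> psum p f"
    unfolding psum_def using f by (intro sum_le_suminf) (auto simp: lp_iff)
  hence "cmod (f n) powr p \<le> lp_norm p f powr p" using lp_norm_powr[OF f p] by simp
  moreover have "lp_norm p f powr p < cmod (f n) powr p \<longleftrightarrow> lp_norm p f < cmod (f n)"
    using p by (intro powr_less_iff) auto
  ultimately show ?thesis by linarith
qed

lemma lp_norm_eq_0_iff:
  assumes f: "f \<in> lp p" and p: "p \<ge> 1" shows "lp_norm p f = 0 \<longleftrightarrow> f = (\<lambda>_. 0)"
  using cmod_le_lp_norm[OF f p] p by (auto simp: lp_norm_def fun_eq_iff)

lemma std_gen_in_lp: "std_gen k \<in> lp p"
  by (rule finite_support_in_lp[of "Suc k"]) (auto simp: std_gen_def)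

lemma lp_norm_std_gen: "p \<ge> 1 \<Longrightarrow> lp_norm p (std_gen k) = 1"
  using psum_finite_support[of "Suc k" "std_gen k" p] by (simp add: std_gen_def lp_norm_eq)

lemma lp_tail:
  assumes f: "f \<in> lp p" and p: "p \<ge> 1" and e: "e > 0"
  obtains N where "\<And>M. M \<ge> N \<Longrightarrow> lp_norm p (\<lambda>n. if n < M then 0 else f n) < e"
proof -
  have sm: "summable (\<lambda>n. cmod (f n) powr p)" using f by (simp add: lp_iff)
  obtain N where N: "\<And>M. M \<ge> N \<Longrightarrow> norm (\<Sum>n. cmod (f (n + M)) powr p) < e powr p"
    using suminf_exist_split[OF _ sm, of "e powr p"] e by auto
  have "lp_norm p (\<lambda>n. if n < M then 0 else f n) < e" if "M \<ge> N" for M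
  proof -
    let ?g = "\<lambda>n. if n < M then 0 else f n"
    have sg: "summable (\<lambda>n. cmod (?g n) powr p)"
      by (rule summable_comparison_test'[OF sm, of 0]) auto
    have "psum p ?g = (\<Sum>n. cmod (?g (n + M)) powr p) + (\<Sum>n<M. cmod (?g n) powr p)"
      unfolding psum_def by (rule suminf_split_initial_segment[OF sg])
    hence "psum p ?g < e powr p" using N[OF that] by simp
    thus ?thesis using e p sg by (subst lp_norm_less_iff) (auto simp: lp_iff)
  qed
  thus thesis by (rule that)
qed

section \<open>Isometries for p different from 2\<close>

text \<open>Both inequalities pass through \<open>2 (cmod a ^ 2 + cmod b ^ 2) powr (p / 2)\<close>: the first half is a
  power mean inequality applied to the parallelogram law, the second is strict sub- or
  superadditivity of \<open>t \<mapsto> t powr (p / 2)\<close>.\<close>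

lemma cmod_powr_eq: "cmod z powr p = ((cmod z)\<^sup>2) powr (p / 2)"
proof -
  have "((cmod z)\<^sup>2) = cmod z powr 2" by simp
  thus ?thesis by (simp only: powr_powr) simp
qed

lemma parallelogram_cmod: "(cmod (a + b))\<^sup>2 + (cmod (a - b))\<^sup>2 = 2 * ((cmod a)\<^sup>2 + (cmod b)\<^sup>2)"
  unfolding cmod_power2 by (simp add: power2_eq_square algebra_simps)

lemma powr_add_strict:
  fixes r x y :: real
  assumes x: "x > 0" and y: "y > 0" and r: "r > 0"
  shows powr_subadd: "r < 1 \<Longrightarrow> (x + y) powr r < x powr r + y powr r"
    and powr_superadd: "1 < r \<Longrightarrow> x powr r + y powr r < (x + y) powr r"
proof -
  let ?u = "x / (x + y)" and ?v = "y / (x + y)"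
  have uv: "0 < ?u" "?u < 1" "0 < ?v" "?v < 1" "?u + ?v = 1"
    using x y by (auto simp: add_divide_distrib[symmetric])
  have eq: "x powr r + y powr r = (x + y) powr r * (?u powr r + ?v powr r)"
    using x y by (simp add: powr_divide algebra_simps)
  show "(x + y) powr r < x powr r + y powr r" if "r < 1"
  proof -
    have "?u powr 1 < ?u powr r" "?v powr 1 < ?v powr r" using uv that by (intro powr_less_mono'; simp)+
    hence "1 < ?u powr r + ?v powr r" using uv by (simp only: powr_one less_imp_le)
    thus ?thesis using x y unfolding eq by simp
  qed
  show "x powr r + y powr r < (x + y) powr r" if "1 < r"
  proof -
    have "?u powr r < ?u powr 1" "?v powr r < ?v powr 1" using uv that by (intro powr_less_mono'; simp)+
    hence "?u powr r + ?v powr r < 1" using uv by (simp only: powr_one less_imp_le)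
    thus ?thesis using x y unfolding eq by simp
  qed
qed

lemma powr_mean_ge:
  fixes r x y :: real
  assumes "r \<ge> 1" "x \<ge> 0" "y \<ge> 0" shows "2 * ((x + y) / 2) powr r \<le> x powr r + y powr r"
  using powr_convex_nonneg[of r x y "1/2" "1/2"] assms by (simp add: add_divide_distrib)

lemma powr_mean_le:
  fixes r x y :: real
  assumes r: "0 < r" "r \<le> 1" and xy: "x \<ge> 0" "y \<ge> 0"
  shows "x powr r + y powr r \<le> 2 * ((x + y) / 2) powr r"
proof -
  have "2 * ((x powr r + y powr r) / 2) powr (1 / r) \<le> (x powr r) powr (1 / r) + (y powr r) powr (1 / r)"
    using r by (intro powr_mean_ge) auto
  hence "((x powr r + y powr r) / 2) powr (1 / r) \<le> (x + y) / 2"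
    using r xy by (simp add: powr_powr)
  hence "(((x powr r + y powr r) / 2) powr (1 / r)) powr r \<le> ((x + y) / 2) powr r"
    using r by (intro powr_mono2) auto
  thus ?thesis using r by (simp add: powr_powr)
qed

text \<open>It vanishes if a or b is 0 and otherwise has a strict sign depending only on the side of
  2 on which p lies. Its sum over coordinates is an expression in norms, so norms detect
  disjointness of supports.\<close>

definition parallelogram_defect :: "real \<Rightarrow> complex \<Rightarrow> complex \<Rightarrow> real" where
  "parallelogram_defect p a b =
    2 * cmod a powr p + 2 * cmod b powr p - cmod (a + b) powr p - cmod (a - b) powr p"

lemma parallelogram_defect_sign:
  assumes p: "p > 0" and ab: "a \<noteq> 0" "b \<noteq> 0"
  shows parallelogram_defect_pos: "p < 2 \<Longrightarrow> parallelogram_defect p a b > 0"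
    and parallelogram_defect_neg: "2 < p \<Longrightarrow> parallelogram_defect p a b < 0"
proof -
  let ?x = "(cmod (a + b))\<^sup>2" and ?y = "(cmod (a - b))\<^sup>2" and ?A = "(cmod a)\<^sup>2" and ?B = "(cmod b)\<^sup>2"
  have eq: "(?x + ?y) / 2 = ?A + ?B" by (simp add: parallelogram_cmod)
  have pos: "?A > 0" "?B > 0" using ab by auto
  note d = parallelogram_defect_def cmod_powr_eq[of _ p]
  show "parallelogram_defect p a b > 0" if "p < 2"
  proof -
    have "?x powr (p/2) + ?y powr (p/2) \<le> 2 * (?A + ?B) powr (p/2)"
      unfolding eq[symmetric] using p that by (intro powr_mean_le) auto
    also have "\<dots> < 2 * (?A powr (p/2) + ?B powr (p/2))"
      using powr_subadd[OF pos, of "p/2"] p that by simp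
    finally show ?thesis unfolding d by simp
  qed
  show "parallelogram_defect p a b < 0" if "2 < p"
  proof -
    have "2 * (?A powr (p/2) + ?B powr (p/2)) < 2 * (?A + ?B) powr (p/2)"
      using powr_superadd[OF pos, of "p/2"] p that by simp
    also have "\<dots> \<le> ?x powr (p/2) + ?y powr (p/2)"
      unfolding eq[symmetric] using p that by (intro powr_mean_ge) auto
    finally show ?thesis unfolding d by simp
  qed
qed

lemma parallelogram_defect_0: "a = 0 \<or> b = 0 \<Longrightarrow> parallelogram_defect p a b = 0"
  by (auto simp: parallelogram_defect_def)

lemma parallelogram_defect_sums:
  assumes p: "p \<ge> 1" and f: "f \<in> lp p" and g: "g \<in> lp p"
  shows "(\<lambda>n. parallelogram_defect p (f n) (g n)) sums
    (2 * psum p f + 2 * psum p g - psum p (\<lambda>n. f n + g n) - psum p (\<lambda>n. f n - g n))"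
  unfolding parallelogram_defect_def
  using f g add_in_lp[OF assms] diff_in_lp[OF assms]
  by (intro sums_diff sums_add sums_mult) (auto simp: psum_def lp_iff)

context
  fixes p T assumes T: "surj_linear_isometry p T"
begin

lemma isometry_in_lp: "f \<in> lp p \<Longrightarrow> T f \<in> lp p"
  and isometry_surj: "f \<in> lp p \<Longrightarrow> \<exists>g\<in>lp p. T g = f"
  and isometry_norm: "f \<in> lp p \<Longrightarrow> lp_norm p (T f) = lp_norm p f"
  and isometry_add: "f \<in> lp p \<Longrightarrow> g \<in> lp p \<Longrightarrow> T (\<lambda>n. f n + g n) = (\<lambda>n. T f n + T g n)"
  and isometry_cmult: "f \<in> lp p \<Longrightarrow> T (\<lambda>n. c * f n) = (\<lambda>n. c * T f n)"
  using T unfolding surj_linear_isometry_def by (blast, metis image_iff, blast, blast, blast)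

lemma isometry_psum: "p \<ge> 1 \<Longrightarrow> f \<in> lp p \<Longrightarrow> psum p (T f) = psum p f"
  using lp_norm_powr[of f p] lp_norm_powr[of "T f" p] isometry_norm[of f] isometry_in_lp by simp

lemma isometry_diff:
  assumes f: "f \<in> lp p" and g: "g \<in> lp p"
  shows "T (\<lambda>n. f n - g n) = (\<lambda>n. T f n - T g n)"
  using isometry_add[OF f cmult_in_lp[OF g, of "-1"]] isometry_cmult[OF g, of "-1"] by simp

end

text \<open>T preserves the sum of the defects, which is 0 for disjoint supports. As the defects of
  the images all have the same sign, each of them is 0, and strictness excludes a common nonzero
  coordinate.\<close>

lemma isometry_disjoint:
  assumes T: "surj_linear_isometry p T" and p: "p \<ge> 1" "p \<noteq> 2" and f: "f \<in> lp p" and g: "g \<in> lp p"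
    and disj: "\<And>n. f n = 0 \<or> g n = 0"
  shows "T f n = 0 \<or> T g n = 0"
proof (rule ccontr)
  assume nz: "\<not> (T f n = 0 \<or> T g n = 0)"
  note TL = isometry_in_lp[OF T f] isometry_in_lp[OF T g]
  let ?d = "\<lambda>n. parallelogram_defect p (T f n) (T g n)"
  have "2 * psum p f + 2 * psum p g - psum p (\<lambda>n. f n + g n) - psum p (\<lambda>n. f n - g n) = 0"
    using parallelogram_defect_sums[OF p(1) f g] disj by (simp add: parallelogram_defect_0 sums_iff)
  moreover have "psum p (\<lambda>n. T f n + T g n) = psum p (\<lambda>n. f n + g n)"
    using isometry_psum[OF T p(1) add_in_lp[OF p(1) f g]] isometry_add[OF T f g] by simp
  moreover have "psum p (\<lambda>n. T f n - T g n) = psum p (\<lambda>n. f n - g n)"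
    using isometry_psum[OF T p(1) diff_in_lp[OF p(1) f g]] isometry_diff[OF T f g] by simp
  ultimately have sums: "?d sums 0"
    using parallelogram_defect_sums[OF p(1) TL] isometry_psum[OF T p(1) f] isometry_psum[OF T p(1) g]
    by simp
  have p0: "p > 0" using p by simp
  show False
  proof (cases "p < 2")
    case True
    have "?d m \<ge> 0" for m
      using parallelogram_defect_pos[OF p0 _ _ True] parallelogram_defect_0
      by (cases "T f m = 0 \<or> T g m = 0") (auto intro: less_imp_le)
    hence "?d n = 0" using sums suminf_eq_zero_iff[of ?d] by (simp add: sums_iff)
    thus False using parallelogram_defect_pos[OF p0 _ _ True, of "T f n" "T g n"] nz by simp
  next
    case False
    hence gt: "2 < p" using p by simp
    have "- ?d m \<ge> 0" for m
      using parallelogram_defect_neg[OF p0 _ _ gt] parallelogram_defect_0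
      by (cases "T f m = 0 \<or> T g m = 0") (auto intro: less_imp_le)
    hence "- ?d n = 0" using sums_minus[OF sums] suminf_eq_zero_iff[of "\<lambda>m. - ?d m"] by (simp add: sums_iff)
    thus False using parallelogram_defect_neg[OF p0 _ _ gt, of "T f n" "T g n"] nz by simp
  qed
qed

text \<open>The preimage of \<open>e\<^sub>0\<close> cannot be split into two nonzero disjoint parts.\<close>

lemma isometry_std_gen:
  assumes T: "surj_linear_isometry p T" and p: "p \<ge> 1" "p \<noteq> 2"
  obtains k c where "cmod c = 1" "T (std_gen k) = (\<lambda>n. c * std_gen 0 n)"
proof -
  have inj0: "h = (\<lambda>_. 0)" if "h \<in> lp p" "T h = (\<lambda>_. 0)" for h
    using isometry_norm[OF T that(1)] lp_norm_eq_0_iff[OF that(1) p(1)] lp_norm_eq_0_iff[OF zero_in_lp p(1)] that(2)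
    by simp
  note hom = isometry_cmult[OF T]
  have "\<exists>g\<in>lp p. T g = std_gen 0" by (rule isometry_surj[OF T std_gen_in_lp])
  then obtain g where g: "g \<in> lp p" "T g = std_gen 0" by auto
  have "g \<noteq> (\<lambda>_. 0)"
  proof
    assume "g = (\<lambda>_. 0)"
    hence "T g = (\<lambda>n. 0 * T g n)" using hom[OF g(1), of 0] by simp
    hence "std_gen 0 0 = 0" using g(2) by (simp add: fun_eq_iff)
    thus False by (simp add: std_gen_def)
  qed
  then obtain k where k: "g k \<noteq> 0" by auto
  define h where "h = (\<lambda>n. g k * std_gen k n)"
  have h: "h \<in> lp p" unfolding h_def by (intro cmult_in_lp std_gen_in_lp)
  let ?h' = "\<lambda>n. g n - h n"
  have h': "?h' \<in> lp p" by (intro diff_in_lp p g h)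
  have disj: "T h n = 0 \<or> T ?h' n = 0" for n
    by (rule isometry_disjoint[OF T p h h']) (auto simp: h_def std_gen_def)
  \<comment> \<open>The two disjoint images add up to \<open>std_gen 0\<close>, so off coordinate 0
    both vanish, and at 0 one of them does.\<close>
  have split: "T ?h' n = std_gen 0 n - T h n" for n
    using isometry_diff[OF T g(1) h] g(2) by simp
  have "T h = (\<lambda>_. 0) \<or> T ?h' = (\<lambda>_. 0)"
  proof (cases "T h 0 = 0")
    case True
    hence "T h n = 0" for n using disj[of n] split[of n] by (cases n) (auto simp: std_gen_def)
    thus ?thesis by auto
  next
    case False
    hence "T ?h' n = 0" for n using disj[of n] split[of n] by (cases n) (auto simp: std_gen_def)
    thus ?thesis by auto
  qed
  moreover have "h \<noteq> (\<lambda>_. 0)" using k by (auto simp: h_def std_gen_def fun_eq_iff)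
  ultimately have "?h' = (\<lambda>_. 0)" using inj0[OF h] inj0[OF h'] by blast
  hence "g = h" by (auto simp: fun_eq_iff)
  hence "std_gen 0 = T h" using g(2) by simp
  also have "T h = (\<lambda>n. g k * T (std_gen k) n)" unfolding h_def by (rule hom[OF std_gen_in_lp])
  finally have eq: "std_gen 0 = (\<lambda>n. g k * T (std_gen k) n)" .
  have Te: "T (std_gen k) = (\<lambda>n. inverse (g k) * std_gen 0 n)"
    unfolding eq using k by (simp add: field_simps)
  have "lp_norm p (T (std_gen k)) = 1"
    using isometry_norm[OF T std_gen_in_lp] lp_norm_std_gen[OF p(1)] by simp
  hence "cmod (inverse (g k)) = 1"
    unfolding Te using lp_norm_cmult[OF std_gen_in_lp p(1)] lp_norm_std_gen[OF p(1)] by simp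
  thus thesis using Te by (rule that)
qed

section \<open>Rational points and computable norms\<close>

definition padd :: "rat_point \<Rightarrow> rat_point \<Rightarrow> rat_point" where
  "padd z w = (fst z + fst w, snd z + snd w)"

definition pmult :: "rat_point \<Rightarrow> rat_point \<Rightarrow> rat_point" where
  "pmult z w = (fst z * fst w - snd z * snd w, fst z * snd w + snd z * fst w)"

lemma point_padd: "point (padd z w) = point z + point w"
  by (simp add: point_def padd_def of_rat_add complex_eq_iff)

lemma point_pmult: "point (pmult z w) = point z * point w"
  by (simp add: point_def pmult_def of_rat_add of_rat_diff of_rat_mult complex_eq_iff)

lemma point_of_rat: "point (q, 0) = of_real (of_rat q)"
  by (simp add: point_def complex_eq_iff)

lemma computable_padd [comp_intros]:
  "computable f \<Longrightarrow> computable g \<Longrightarrow> computable (\<lambda>x. padd (f x) (g x))"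
  unfolding padd_def by (intro comp_intros)

lemma computable_pmult [comp_intros]:
  "computable f \<Longrightarrow> computable g \<Longrightarrow> computable (\<lambda>x. pmult (f x) (g x))"
  unfolding pmult_def by (intro comp_intros)

lemma enc_eq_point_code: "enc z = point_code z"
  by (simp add: enc_prod_def point_code_def enc_rat_eq_rat_code)

lemma enc_eq_points_code: "enc zs = points_code zs"
proof -
  have "enc = point_code" by (rule ext) (rule enc_eq_point_code)
  thus ?thesis by (simp add: enc_list_def points_code_def)
qed

lemma enc_eq_ball_code: "enc B = ball_code B"
  by (simp add: enc_prod_def ball_code_def enc_rat_eq_rat_code enc_eq_points_code)

text \<open>Unlike \<open>lnth\<close> it defaults to the zero point: coefficient lists stand for
  finitely supported sequences, so lists of different lengths can be combined.\<close>

definition coeff_at :: "rat_point list \<Rightarrow> nat \<Rightarrow> rat_point" where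
  "coeff_at zs i = (if i < length zs then zs ! i else (0, 0))"

lemma computable_coeff_at [comp_intros]:
  assumes "computable f" "computable g" shows "computable (\<lambda>x. coeff_at (f x) (g x))"
proof -
  have "computable (\<lambda>x. if g x < length (f x) then lnth (f x) (g x) else (0, 0))"
    by (intro comp_intros assms)
  moreover have "(if i < length zs then lnth zs i else (0, 0)) = coeff_at zs i" for zs i
    by (simp add: coeff_at_def)
  ultimately show ?thesis by simp
qed

text \<open>\<open>creal_powr\<close> wants a base that is nonnegative at every argument. Truncation
  at 0 provides this where the sign is known only under a guard.\<close>

lemma creal_powr_max:
  assumes f: "computable f" and p: "creal (\<lambda>_::nat. p)" "p > 0"
  shows "creal (\<lambda>x. (max 0 (of_rat (f x))) powr p)"
proof -
  have "computable (\<lambda>x. if 0 \<le> f x then f x else 0)" by (intro comp_intros f)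
  from creal_powr[OF this _ p] have "creal (\<lambda>x. of_rat (if 0 \<le> f x then f x else 0) powr p)" by simp
  moreover have "of_rat (if 0 \<le> q then q else 0) = max 0 (of_rat q :: real)" for q
    by (simp add: max_def)
  ultimately show ?thesis by simp
qed

text \<open>The squared modulus of a rational point is rational; raising it to p / 2 avoids the
  square root.\<close>

lemma creal_cmod_powr [creal_intros]:
  assumes f: "computable f" and p: "creal (\<lambda>_::nat. p)" "p > 0"
  shows "creal (\<lambda>x. cmod (point (f x)) powr p)"
proof -
  have "creal (\<lambda>_::nat. of_rat (1 / 2) * p)" by (rule creal_mult_rat) (use p in auto)
  hence p2: "creal (\<lambda>_::nat. p / 2)" by (simp add: of_rat_divide)
  have "computable (\<lambda>x. fst (f x) ^ 2 + snd (f x) ^ 2)" by (intro comp_intros f)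
  from creal_powr[OF this _ p2] p(2) have "creal (\<lambda>x. of_rat (fst (f x) ^ 2 + snd (f x) ^ 2) powr (p / 2))"
    by simp
  moreover have "of_rat (fst z ^ 2 + snd z ^ 2) = (cmod (point z))\<^sup>2" for z
    by (simp add: cmod_power2 point_def of_rat_add of_rat_power)
  ultimately show ?thesis by (simp only: cmod_powr_eq[symmetric])
qed

lemma creal_lp_norm:
  assumes S: "creal (\<lambda>x. psum p (f x))" and mem: "\<And>x. f x \<in> lp p" and p: "creal (\<lambda>_::nat. p)" "p \<ge> 1"
  shows "creal (\<lambda>x. lp_norm p (f x))"
proof -
  have max: "of_rat q = max 0 (of_rat q :: real)" if "0 \<le> q" for q using that by simp
  have 1: "lp_norm p (f x) < of_rat q \<longleftrightarrow> 0 < q \<and> psum p (f x) < (max 0 (of_rat q)) powr p" for x q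
  proof (cases "0 < q")
    case True
    thus ?thesis using lp_norm_less_iff[OF mem p(2), of "of_rat q" x] by simp
  next
    case False
    hence "of_rat q \<le> (0::real)" by simp
    thus ?thesis using False lp_norm_nonneg[of p "f x"] by linarith
  qed
  have 2: "of_rat q < lp_norm p (f x) \<longleftrightarrow> q < 0 \<or> (0 \<le> q \<and> (max 0 (of_rat q)) powr p < psum p (f x))" for x q
  proof (cases "0 \<le> q")
    case True
    thus ?thesis using lp_norm_le_iff[OF mem p(2), of "of_rat q" x] by (auto simp: not_le[symmetric])
  next
    case False
    hence "of_rat q < (0::real)" by simp
    thus ?thesis using False lp_norm_nonneg[of p "f x"] by linarith
  qed
  have p0: "p > 0" using p by simp
  show ?thesis unfolding creal_def[of "\<lambda>x. lp_norm p (f x)"] 1 2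
    by (intro conjI semi_intros creal_powr_max[OF _ p(1) p0] creal_comp[OF S] comp_intros)
qed

text \<open>Converse of \<open>creal_approx\<close>: both error bounds are strict, hence
  confirmable, and rationals satisfying them exist by density.\<close>

lemma creal_imp_approx:
  assumes f: "creal f"
  obtains g where "computable g" "\<And>x k. \<bar>of_rat (g (x, k)) - f x\<bar> < 1 / 2 ^ k"
proof -
  have pow: "of_rat (1 / 2 ^ k) = (1 / 2 ^ k :: real)" for k
    by (simp add: of_rat_divide of_rat_power)
  let ?P = "\<lambda>z q. f (fst z) < of_rat (q + 1 / 2 ^ snd z) \<and> of_rat (q - 1 / 2 ^ snd z) < f (fst z)"
  have "semidec (\<lambda>z. ?P (fst z) (snd z))"
    by (intro semi_intros creal_lower[OF f] creal_upper[OF f] comp_intros)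
  moreover have "\<exists>q. ?P z q" for z
  proof -
    obtain q where q: "f (fst z) - 1 / 2 ^ snd z < of_rat q" "of_rat q < f (fst z)"
      using of_rat_dense[of "f (fst z) - 1 / 2 ^ snd z" "f (fst z)"] by auto
    have "(0::real) < 1 / 2 ^ snd z" by simp
    hence "?P z q" unfolding of_rat_add of_rat_diff pow using q by linarith
    thus ?thesis ..
  qed
  ultimately obtain g where g: "computable g" "\<And>z. ?P z (g z)" by (rule semidec_choice[where P = ?P]) blast
  have "\<bar>of_rat (g (x, k)) - f x\<bar> < 1 / 2 ^ k" for x k
    using g(2)[of "(x, k)"] unfolding of_rat_add of_rat_diff pow fst_conv snd_conv by linarith
  with g(1) show thesis by (rule that)
qed

lemma effective_generating_setI:
  assumes "generating_set p F" and "creal (\<lambda>zs. lp_norm p (lin_comb F (map point zs)))"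
  shows "effective_generating_set p F"
proof -
  obtain g :: "rat_point list \<times> nat \<Rightarrow> rat" where g: "computable g"
    "\<And>zs k. \<bar>of_rat (g (zs, k)) - lp_norm p (lin_comb F (map point zs))\<bar> < 1 / 2 ^ k"
    using creal_imp_approx[OF assms(2)] by blast
  have "partrec (\<lambda>n. Some (enc (g (dec n))))"
    using g(1) unfolding computable_def recursive_def .
  moreover have "(\<lambda>n. Some (enc (g (dec n)))) (prod_encode (points_code zs, k)) = Some (rat_code (g (zs, k)))" for zs k
  proof -
    have "prod_encode (points_code zs, k) = enc (zs, k)"
      by (simp add: enc_prod_def enc_eq_points_code enc_nat_def)
    thus ?thesis by (simp add: enc_rat_eq_rat_code)
  qed
  ultimately show ?thesis unfolding effective_generating_set_def using assms(1) g(2) by blast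
qed

lemma lin_comb_in_lp:
  assumes "p \<ge> 1" "\<And>j. F j \<in> lp p" shows "lin_comb F cs \<in> lp p"
proof -
  have "(\<lambda>n. \<Sum>j<m. cs ! j * F j n) \<in> lp p" for m
    by (induction m) (simp_all add: zero_in_lp add_in_lp[OF assms(1)] cmult_in_lp assms(2))
  thus ?thesis by (simp add: lin_comb_def)
qed

lemma lin_comb_std_gen: "lin_comb std_gen cs n = (if n < length cs then cs ! n else 0)"
proof -
  have "(\<Sum>j<length cs. cs ! j * (if n = j then 1 else 0)) = (\<Sum>j<length cs. if n = j then cs ! j else 0)"
    by (rule sum.cong) auto
  thus ?thesis by (simp add: lin_comb_def std_gen_def)
qed

lemma point_coeff_at: "point (coeff_at zs i) = (if i < length zs then map point zs ! i else 0)"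
  by (simp add: coeff_at_def point_def complex_eq_iff)

section \<open>Failure of computable categoricity for p different from 2\<close>

text \<open>The weights \<open>u\<close> enumerate an undecidable set. The generating set consists of \<open>e\<^sub>1, e\<^sub>2, \<dots>\<close> and of
  one unit vector \<open>c e\<^sub>0 + \<Sum> u\<^sub>i e\<^sub>i\<^sub>+\<^sub>1\<close>. Norms of combinations are computable since the unknown
  contribution of the infinite tail and of \<open>c\<close> is determined by the unit norm.\<close>

locale weights =
  fixes p :: real and u :: "nat \<Rightarrow> rat"
  assumes p1: "p \<ge> 1" and crp: "creal (\<lambda>_::nat. p)"
    and comp_u: "computable u" and u_nonneg: "\<And>i. 0 \<le> u i" and u_le_1: "\<And>i. u i \<le> 1"
    and sum_u: "\<And>n. (\<Sum>i<n. u i) \<le> 1 / 2"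
begin

definition w :: "nat \<Rightarrow> real" where "w i = of_rat (u i) powr p"
definition \<gamma> :: real where "\<gamma> = (\<Sum>i. w i)"
text \<open>The coefficient that gives \<open>gen 0\<close> norm 1. Since the weights sum to at most
  1 / 2, so does \<gamma>, and c0 is positive.\<close>

definition c0 :: real where "c0 = (1 - \<gamma>) powr (1 / p)"

fun gen :: "nat \<Rightarrow> nat \<Rightarrow> complex" where
  "gen 0 0 = of_real c0"
| "gen 0 (Suc i) = of_real (of_rat (u i))"
| "gen (Suc j) n = std_gen (Suc j) n"

lemma p0: "p > 0" using p1 by simp

lemma w_nonneg: "0 \<le> w i" by (simp add: w_def)

lemma sum_w_le: "(\<Sum>i<n. w i) \<le> 1 / 2"
proof -
  have "w i \<le> of_rat (u i)" for i
  proof -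
    have "of_rat (u i) powr p \<le> of_rat (u i) powr (1::real)"
      using u_nonneg[of i] u_le_1[of i] p1 by (intro powr_mono') auto
    thus ?thesis using u_nonneg[of i] by (simp add: w_def)
  qed
  hence "(\<Sum>i<n. w i) \<le> (\<Sum>i<n. of_rat (u i))" by (rule sum_mono)
  also have "\<dots> = of_rat (\<Sum>i<n. u i)" by (simp add: of_rat_sum)
  also have "\<dots> \<le> of_rat (1 / 2)" using sum_u by (simp only: of_rat_less_eq)
  finally show ?thesis by (simp add: of_rat_divide)
qed

lemma summable_w: "summable w"
  by (rule summableI_nonneg_bounded[OF w_nonneg sum_w_le])

lemma w_sums: "w sums \<gamma>"
  unfolding \<gamma>_def by (rule summable_sums[OF summable_w])

lemma \<gamma>_le: "\<gamma> \<le> 1 / 2"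
  unfolding \<gamma>_def by (rule suminf_le_const[OF summable_w sum_w_le])

lemma c0_pos: "c0 > 0" and c0_powr: "c0 powr p = 1 - \<gamma>"
  using \<gamma>_le p0 by (auto simp: c0_def powr_powr)

text \<open>Far out, a combination of the generators agrees with a multiple of \<open>gen 0\<close>,
  so its tail is a multiple of what the partial sum leaves of \<gamma>.\<close>

lemma gen_sums:
  assumes "\<And>i. i \<ge> M \<Longrightarrow> f (Suc i) = a * of_real (of_rat (u i))"
  shows "(\<lambda>n. cmod (f n) powr p) sums
    (cmod (f 0) powr p + (\<Sum>i<M. cmod (f (Suc i)) powr p) + cmod a powr p * (\<gamma> - (\<Sum>i<M. w i)))"
proof -
  have eq: "cmod (f (Suc (i + M))) powr p = cmod a powr p * w (i + M)" for i
    using assms[of "i + M"] u_nonneg[of "i + M"] by (simp add: norm_mult powr_mult w_def)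
  have "(\<lambda>i. w (i + M)) sums (\<gamma> - (\<Sum>i<M. w i))"
    using w_sums by (subst sums_iff_shift) simp
  hence "(\<lambda>i. cmod (f (Suc (i + M))) powr p) sums (cmod a powr p * (\<gamma> - (\<Sum>i<M. w i)))"
    unfolding eq by (rule sums_mult)
  hence "(\<lambda>i. cmod (f (Suc i)) powr p) sums
      (cmod a powr p * (\<gamma> - (\<Sum>i<M. w i)) + (\<Sum>i<M. cmod (f (Suc i)) powr p))"
    by (subst (asm) sums_iff_shift[where f = "\<lambda>i. cmod (f (Suc i)) powr p"])
  hence "(\<lambda>n. cmod (f n) powr p) sums
      (cmod a powr p * (\<gamma> - (\<Sum>i<M. w i)) + (\<Sum>i<M. cmod (f (Suc i)) powr p) + cmod (f 0) powr p)"
    by (subst (asm) sums_Suc_iff) simp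
  thus ?thesis by (simp add: add_ac)
qed

lemma gen_in_lp: "gen j \<in> lp p"
proof (cases j)
  case 0
  have "(\<lambda>n. cmod (gen 0 n) powr p) sums
    (cmod (gen 0 0) powr p + (\<Sum>i<0. cmod (gen 0 (Suc i)) powr p) + cmod 1 powr p * (\<gamma> - (\<Sum>i<0. w i)))"
    by (rule gen_sums) simp
  thus ?thesis using 0 by (auto simp: lp_iff sums_iff)
next
  case (Suc i)
  have "gen (Suc i) = std_gen (Suc i)" by (rule ext) simp
  thus ?thesis using Suc std_gen_in_lp by simp
qed

lemma lin_comb_gen:
  assumes "cs \<noteq> []"
  shows lin_comb_gen_0: "lin_comb gen cs 0 = cs ! 0 * of_real c0"
    and lin_comb_gen_Suc: "lin_comb gen cs (Suc i) = cs ! 0 * of_real (of_rat (u i)) +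
      (if Suc i < length cs then cs ! Suc i else 0)"
proof -
  obtain M where M: "length cs = Suc M" using assms by (cases cs) auto
  show "lin_comb gen cs 0 = cs ! 0 * of_real c0"
    unfolding lin_comb_def M sum.lessThan_Suc_shift by (simp add: std_gen_def)
  have "(\<Sum>j<M. cs ! Suc j * (if i = j then 1 else 0)) = (\<Sum>j<M. if i = j then cs ! Suc j else 0)"
    by (rule sum.cong) auto
  thus "lin_comb gen cs (Suc i) = cs ! 0 * of_real (of_rat (u i)) +
      (if Suc i < length cs then cs ! Suc i else 0)"
    unfolding lin_comb_def M sum.lessThan_Suc_shift by (simp add: std_gen_def)
qed

text \<open>Here \<gamma> cancels: coordinate 0 contributes the factor 1 - \<gamma>, the tail
  \<gamma> minus a partial sum. What remains is a finite expression in rational data.\<close>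

lemma psum_lin_comb_gen:
  assumes "cs \<noteq> []"
  shows "psum p (lin_comb gen cs) = cmod (cs ! 0) powr p +
    (\<Sum>i<length cs - 1. cmod (cs ! 0 * of_real (of_rat (u i)) + cs ! Suc i) powr p
       - cmod (cs ! 0 * of_real (of_rat (u i))) powr p)"
proof -
  let ?M = "length cs - 1" and ?a = "cs ! 0"
  have "(\<lambda>n. cmod (lin_comb gen cs n) powr p) sums
    (cmod (lin_comb gen cs 0) powr p + (\<Sum>i<?M. cmod (lin_comb gen cs (Suc i)) powr p) +
     cmod ?a powr p * (\<gamma> - (\<Sum>i<?M. w i)))"
    by (rule gen_sums) (auto simp: lin_comb_gen_Suc[OF assms])
  hence "psum p (lin_comb gen cs) = cmod (lin_comb gen cs 0) powr p +
    (\<Sum>i<?M. cmod (lin_comb gen cs (Suc i)) powr p) + cmod ?a powr p * (\<gamma> - (\<Sum>i<?M. w i))"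
    unfolding psum_def by (rule sums_unique[symmetric])
  also have "(\<Sum>i<?M. cmod (lin_comb gen cs (Suc i)) powr p) =
      (\<Sum>i<?M. cmod (?a * of_real (of_rat (u i)) + cs ! Suc i) powr p)"
    by (rule sum.cong) (auto simp: lin_comb_gen_Suc[OF assms])
  also have "cmod (lin_comb gen cs 0) powr p = cmod ?a powr p * (1 - \<gamma>)"
    using c0_pos c0_powr by (simp add: lin_comb_gen_0[OF assms] norm_mult powr_mult)
  also have "cmod ?a powr p * (\<gamma> - (\<Sum>i<?M. w i)) =
      cmod ?a powr p * \<gamma> - (\<Sum>i<?M. cmod (?a * of_real (of_rat (u i))) powr p)"
    using u_nonneg by (simp add: norm_mult powr_mult w_def right_diff_distrib sum_distrib_left)
  finally show ?thesis by (simp add: sum_subtractf algebra_simps)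
qed

lemma creal_psum_gen: "creal (\<lambda>zs. psum p (lin_comb gen (map point zs)))"
proof -
  let ?a = "\<lambda>zs. coeff_at zs 0"
  have "creal (\<lambda>zs. if zs = [] then 0 else cmod (point (?a zs)) powr p +
    (\<Sum>i<length zs - Suc 0. cmod (point (padd (pmult (?a zs) (u i, 0)) (coeff_at zs (Suc i)))) powr p
       - cmod (point (pmult (?a zs) (u i, 0))) powr p))"
    by (intro creal_intros comp_intros crp p0 computable_comp[OF comp_u])
  moreover have "(if zs = [] then 0 else cmod (point (?a zs)) powr p +
    (\<Sum>i<length zs - Suc 0. cmod (point (padd (pmult (?a zs) (u i, 0)) (coeff_at zs (Suc i)))) powr p
       - cmod (point (pmult (?a zs) (u i, 0))) powr p)) = psum p (lin_comb gen (map point zs))" for zs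
  proof (cases "zs = []")
    case True
    thus ?thesis by (simp add: lin_comb_def psum_def)
  next
    case False
    thus ?thesis
      by (auto simp: psum_lin_comb_gen point_padd point_pmult point_of_rat point_coeff_at intro!: sum.cong)
  qed
  ultimately show ?thesis by simp
qed

lemma generating_gen: "generating_set p gen"
  unfolding generating_set_def
proof (intro conjI allI ballI impI gen_in_lp)
  fix f and \<epsilon> :: real
  assume f: "f \<in> lp p" and "\<epsilon> > 0"
  \<comment> \<open>Coordinate 0 is reached by \<open>gen 0\<close> alone, which fixes a; the other
    generators then correct finitely many of the remaining coordinates.\<close>
  define a where "a = f 0 / of_real c0"
  define h where "h = (\<lambda>n. f n - a * gen 0 n)"
  have h: "h \<in> lp p" unfolding h_def by (intro diff_in_lp p1 f cmult_in_lp gen_in_lp)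
  obtain N where N: "\<And>M. M \<ge> N \<Longrightarrow> lp_norm p (\<lambda>n. if n < M then 0 else h n) < \<epsilon>"
    using lp_tail[OF h p1 \<open>\<epsilon> > 0\<close>] by blast
  define cs where "cs = a # map (\<lambda>i. h (Suc i)) [0..<N]"
  have cs: "cs \<noteq> []" "length cs = Suc N" "cs ! 0 = a" "\<And>i. i < N \<Longrightarrow> cs ! Suc i = h (Suc i)"
    by (auto simp: cs_def)
  have "f n - lin_comb gen cs n = (if n < Suc N then 0 else h n)" for n
  proof (cases n)
    case 0
    thus ?thesis using c0_pos cs by (simp add: lin_comb_gen_0 a_def)
  next
    case (Suc i)
    thus ?thesis using cs by (simp add: lin_comb_gen_Suc h_def)
  qed
  moreover have "lp_norm p (\<lambda>n. f n - lin_comb gen cs n) = lp_norm p (\<lambda>n. lin_comb gen cs n - f n)"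
    by (rule lp_norm_minus_commute)
  ultimately have "lin_comb gen cs \<in> lp_ball p f \<epsilon>"
    unfolding lp_ball_def using N[of "Suc N"] lin_comb_in_lp[OF p1 gen_in_lp] by simp
  thus "\<exists>cs. lin_comb gen cs \<in> lp_ball p f \<epsilon>" ..
qed

lemma effective_gen: "effective_generating_set p gen"
  by (intro effective_generating_setI generating_gen creal_lp_norm creal_psum_gen crp p1
      lin_comb_in_lp gen_in_lp)

text \<open>Convergence provides an output ball inside a small set, whereas the estimates need a
  small radius. Comparing the centre with a point of the ball at distance r / 2 from it gives r / 2
  < 2 \<epsilon>.\<close>

lemma ball_radius_less:
  assumes F: "\<And>j. F j \<in> lp p" and B: "0 < fst B" and x: "x \<in> lp p"
    and sub: "ball_set p F B \<subseteq> lp_ball p x \<epsilon>"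
  shows "of_rat (fst B) < 4 * \<epsilon>"
proof -
  define r :: real where "r = of_rat (fst B)"
  have r: "r > 0" using B by (simp add: r_def)
  define c where "c = lin_comb F (map point (snd B))"
  have c: "c \<in> lp p" unfolding c_def by (intro lin_comb_in_lp p1 F)
  define d where "d = (\<lambda>n. of_real (r / 2) * std_gen 0 n)"
  have d: "d \<in> lp p" unfolding d_def by (intro cmult_in_lp std_gen_in_lp)
  have norm_d: "lp_norm p d = r / 2"
    unfolding d_def lp_norm_cmult[OF std_gen_in_lp p1] lp_norm_std_gen[OF p1] norm_of_real using r by simp
  have cd: "(\<lambda>n. c n + d n) \<in> lp p" by (intro add_in_lp p1 c d)
  have "c \<in> ball_set p F B"
    using c r by (simp add: ball_set_def lp_ball_def c_def[symmetric] r_def[symmetric] lp_norm_def p0)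
  hence 1: "lp_norm p (\<lambda>n. x n - c n) < \<epsilon>"
    using sub lp_norm_minus_commute[of p x c] by (auto simp: lp_ball_def)
  have "(\<lambda>n. c n + d n) \<in> ball_set p F B"
    using cd r norm_d by (simp add: ball_set_def lp_ball_def c_def[symmetric] r_def[symmetric])
  hence 2: "lp_norm p (\<lambda>n. (c n + d n) - x n) < \<epsilon>" using sub by (auto simp: lp_ball_def)
  have "lp_norm p (\<lambda>n. (c n + d n) - c n) < 2 * \<epsilon>"
    using lp_norm_diff_triangle[OF p1 cd x c] 1 2 by linarith
  thus ?thesis using norm_d by (simp add: r_def)
qed

lemma creal_psum_std_gen_diff:
  "creal (\<lambda>zs. psum p (\<lambda>n. std_gen k n - lin_comb std_gen (map point zs) n))"
proof -
  let ?f = "\<lambda>zs n. std_gen k n - lin_comb std_gen (map point zs) n"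
  let ?z = "\<lambda>zs i. padd (if i = k then (1, 0) else (0, 0)) (pmult (-1, 0) (coeff_at zs i))"
  have "creal (\<lambda>zs. \<Sum>i<length zs + Suc k. cmod (point (?z zs i)) powr p)"
    by (intro creal_intros comp_intros crp p0)
  moreover have "(\<Sum>i<length zs + Suc k. cmod (point (?z zs i)) powr p) = psum p (?f zs)" for zs
  proof -
    have "psum p (?f zs) = (\<Sum>i<length zs + Suc k. cmod (?f zs i) powr p)"
      by (rule psum_finite_support) (auto simp: lin_comb_std_gen std_gen_def)
    also have "\<dots> = (\<Sum>i<length zs + Suc k. cmod (point (?z zs i)) powr p)"
      by (rule sum.cong) (auto simp: lin_comb_std_gen std_gen_def point_padd point_pmult point_coeff_at
        point_of_rat point_def[of "(0, 0)"] of_rat_minus complex_eq_iff)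
    finally show ?thesis by simp
  qed
  ultimately show ?thesis by simp
qed

text \<open>If \<open>e\<^sub>k\<close> is sent to a unimodular multiple of \<open>e\<^sub>0\<close>, then approximating the latter by
  combinations of \<open>gen\<close> approximates \<open>1 / c0\<close> by the moduli of the leading coefficients.\<close>

lemma computable_modulus:
  assumes T: "computable_map p std_gen gen T" and c: "cmod c = 1"
    and Tk: "T (std_gen k) = (\<lambda>n. c * std_gen 0 n)"
    and v: "computable v" "\<And>e. 0 < v e"
  obtains s where "computable s" "\<And>e::nat. \<gamma> < (\<Sum>i<s e. w i) + of_rat (v e) powr p"
proof -
  from T obtain \<phi> where \<phi>: "partrec \<phi>"
    and correct: "\<And>B1 B2. B1 \<in> rat_balls \<Longrightarrow> B2 \<in> rat_balls \<Longrightarrow> \<phi> (ball_code B1) = Some (ball_code B2) \<Longrightarrow>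
        (\<forall>f\<in>ball_set p std_gen B1. T f \<in> ball_set p gen B2)"
    and conv: "\<And>f U. f \<in> lp p \<Longrightarrow> lp_neighborhood p (T f) U \<Longrightarrow>
        (\<exists>B1\<in>rat_balls. \<exists>B2\<in>rat_balls. f \<in> ball_set p std_gen B1 \<and>
          \<phi> (ball_code B1) = Some (ball_code B2) \<and> ball_set p gen B2 \<subseteq> U)"
    unfolding computable_map_def by blast
  let ?ek = "std_gen k"
  let ?a = "\<lambda>B2 :: rat_ball. coeff_at (snd B2) 0"
  \<comment> \<open>\<open>Q e s\<close> certifies the required bound. For an output ball with
    radius r and leading coefficient a it says
    \<open>cmod a powr p * (1 - S - v e powr p) < (1 - r) powr p\<close>, where S is the sum of the
    first s weights. As \<open>1 - r < cmod a * c0\<close>, the right side is below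
    \<open>cmod a powr p * (1 - \<gamma>)\<close>.\<close>
  define Q where "Q e s \<longleftrightarrow> (\<exists>B1 B2 :: rat_ball. 0 < fst B1 \<and> snd B1 \<noteq> [] \<and> 0 < fst B2 \<and> snd B2 \<noteq> [] \<and>
      psum p (\<lambda>n. ?ek n - lin_comb std_gen (map point (snd B1)) n) < max 0 (of_rat (fst B1)) powr p \<and>
      \<phi> (enc B1) = Some (enc B2) \<and> fst B2 < 1 \<and>
      cmod (point (?a B2)) powr p - (\<Sum>i<s. cmod (point (pmult (?a B2) (u i, 0))) powr p) -
        cmod (point (pmult (?a B2) (v e, 0))) powr p < max 0 (of_rat (1 - fst B2)) powr p)" for e s :: nat
  have ball_iff: "?ek \<in> ball_set p std_gen B \<longleftrightarrow>
      psum p (\<lambda>n. ?ek n - lin_comb std_gen (map point (snd B)) n) < max 0 (of_rat (fst B)) powr p"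
    if "0 < fst B" for B
  proof -
    have "(\<lambda>n. ?ek n - lin_comb std_gen (map point (snd B)) n) \<in> lp p"
      by (intro diff_in_lp p1 std_gen_in_lp lin_comb_in_lp)
    from lp_norm_less_iff[OF this p1, of "of_rat (fst B)"] show ?thesis
      using that by (simp add: ball_set_def lp_ball_def std_gen_in_lp)
  qed
  have a_eq: "cmod (point (?a B)) powr p - (\<Sum>i<s. cmod (point (pmult (?a B) (u i, 0))) powr p) -
        cmod (point (pmult (?a B) (v e, 0))) powr p =
      cmod (map point (snd B) ! 0) powr p * (1 - (\<Sum>i<s. w i) - of_rat (v e) powr p)" if "snd B \<noteq> []" for B s e
    using that u_nonneg v(2)[of e]
    by (simp add: point_pmult point_of_rat point_coeff_at norm_mult powr_mult w_def right_diff_distrib sum_distrib_left)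
  have near: "\<bar>cmod (map point (snd B) ! 0) * c0 - 1\<bar> < of_rat (fst B)"
    if "snd B \<noteq> []" "T ?ek \<in> ball_set p gen B" for B
  proof -
    let ?g = "\<lambda>n. T ?ek n - lin_comb gen (map point (snd B)) n"
    have "T ?ek \<in> lp p" "lp_norm p ?g < of_rat (fst B)" using that(2) by (auto simp: ball_set_def lp_ball_def)
    moreover from this have "?g \<in> lp p" by (intro diff_in_lp p1 lin_comb_in_lp gen_in_lp)
    ultimately have "cmod (?g 0) < of_rat (fst B)" using cmod_le_lp_norm[of ?g p 0] p1 by linarith
    hence "cmod (c - map point (snd B) ! 0 * of_real c0) < of_rat (fst B)"
      using that(1) unfolding Tk by (simp add: lin_comb_gen_0 std_gen_def)
    moreover have "\<bar>cmod (map point (snd B) ! 0 * of_real c0) - cmod c\<bar> \<le> cmod (c - map point (snd B) ! 0 * of_real c0)"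
      using norm_triangle_ineq3[of "map point (snd B) ! 0 * of_real c0" c] by (simp only: norm_minus_commute)
    ultimately show ?thesis using c c0_pos by (simp add: norm_mult)
  qed
  have c0a: "(cmod z * c0) powr p = cmod z powr p * (1 - \<gamma>)" for z
    using c0_pos c0_powr by (simp add: powr_mult)
  have sound: "\<gamma> < (\<Sum>i<s. w i) + of_rat (v e) powr p" if Qes: "Q e s" for e s
  proof -
    from Qes obtain B1 B2 where B: "0 < fst B1" "snd B1 \<noteq> []" "0 < fst B2" "snd B2 \<noteq> []"
      and ek: "psum p (\<lambda>n. ?ek n - lin_comb std_gen (map point (snd B1)) n) < max 0 (of_rat (fst B1)) powr p"
      and code: "\<phi> (enc B1) = Some (enc B2)" and B2: "fst B2 < 1"
      and less: "cmod (point (?a B2)) powr p - (\<Sum>i<s. cmod (point (pmult (?a B2) (u i, 0))) powr p) -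
        cmod (point (pmult (?a B2) (v e, 0))) powr p < max 0 (of_rat (1 - fst B2)) powr p"
      unfolding Q_def by blast
    define a where "a = cmod (map point (snd B2) ! 0)"
    define r :: real where "r = of_rat (fst B2)"
    have r: "0 < r" "r < 1" using B B2 by (auto simp: r_def)
    have "B1 \<in> rat_balls" "B2 \<in> rat_balls" using B by (simp_all add: rat_balls_def case_prod_unfold)
    hence "T ?ek \<in> ball_set p gen B2"
      using correct[of B1 B2] code ek ball_iff[OF B(1)] by (simp add: enc_eq_ball_code)
    hence lt: "1 - r < a * c0" using near[of B2] B by (simp add: a_def r_def abs_less_iff)
    hence "0 < a * c0" using r by linarith
    hence apos: "0 < a" using c0_pos by (simp add: zero_less_mult_iff)
    have "a powr p * (1 - (\<Sum>i<s. w i) - of_rat (v e) powr p) < (1 - r) powr p"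
      using less[unfolded a_eq[OF B(4)]] r by (simp add: a_def r_def of_rat_diff)
    also have "\<dots> < (a * c0) powr p" using lt r p0 by (intro powr_less_mono2) auto
    also have "\<dots> = a powr p * (1 - \<gamma>)" unfolding a_def by (rule c0a)
    finally show ?thesis using apos by simp
  qed
  have complete: "\<exists>s. Q e s" for e
  proof -
    define x :: real where "x = of_rat (v e) powr p"
    have x: "x > 0" using v(2)[of e] by (simp add: x_def)
    have "(\<lambda>n. \<Sum>i<n. w i) \<longlonglongrightarrow> \<gamma>" using w_sums by (simp add: sums_def)
    hence "eventually (\<lambda>n. \<gamma> - x < (\<Sum>i<n. w i)) sequentially"
      using x by (intro order_tendstoD) auto
    then obtain s where s: "\<gamma> - x < (\<Sum>i<s. w i)" by (auto simp: eventually_sequentially)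
    \<comment> \<open>Completeness has to bound \<open>a powr p * \<theta>\<close> by
      \<open>(1 - r) powr p\<close>, knowing only that \<open>a * c0 < 1 + r\<close>. Because
      \<theta> < 1 - \<gamma>, the bound holds in the limit at r = 0 and hence for all small
      r.\<close>
    define \<theta> where "\<theta> = 1 - (\<Sum>i<s. w i) - x"
    have \<theta>: "\<theta> < 1 - \<gamma>" using s by (simp add: \<theta>_def)
    have g: "0 < 1 - \<gamma>" using \<gamma>_le by simp
    have "((\<lambda>r. (1 - r) powr p * (1 - \<gamma>) - (1 + r) powr p * \<theta>) \<longlongrightarrow>
        (1 - 0) powr p * (1 - \<gamma>) - (1 + 0) powr p * \<theta>) (at_right 0)"
      by (intro tendsto_intros) auto
    hence "eventually (\<lambda>r. 0 < (1 - r) powr p * (1 - \<gamma>) - (1 + r) powr p * \<theta>) (at_right 0)"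
      using \<theta> by (intro order_tendstoD) auto
    then obtain d where d: "d > 0" "\<And>r. 0 < r \<Longrightarrow> r < d \<Longrightarrow> (1 + r) powr p * \<theta> < (1 - r) powr p * (1 - \<gamma>)"
      unfolding eventually_at_right_field by auto
    \<comment> \<open>The division by 4 offsets \<open>ball_radius_less\<close>; the minimum with 1
      keeps 1 - r positive.\<close>
    define \<epsilon> where "\<epsilon> = min d 1 / 4"
    have \<epsilon>: "\<epsilon> > 0" using d by (simp add: \<epsilon>_def)
    have Tlp: "T ?ek \<in> lp p" unfolding Tk by (intro cmult_in_lp std_gen_in_lp)
    have "lp_neighborhood p (T ?ek) (lp_ball p (T ?ek) \<epsilon>)"
      using \<epsilon> by (auto simp: lp_neighborhood_def lp_ball_def)
    from conv[OF std_gen_in_lp this] obtain B1 B2 where B: "B1 \<in> rat_balls" "B2 \<in> rat_balls"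
      "?ek \<in> ball_set p std_gen B1" "\<phi> (ball_code B1) = Some (ball_code B2)"
      "ball_set p gen B2 \<subseteq> lp_ball p (T ?ek) \<epsilon>" by blast
    have B': "0 < fst B1" "snd B1 \<noteq> []" "0 < fst B2" "snd B2 \<noteq> []"
      using B by (auto simp: rat_balls_def)
    define a where "a = cmod (map point (snd B2) ! 0)"
    define r :: real where "r = of_rat (fst B2)"
    have "r < 4 * \<epsilon>" unfolding r_def by (rule ball_radius_less[OF gen_in_lp B'(3) Tlp B(5)])
    hence r: "0 < r" "r < d" "r < 1" using B' by (auto simp: r_def \<epsilon>_def)
    have "T ?ek \<in> ball_set p gen B2" using correct[OF B(1,2,4)] B(3) by blast
    hence lt: "a * c0 < 1 + r" using near[of B2] B' by (simp add: a_def r_def abs_less_iff)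
    have "a powr p * \<theta> < (1 - r) powr p"
    proof (cases "\<theta> \<le> 0")
      case True
      hence "a powr p * \<theta> \<le> 0" by (intro mult_nonneg_nonpos) auto
      also have "0 < (1 - r) powr p" using r by simp
      finally show ?thesis .
    next
      case False
      have "(a * c0) powr p \<le> (1 + r) powr p"
        using lt p0 c0_pos by (intro powr_mono2) (auto simp: a_def)
      hence "a powr p * (1 - \<gamma>) \<le> (1 + r) powr p" unfolding a_def c0a .
      hence "a powr p * (1 - \<gamma>) * \<theta> \<le> (1 + r) powr p * \<theta>" using False by (intro mult_right_mono) auto
      also have "\<dots> < (1 - r) powr p * (1 - \<gamma>)" using d(2) r by simp
      finally have "(a powr p * \<theta>) * (1 - \<gamma>) < (1 - r) powr p * (1 - \<gamma>)" by (simp add: mult_ac)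
      thus ?thesis using g by (simp only: mult_less_cancel_right_pos)
    qed
    hence "cmod (point (?a B2)) powr p - (\<Sum>i<s. cmod (point (pmult (?a B2) (u i, 0))) powr p) -
        cmod (point (pmult (?a B2) (v e, 0))) powr p < max 0 (of_rat (1 - fst B2)) powr p"
      unfolding a_eq[OF B'(4)] using r by (simp add: a_def r_def \<theta>_def x_def of_rat_diff)
    moreover have "fst B2 < 1" using r by (simp add: r_def)
    moreover have "\<phi> (enc B1) = Some (enc B2)" using B(4) by (simp only: enc_eq_ball_code)
    moreover note B(3)[unfolded ball_iff[OF B'(1)]]
    ultimately have "Q e s" unfolding Q_def using B' by blast
    thus ?thesis ..
  qed
  have "semidec (\<lambda>z. Q (fst z) (snd z))"
    unfolding Q_def
    by (intro semi_intros semidec_partrec[OF \<phi>] creal_intros comp_intros crp p0 creal_powr_max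
        computable_comp[OF comp_u] computable_comp[OF v(1)] creal_comp[OF creal_psum_std_gen_diff])
  then obtain s where s: "computable s" "\<And>e. Q e (s e)"
    using complete by (rule semidec_choice) blast
  show thesis by (rule that[OF s(1) sound[OF s(2)]])
qed

end

section \<open>Weights from the halting problem\<close>

lemma not_computably_categorical:
  assumes p: "computable_real p" "p \<ge> 1" "p \<noteq> 2" shows "\<not> computably_categorical p"
proof
  assume cc: "computably_categorical p"
  have "semidec (\<lambda>e. eval e e 0)" by (intro semi_intros comp_intros)
  then obtain R where R: "computable R" "\<And>e. eval e e 0 \<longleftrightarrow> (\<exists>s. R (e, s :: nat))"
    unfolding semidec_def by blast
  define unpair where "unpair = (\<lambda>n. dec n :: nat \<times> nat)"
  \<comment> \<open>n codes e with the least witness that e is in the halting set, so every e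
    accounts for at most one nonzero weight.\<close>
  define first where "first = (\<lambda>n. R (unpair n) \<and> (\<forall>t<snd (unpair n). \<not> R (fst (unpair n), t)))"
  \<comment> \<open>The exponent e + 2 makes the total of all \<open>v e\<close> equal to 1 / 2, as
    the locale \<open>weights\<close> requires of partial sums.\<close>
  define v :: "nat \<Rightarrow> rat" where "v = (\<lambda>e. 1 / 2 ^ (e + 2))"
  define u :: "nat \<Rightarrow> rat" where "u = (\<lambda>n. if first n then v (fst (unpair n)) else 0)"
  have v: "computable v" "\<And>e. 0 < v e" unfolding v_def by (intro comp_intros) simp
  have comp_unpair: "computable unpair" unfolding unpair_def by (intro comp_intros)
  have comp_first: "computable first"
    unfolding first_def by (intro comp_intros computable_comp[OF R(1)] computable_comp[OF comp_unpair])
  have unpair_enc: "unpair (enc x) = x" for x by (simp add: unpair_def)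
  have unpair_inj: "n = m" if "unpair n = unpair m" for n m
  proof -
    have *: "enc (dec n :: nat \<times> nat) = n" for n
      by (simp add: enc_prod_def dec_prod_def enc_nat_def dec_nat_def)
    show ?thesis using arg_cong[OF that, of enc] unfolding unpair_def * .
  qed
  have first_unique: "n = m" if "first n" "first m" "fst (unpair n) = fst (unpair m)" for n m
  proof -
    have R: "R (fst (unpair n), snd (unpair n))" "R (fst (unpair m), snd (unpair m))"
      using that(1,2) unfolding first_def by simp_all
    have "\<forall>t<snd (unpair n). \<not> R (fst (unpair m), t)" "\<forall>t<snd (unpair m). \<not> R (fst (unpair m), t)"
      using that(1,2) unfolding first_def that(3) by blast+
    hence "\<not> snd (unpair m) < snd (unpair n)" "\<not> snd (unpair n) < snd (unpair m)"
      using R unfolding that(3) by blast+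
    hence "snd (unpair n) = snd (unpair m)" by simp
    thus ?thesis using that(3) unpair_inj[of n m] by (simp add: prod_eq_iff)
  qed
  have halts_iff: "eval e e 0 \<longleftrightarrow> (\<exists>n. first n \<and> fst (unpair n) = e)" for e
  proof
    assume "eval e e 0"
    then obtain s where "R (e, s)" using R(2) by blast
    hence "R (e, LEAST s. R (e, s))" by (rule LeastI)
    hence "first (enc (e, LEAST s. R (e, s)))"
      unfolding first_def unpair_enc by (auto dest: not_less_Least)
    thus "\<exists>n. first n \<and> fst (unpair n) = e"
      by (intro exI[of _ "enc (e, LEAST s. R (e, s))"]) (simp add: unpair_enc)
  next
    assume "\<exists>n. first n \<and> fst (unpair n) = e"
    then obtain n where n: "first n" "fst (unpair n) = e" by blast
    hence "R (unpair n)" by (simp add: first_def)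
    hence "R (e, snd (unpair n))" using n(2) by (metis prod.collapse)
    thus "eval e e 0" using R(2) by blast
  qed
  have sum_v: "(\<Sum>e\<in>A. v e) \<le> 1 / 2" if fin: "finite A" for A
  proof -
    obtain m where m: "A \<subseteq> {..<m}" using fin unfolding finite_nat_iff_bounded by blast
    have "(\<Sum>e<m. v e) = 1 / 2 - 1 / 2 ^ (m + 1)" by (induction m) (simp_all add: v_def field_simps)
    moreover have "(\<Sum>e\<in>A. v e) \<le> (\<Sum>e<m. v e)"
      using m v(2) by (intro sum_mono2) (auto intro: less_imp_le)
    moreover have "(0::rat) \<le> 1 / 2 ^ (m + 1)" by simp
    ultimately show ?thesis by linarith
  qed
  interpret weights p u
  proof
    show "p \<ge> 1" by fact
    show "creal (\<lambda>_::nat. p)" by (rule creal_computable_real) fact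
    show "computable u"
      unfolding u_def by (intro comp_intros comp_first computable_comp[OF v(1)] computable_comp[OF comp_unpair])
    show "0 \<le> u i" for i using v(2) by (simp add: u_def less_imp_le)
    show "u i \<le> 1" for i
      using sum_v[of "{fst (unpair i)}"] by (simp add: u_def)
    show "(\<Sum>i<n. u i) \<le> 1 / 2" for n
    proof -
      let ?S = "{i. i < n \<and> first i}"
      have "(\<Sum>i<n. u i) = (\<Sum>i\<in>?S. v (fst (unpair i)))"
        unfolding u_def by (subst sum.inter_filter[symmetric]) (auto intro: sum.cong)
      also have "\<dots> = (\<Sum>e\<in>(\<lambda>i. fst (unpair i)) ` ?S. v e)"
        by (subst sum.reindex) (auto simp: inj_on_def intro: first_unique)
      also have "\<dots> \<le> 1 / 2" by (rule sum_v) simp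
      finally show ?thesis .
    qed
  qed
  obtain T where T: "surj_linear_isometry p T" "computable_map p std_gen gen T"
    using cc effective_gen unfolding computably_categorical_def by blast
  obtain k c where "cmod c = 1" "T (std_gen k) = (\<lambda>n. c * std_gen 0 n)"
    using isometry_std_gen[OF T(1) p(2,3)] by blast
  from computable_modulus[OF T(2) this v] obtain s where
    s: "computable s" "\<And>e::nat. \<gamma> < (\<Sum>i<s e. w i) + of_rat (v e) powr p" by blast
  have "eval e e 0 \<longleftrightarrow> (\<exists>n<s e. first n \<and> fst (unpair n) = e)" for e
  proof
    assume "eval e e 0"
    then obtain n where n: "first n" "fst (unpair n) = e" using halts_iff by blast
    \<comment> \<open>An index for e beyond \<open>s e\<close> would leave at least
      \<open>v e powr p\<close> of \<gamma> outside the partial sum, against the choice of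
      s.\<close>
    have "n < s e"
    proof (rule ccontr)
      assume "\<not> n < s e"
      hence "(\<Sum>i<s e. w i) + w n = (\<Sum>i\<in>insert n {..<s e}. w i)" by simp
      also have "\<dots> \<le> \<gamma>"
        unfolding \<gamma>_def by (intro sum_le_suminf summable_w) (auto simp: w_nonneg)
      finally have "(\<Sum>i<s e. w i) + w n \<le> \<gamma>" .
      moreover have "w n = of_rat (v e) powr p"
        unfolding w_def by (simp only: u_def n if_True)
      ultimately show False using s(2)[of e] by linarith
    qed
    thus "\<exists>n<s e. first n \<and> fst (unpair n) = e" using n by blast
  qed (use halts_iff in blast)
  moreover have "computable (\<lambda>e. \<exists>n<s e. first n \<and> fst (unpair n) = e)"
    by (intro comp_intros s computable_comp[OF comp_first] computable_comp[OF comp_unpair])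
  ultimately show False using undecidable_halting by simp
qed

section \<open>Square-summable sequences as a Hilbert space\<close>

lemma lp_2_iff: "f \<in> lp 2 \<longleftrightarrow> summable (\<lambda>n. (cmod (f n))\<^sup>2)"
  by (simp add: lp_iff)

lemma summable_mult_cnj:
  assumes "f \<in> lp 2" "g \<in> lp 2" shows "summable (\<lambda>n. f n * cnj (g n))"
proof (rule summable_norm_cancel, rule summable_comparison_test')
  show "summable (\<lambda>n. (cmod (f n))\<^sup>2 + (cmod (g n))\<^sup>2)"
    using assms by (intro summable_add) (simp_all add: lp_2_iff)
  show "norm (norm (f n * cnj (g n))) \<le> (cmod (f n))\<^sup>2 + (cmod (g n))\<^sup>2" if "0 \<le> n" for n
  proof -
    have "2 * (cmod (f n) * cmod (g n)) \<le> (cmod (f n))\<^sup>2 + (cmod (g n))\<^sup>2"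
      using sum_squares_bound[of "cmod (f n)" "cmod (g n)"] by (simp only: mult.assoc)
    moreover have "0 \<le> cmod (f n) * cmod (g n)" by simp
    moreover have "norm (norm (f n * cnj (g n))) = cmod (f n) * cmod (g n)" by (simp add: norm_mult)
    ultimately show ?thesis by linarith
  qed
qed

text \<open>A type of its own opens the class hierarchy of inner product and Banach spaces. Those
  classes are real, so \<open>cinner\<close> and \<open>*C\<close> carry the complex structure
  beside them.\<close>

typedef l2 = "lp 2"
  using zero_in_lp by blast

setup_lifting type_definition_l2

lift_definition cinner :: "l2 \<Rightarrow> l2 \<Rightarrow> complex" is "\<lambda>f g. \<Sum>n. f n * cnj (g n)" .
lift_definition cscale :: "complex \<Rightarrow> l2 \<Rightarrow> l2" (infixr "*C" 75) is "\<lambda>c f n. c * f n"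
  by (rule cmult_in_lp)

instantiation l2 :: real_inner
begin
lift_definition zero_l2 :: l2 is "\<lambda>_. 0" by (rule zero_in_lp)
lift_definition plus_l2 :: "l2 \<Rightarrow> l2 \<Rightarrow> l2" is "\<lambda>f g n. f n + g n" by (rule add_in_lp) simp
lift_definition minus_l2 :: "l2 \<Rightarrow> l2 \<Rightarrow> l2" is "\<lambda>f g n. f n - g n" by (rule diff_in_lp) simp
lift_definition uminus_l2 :: "l2 \<Rightarrow> l2" is "\<lambda>f n. - f n" by (rule uminus_in_lp)
definition "scaleR r x = of_real r *C x" for x :: l2
definition "inner x y = Re (cinner x y)" for x y :: l2
definition "norm x = sqrt (inner x x)" for x :: l2
definition "dist x y = norm (x - y)" for x y :: l2
definition "sgn x = scaleR (inverse (norm x)) x" for x :: l2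
definition [code del]: "(uniformity :: (l2 \<times> l2) filter) = (INF e\<in>{0<..}. principal {(x, y). dist x y < e})"
definition [code del]: "open (U :: l2 set) \<longleftrightarrow> (\<forall>x\<in>U. eventually (\<lambda>(x', y). x' = x \<longrightarrow> y \<in> U) uniformity)"

instance
proof
  fix x y z :: l2 and r s :: real
  show "x + y + z = x + (y + z)" "x + y = y + x" "0 + x = x" "- x + x = 0" "x - y = x + - y"
    by (transfer; simp add: add_ac)+
  show "r *\<^sub>R (x + y) = r *\<^sub>R x + r *\<^sub>R y" "(r + s) *\<^sub>R x = r *\<^sub>R x + s *\<^sub>R x"
    "r *\<^sub>R s *\<^sub>R x = (r * s) *\<^sub>R x" "1 *\<^sub>R x = x"
    unfolding scaleR_l2_def by (transfer; simp add: algebra_simps)+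
  have "cnj (cinner x y) = cinner y x"
    by transfer (simp add: bounded_linear.suminf[OF bounded_linear_cnj summable_mult_cnj] mult.commute)
  thus "inner x y = inner y x" unfolding inner_l2_def by (metis complex_cnj(1) complex_surj complex.sel(1))
  have "cinner (x + y) z = cinner x z + cinner y z"
    by transfer (simp add: suminf_add summable_mult_cnj distrib_right)
  thus "inner (x + y) z = inner x z + inner y z" by (simp add: inner_l2_def)
  have "cinner (of_real r *C x) y = of_real r * cinner x y"
    by transfer (simp add: suminf_mult[symmetric] summable_mult_cnj mult.assoc)
  thus "inner (r *\<^sub>R x) y = r * inner x y" by (simp add: inner_l2_def scaleR_l2_def)
  have eq: "cinner x x = of_real (\<Sum>n. (cmod (Rep_l2 x n))\<^sup>2)"
    using Rep_l2[of x] unfolding cinner.rep_eq complex_norm_square[symmetric]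
    by (simp add: lp_2_iff suminf_of_real)
  show "0 \<le> inner x x" unfolding inner_l2_def eq using Rep_l2[of x]
    by (simp add: lp_2_iff suminf_nonneg)
  have "inner x x = 0 \<longleftrightarrow> (\<forall>n. Rep_l2 x n = 0)"
    unfolding inner_l2_def eq using Rep_l2[of x] by (simp add: lp_2_iff suminf_eq_zero_iff)
  also have "\<dots> \<longleftrightarrow> x = 0" by transfer (simp add: fun_eq_iff)
  finally show "inner x x = 0 \<longleftrightarrow> x = 0" .
qed (simp_all add: dist_l2_def sgn_l2_def uniformity_l2_def open_l2_def norm_l2_def)

end

section \<open>Calculus of the complex inner product\<close>

lemma cinner_add_left: "cinner (x + y) z = cinner x z + cinner y z"
  by transfer (simp add: suminf_add summable_mult_cnj distrib_right)

lemma cinner_cscale_left [simp]: "cinner (c *C x) y = c * cinner x y"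
  by transfer (simp add: suminf_mult[symmetric] summable_mult_cnj mult.assoc)

lemma cinner_commute: "cinner y x = cnj (cinner x y)"
  by transfer (simp add: bounded_linear.suminf[OF bounded_linear_cnj summable_mult_cnj] mult.commute)

lemma cinner_zero_left [simp]: "cinner 0 y = 0"
  using cinner_add_left[of 0 0 y] by simp

lemma cinner_zero_right [simp]: "cinner y 0 = 0"
  using cinner_commute[of y 0] by simp

lemma cinner_diff_left: "cinner (x - y) z = cinner x z - cinner y z"
  using cinner_add_left[of "x - y" y z] by simp

lemma cinner_add_right: "cinner x (y + z) = cinner x y + cinner x z"
  using cinner_add_left[of y z x] by (simp add: cinner_commute[of x])

lemma cinner_diff_right: "cinner x (y - z) = cinner x y - cinner x z"
  using cinner_diff_left[of y z x] by (simp add: cinner_commute[of x])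

lemma cinner_cscale_right [simp]: "cinner x (c *C y) = cnj c * cinner x y"
  by (simp add: cinner_commute[of x])

lemma cinner_sum_left: "cinner (\<Sum>i\<in>A. f i) y = (\<Sum>i\<in>A. cinner (f i) y)"
  by (induction A rule: infinite_finite_induct) (simp_all add: cinner_add_left)

lemma cinner_sum_right: "cinner y (\<Sum>i\<in>A. f i) = (\<Sum>i\<in>A. cinner y (f i))"
  by (induction A rule: infinite_finite_induct) (simp_all add: cinner_add_right)

lemma Re_cinner: "Re (cinner x y) = inner x y"
  by (simp add: inner_l2_def)

lemma cinner_same: "cinner x x = of_real ((norm x)\<^sup>2)"
proof -
  have "Im (cinner x x) = 0" using cinner_commute[of x x] by (simp add: complex_eq_iff)
  thus ?thesis by (simp add: complex_eq_iff Re_cinner power2_norm_eq_inner)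
qed

lemma cscale_simps [simp]: "c *C (0::l2) = 0" "0 *C x = 0" "1 *C x = x" "c *C (d *C x) = (c * d) *C x"
  by (transfer; simp add: mult.assoc)+

lemma cscale_add_right: "c *C (x + y) = c *C x + c *C y"
  and cscale_add_left: "(c + d) *C x = c *C x + d *C x"
  and cscale_diff_right: "c *C (x - y) = c *C x - c *C y"
  and cscale_diff_left: "(c - d) *C x = c *C x - d *C x"
  by (transfer; simp add: algebra_simps)+

lemma cscale_sum_right: "c *C (\<Sum>i\<in>A. f i) = (\<Sum>i\<in>A. c *C f i)"
  by (induction A rule: infinite_finite_induct) (simp_all add: cscale_add_right)

lemma norm_cscale: "norm (c *C x) = cmod c * norm x"
proof -
  have "complex_of_real ((norm (c *C x))\<^sup>2) = (c * cnj c) * cinner x x"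
    unfolding cinner_same[symmetric] by simp
  also have "\<dots> = of_real ((cmod c * norm x)\<^sup>2)"
    unfolding cinner_same complex_norm_square[symmetric] by (simp add: power_mult_distrib)
  finally have "(norm (c *C x))\<^sup>2 = (cmod c * norm x)\<^sup>2" by (simp only: of_real_eq_iff)
  thus ?thesis by (simp add: power2_eq_iff_nonneg)
qed

text \<open>Multiplying x by a unimodular scalar makes the inner product real and nonnegative; the
  real Cauchy-Schwarz inequality then applies.\<close>

lemma norm_cinner_le: "cmod (cinner x y) \<le> norm x * norm y"
proof (cases "cinner x y = 0")
  case False
  define c where "c = cnj (cinner x y) / of_real (cmod (cinner x y))"
  have "cmod c = 1" using False by (simp add: c_def norm_divide)
  have "cinner (c *C x) y = of_real (cmod (cinner x y))"
    using False by (simp add: c_def complex_norm_square[symmetric] power2_eq_square mult.commute)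
  hence "cmod (cinner x y) = inner (c *C x) y" by (simp flip: Re_cinner)
  also have "\<dots> \<le> norm (c *C x) * norm y" by (rule norm_cauchy_schwarz)
  finally show ?thesis using \<open>cmod c = 1\<close> by (simp add: norm_cscale)
qed simp

lemma bounded_linear_cscale: "bounded_linear (\<lambda>x. c *C x)"
  by (rule bounded_linear_intro[where K = "cmod c"])
     (auto simp: cscale_add_right scaleR_l2_def norm_cscale mult.commute)

lemma tendsto_cscale [tendsto_intros]:
  assumes c: "(c \<longlongrightarrow> c0) F" and x: "(x \<longlongrightarrow> x0) F" shows "((\<lambda>n. c n *C x n) \<longlongrightarrow> c0 *C x0) F"
proof -
  have "((\<lambda>n. cmod (c n - c0) * norm (x n) + cmod c0 * norm (x n - x0)) \<longlongrightarrow>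
      cmod (c0 - c0) * norm x0 + cmod c0 * norm (x0 - x0)) F"
    by (intro tendsto_intros c x)
  hence lim: "((\<lambda>n. cmod (c n - c0) * norm (x n) + cmod c0 * norm (x n - x0)) \<longlongrightarrow> 0) F" by simp
  have "norm (c n *C x n - c0 *C x0) \<le> cmod (c n - c0) * norm (x n) + cmod c0 * norm (x n - x0)" for n
  proof -
    have "c n *C x n - c0 *C x0 = (c n - c0) *C x n + c0 *C (x n - x0)"
      by (simp add: cscale_diff_left cscale_diff_right)
    thus ?thesis by (metis norm_triangle_ineq norm_cscale)
  qed
  hence "\<forall>n. norm (c n *C x n - c0 *C x0) \<le> cmod (c n - c0) * norm (x n) + cmod c0 * norm (x n - x0)"
    by blast
  from Lim_null_comparison[OF always_eventually[OF this] lim]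
  have "((\<lambda>n. c n *C x n - c0 *C x0) \<longlongrightarrow> 0) F" .
  thus ?thesis by (simp add: LIM_zero_iff)
qed

lemma tendsto_cinner [tendsto_intros]:
  assumes x: "(x \<longlongrightarrow> x0) F" shows "((\<lambda>n. cinner (x n) y) \<longlongrightarrow> cinner x0 y) F"
proof -
  have "((\<lambda>n. norm (x n - x0) * norm y) \<longlongrightarrow> norm (x0 - x0) * norm y) F"
    by (intro tendsto_intros x)
  hence lim: "((\<lambda>n. norm (x n - x0) * norm y) \<longlongrightarrow> 0) F" by simp
  have "norm (cinner (x n) y - cinner x0 y) \<le> norm (x n - x0) * norm y" for n
    using norm_cinner_le[of "x n - x0" y] by (simp add: cinner_diff_left)
  hence "\<forall>n. norm (cinner (x n) y - cinner x0 y) \<le> norm (x n - x0) * norm y" by blast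
  from Lim_null_comparison[OF always_eventually[OF this] lim]
  have "((\<lambda>n. cinner (x n) y - cinner x0 y) \<longlongrightarrow> 0) F" .
  thus ?thesis by (simp add: LIM_zero_iff)
qed

section \<open>Coordinates and completeness\<close>

lemma norm_l2: "norm x = lp_norm 2 (Rep_l2 x)"
proof -
  have "(norm x)\<^sup>2 = (\<Sum>n. (cmod (Rep_l2 x n))\<^sup>2)"
  proof -
    have "complex_of_real ((norm x)\<^sup>2) = of_real (\<Sum>n. (cmod (Rep_l2 x n))\<^sup>2)"
      unfolding cinner_same[symmetric] cinner.rep_eq complex_norm_square[symmetric]
      using Rep_l2[of x] by (simp add: lp_2_iff suminf_of_real)
    thus ?thesis by (simp only: of_real_eq_iff)
  qed
  also have "\<dots> = psum 2 (Rep_l2 x)" by (simp add: psum_def)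
  also have "\<dots> = (lp_norm 2 (Rep_l2 x))\<^sup>2"
    using lp_norm_powr[OF Rep_l2[of x]] by simp
  finally show ?thesis by (simp add: power2_eq_iff_nonneg)
qed

lemma norm_Rep_le: "cmod (Rep_l2 x n) \<le> norm x"
  unfolding norm_l2 by (rule cmod_le_lp_norm[OF Rep_l2]) simp

lemma sum_Rep_le: "(\<Sum>n<N. (cmod (Rep_l2 x n))\<^sup>2) \<le> (norm x)\<^sup>2"
proof -
  have "(\<Sum>n<N. (cmod (Rep_l2 x n))\<^sup>2) \<le> (\<Sum>n. (cmod (Rep_l2 x n))\<^sup>2)"
    using Rep_l2[of x] by (intro sum_le_suminf) (auto simp: lp_2_iff)
  also have "\<dots> = psum 2 (Rep_l2 x)" by (simp add: psum_def)
  also have "\<dots> = (norm x)\<^sup>2" using lp_norm_powr[OF Rep_l2[of x]] by (simp add: norm_l2)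
  finally show ?thesis .
qed

text \<open>Both the completeness proof and Bessel's inequality deliver bounds on partial sums only,
  from which membership and the norm bound are read off here.\<close>

lemma l2_of_bounded:
  assumes "\<And>N. (\<Sum>n<N. (cmod (f n))\<^sup>2) \<le> e\<^sup>2" "e \<ge> 0"
  shows "f \<in> lp 2" "norm (Abs_l2 f) \<le> e"
proof -
  have sm: "summable (\<lambda>n. (cmod (f n))\<^sup>2)"
    by (rule summableI_nonneg_bounded[OF _ assms(1)]) simp
  thus f: "f \<in> lp 2" by (simp add: lp_2_iff)
  have "psum 2 f \<le> e\<^sup>2" unfolding psum_def using suminf_le_const[OF sm assms(1)] by simp
  thus "norm (Abs_l2 f) \<le> e"
    using lp_norm_le_iff[OF f _ assms(2)] f assms(2) by (simp add: norm_l2 Abs_l2_inverse)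
qed

instance l2 :: complete_space
proof
  fix X :: "nat \<Rightarrow> l2" assume X: "Cauchy X"
  have Ck: "Cauchy (\<lambda>m. Rep_l2 (X m) k)" for k
  proof (rule CauchyI)
    fix e :: real assume "0 < e"
    then obtain M where M: "\<And>m n. m \<ge> M \<Longrightarrow> n \<ge> M \<Longrightarrow> norm (X m - X n) < e"
      using CauchyD[OF X] by blast
    have "norm (Rep_l2 (X m) k - Rep_l2 (X n) k) < e" if "m \<ge> M" "n \<ge> M" for m n
      using norm_Rep_le[of "X m - X n" k] M[OF that] by (simp add: minus_l2.rep_eq)
    thus "\<exists>M. \<forall>m\<ge>M. \<forall>n\<ge>M. norm (Rep_l2 (X m) k - Rep_l2 (X n) k) < e" by blast
  qed
  have "\<exists>l. (\<lambda>m. Rep_l2 (X m) k) \<longlonglongrightarrow> l" for k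
    using Cauchy_convergent[OF Ck[of k]] by (simp add: convergent_def)
  then obtain L where L: "\<And>k. (\<lambda>m. Rep_l2 (X m) k) \<longlonglongrightarrow> L k" by metis
  \<comment> \<open>A finite sum passes to the coordinatewise limit in n, with an M that serves
    every N at once.\<close>
  have tail: "\<exists>M. \<forall>m\<ge>M. \<forall>N. (\<Sum>k<N. (cmod (Rep_l2 (X m) k - L k))\<^sup>2) \<le> e\<^sup>2" if "e > 0" for e
  proof -
    obtain M where M: "\<And>m n. m \<ge> M \<Longrightarrow> n \<ge> M \<Longrightarrow> norm (X m - X n) < e"
      using CauchyD[OF X] \<open>e > 0\<close> by blast
    have "(\<Sum>k<N. (cmod (Rep_l2 (X m) k - L k))\<^sup>2) \<le> e\<^sup>2" if "m \<ge> M" for m N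
    proof (rule LIMSEQ_le_const2)
      show "(\<lambda>n. \<Sum>k<N. (cmod (Rep_l2 (X m) k - Rep_l2 (X n) k))\<^sup>2) \<longlonglongrightarrow> (\<Sum>k<N. (cmod (Rep_l2 (X m) k - L k))\<^sup>2)"
        by (intro tendsto_intros L)
      have "(\<Sum>k<N. (cmod (Rep_l2 (X m) k - Rep_l2 (X n) k))\<^sup>2) \<le> e\<^sup>2" if "n \<ge> M" for n
      proof -
        have "(\<Sum>k<N. (cmod (Rep_l2 (X m) k - Rep_l2 (X n) k))\<^sup>2) \<le> (norm (X m - X n))\<^sup>2"
          using sum_Rep_le[of "X m - X n" N] by (simp add: minus_l2.rep_eq)
        also have "\<dots> \<le> e\<^sup>2" using M[OF \<open>m \<ge> M\<close> that] by (intro power_mono) auto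
        finally show ?thesis .
      qed
      thus "\<exists>n0. \<forall>n\<ge>n0. (\<Sum>k<N. (cmod (Rep_l2 (X m) k - Rep_l2 (X n) k))\<^sup>2) \<le> e\<^sup>2" by blast
    qed
    thus ?thesis by blast
  qed
  obtain M where M: "\<And>N. (\<Sum>k<N. (cmod (Rep_l2 (X M) k - L k))\<^sup>2) \<le> 1\<^sup>2"
    using tail[of 1] by auto
  have "(\<lambda>k. Rep_l2 (X M) k - (Rep_l2 (X M) k - L k)) \<in> lp 2"
    by (rule diff_in_lp[OF _ Rep_l2 l2_of_bounded(1)[OF M]]) auto
  hence Lp: "L \<in> lp 2" by simp
  have "X \<longlonglongrightarrow> Abs_l2 L"
  proof (rule LIMSEQ_I)
    fix r :: real assume "0 < r"
    then obtain M where M: "\<And>m N. m \<ge> M \<Longrightarrow> (\<Sum>k<N. (cmod (Rep_l2 (X m) k - L k))\<^sup>2) \<le> (r / 2)\<^sup>2"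
      using tail[of "r / 2"] by auto
    have "norm (X m - Abs_l2 L) < r" if "m \<ge> M" for m
    proof -
      have "X m - Abs_l2 L = Abs_l2 (\<lambda>k. Rep_l2 (X m) k - L k)"
        unfolding minus_l2_def using Lp by (simp add: Abs_l2_inverse)
      moreover have "norm (Abs_l2 (\<lambda>k. Rep_l2 (X m) k - L k)) \<le> r / 2"
        using M[OF that] \<open>0 < r\<close> by (intro l2_of_bounded(2)) auto
      ultimately show ?thesis using \<open>0 < r\<close> by simp
    qed
    thus "\<exists>M. \<forall>m\<ge>M. norm (X m - Abs_l2 L) < r" by blast
  qed
  thus "convergent X" by (auto simp: convergent_def)
qed

instance l2 :: banach ..

subsection \<open>Orthogonal projections and orthonormal sequences\<close>

text \<open>The vectors may be linearly dependent. If \<open>u n\<close> lies in the span of its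
  predecessors, its own residual s is 0 and the division by zero gives t = 0, which is the right
  coefficient.\<close>

lemma orthogonal_residual:
  fixes u :: "nat \<Rightarrow> l2"
  shows "\<exists>b. \<forall>i<n. cinner (f - (\<Sum>j<n. b j *C u j)) (u i) = 0"
proof (induction n arbitrary: f)
  case (Suc n)
  from Suc[of f] obtain b where b: "\<And>i. i < n \<Longrightarrow> cinner (f - (\<Sum>j<n. b j *C u j)) (u i) = 0" by blast
  from Suc[of "u n"] obtain c where c: "\<And>i. i < n \<Longrightarrow> cinner (u n - (\<Sum>j<n. c j *C u j)) (u i) = 0" by blast
  define s where "s = u n - (\<Sum>j<n. c j *C u j)"
  define r where "r = f - (\<Sum>j<n. b j *C u j)"
  define t where "t = cinner r s / of_real ((norm s)\<^sup>2)"
  define d where "d = (\<lambda>j. if j = n then t else b j - t * c j)"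
  have "f - (\<Sum>j<Suc n. d j *C u j) = r - t *C s"
    by (simp add: d_def r_def s_def cscale_diff_left cscale_diff_right sum_subtractf cscale_sum_right)
  moreover have 1: "cinner (r - t *C s) (u i) = 0" if "i < n" for i
    using b[OF that] c[OF that] by (simp add: cinner_diff_left r_def s_def)
  moreover have "cinner (r - t *C s) (u n) = 0"
  proof -
    have un: "u n = s + (\<Sum>j<n. c j *C u j)" by (simp add: s_def)
    have "cinner (r - t *C s) s = 0"
      by (cases "s = 0") (simp_all add: cinner_diff_left t_def cinner_same)
    thus ?thesis by (subst un) (simp add: cinner_add_right cinner_sum_right 1)
  qed
  ultimately show ?case by (intro exI[of _ d]) (simp add: less_Suc_eq)
qed simp

lift_definition basis_vec :: "nat \<Rightarrow> l2" is std_gen by (rule std_gen_in_lp)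

lemma cinner_basis_vec: "cinner x (basis_vec k) = Rep_l2 x k"
proof -
  have "(\<lambda>n. Rep_l2 x n * cnj (std_gen k n)) sums (\<Sum>n\<in>{k}. Rep_l2 x n * cnj (std_gen k n))"
    by (rule sums_finite) (auto simp: std_gen_def)
  thus ?thesis by (simp add: cinner.rep_eq basis_vec.rep_eq sums_iff std_gen_def)
qed

text \<open>Infinite dimension in usable form. \<open>span\<close> is real, hence the multiples by
  the imaginary unit in \<open>?B\<close>; a finite set cannot span the infinitely many orthogonal
  basis vectors.\<close>

lemma unit_orthogonal_exists:
  fixes u :: "nat \<Rightarrow> l2"
  obtains w where "norm w = 1" "\<And>i. i < n \<Longrightarrow> cinner w (u i) = 0"
proof -
  let ?B = "u ` {..<n} \<union> (\<lambda>i. \<i> *C u i) ` {..<n}"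
  have "\<exists>f. f \<notin> span ?B"
  proof (rule ccontr)
    assume "\<not> ?thesis"
    hence span: "range basis_vec \<subseteq> span ?B" by auto
    have "independent (range basis_vec)"
    proof (rule pairwise_orthogonal_independent)
      show "pairwise orthogonal (range basis_vec)"
        by (auto simp: pairwise_def orthogonal_def cinner_basis_vec basis_vec.rep_eq std_gen_def simp flip: Re_cinner)
      show "0 \<notin> range basis_vec"
      proof
        assume "0 \<in> range basis_vec"
        then obtain k where "0 = basis_vec k" by auto
        hence "Rep_l2 0 k = Rep_l2 (basis_vec k) k" by simp
        thus False by (simp add: basis_vec.rep_eq zero_l2.rep_eq std_gen_def)
      qed
    qed
    hence "finite (range basis_vec)" using independent_span_bound[OF _ _ span] by simp
    moreover have "inj basis_vec"
    proof (rule injI)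
      fix i j assume "basis_vec i = basis_vec j"
      hence "Rep_l2 (basis_vec i) i = Rep_l2 (basis_vec j) i" by simp
      thus "i = j" by (simp add: basis_vec.rep_eq std_gen_def split: if_splits)
    qed
    ultimately show False by (simp add: finite_image_iff)
  qed
  then obtain f where f: "f \<notin> span ?B" by blast
  obtain b where b: "\<And>i. i < n \<Longrightarrow> cinner (f - (\<Sum>j<n. b j *C u j)) (u i) = 0"
    using orthogonal_residual[of n f u] by blast
  define r where "r = f - (\<Sum>j<n. b j *C u j)"
  have "r \<noteq> 0"
  proof
    assume "r = 0"
    hence "f = (\<Sum>j<n. b j *C u j)" by (simp add: r_def)
    moreover have "b j *C u j = Re (b j) *\<^sub>R u j + Im (b j) *\<^sub>R (\<i> *C u j)" for j
      by (simp add: scaleR_l2_def cscale_add_left[symmetric] complex_eq[symmetric] mult.commute)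
    ultimately have "f \<in> span ?B"
      by (simp only:) (intro span_sum span_add span_scale span_base; auto)
    thus False using f by simp
  qed
  show thesis
  proof (rule that)
    show "norm (of_real (inverse (norm r)) *C r) = 1" using \<open>r \<noteq> 0\<close> by (simp add: norm_cscale norm_inverse)
    show "cinner (of_real (inverse (norm r)) *C r) (u i) = 0" if "i < n" for i
      using b[OF that] by (simp add: r_def)
  qed
qed

section \<open>Isometric embedding along an orthonormal sequence\<close>

locale orthonormal_seq =
  fixes g :: "nat \<Rightarrow> l2"
  assumes ortho: "\<And>i j. cinner (g i) (g j) = (if i = j then 1 else 0)"
begin

lemma norm_sum_g: "finite A \<Longrightarrow> (norm (\<Sum>i\<in>A. a i *C g i))\<^sup>2 = (\<Sum>i\<in>A. (cmod (a i))\<^sup>2)"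
proof -
  assume A: "finite A"
  have "complex_of_real ((norm (\<Sum>i\<in>A. a i *C g i))\<^sup>2) = (\<Sum>i\<in>A. \<Sum>j\<in>A. if i = j then a i * cnj (a i) else 0)"
    unfolding cinner_same[symmetric] cinner_sum_left cinner_sum_right
    by (intro sum.cong refl) (auto simp: ortho)
  also have "\<dots> = (\<Sum>i\<in>A. a i * cnj (a i))" using A by simp
  also have "\<dots> = of_real (\<Sum>i\<in>A. (cmod (a i))\<^sup>2)" by (simp only: of_real_sum complex_norm_square)
  finally show ?thesis by (simp only: of_real_eq_iff)
qed

lemma summable_g:
  assumes a: "summable (\<lambda>n. (cmod (a n))\<^sup>2)" shows "summable (\<lambda>n. a n *C g n)"
  unfolding summable_Cauchy
proof (intro allI impI)
  fix e :: real assume "e > 0"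
  hence "0 < e\<^sup>2" by simp
  from a[unfolded summable_Cauchy, rule_format, OF this]
  obtain N where N: "\<forall>m\<ge>N. \<forall>n. norm (\<Sum>i=m..<n. (cmod (a i))\<^sup>2) < e\<^sup>2" ..
  have "norm (\<Sum>i=m..<n. a i *C g i) < e" if "m \<ge> N" for m n
  proof -
    have "(norm (\<Sum>i=m..<n. a i *C g i))\<^sup>2 = (\<Sum>i=m..<n. (cmod (a i))\<^sup>2)"
      by (rule norm_sum_g) simp
    also have "\<dots> \<le> norm (\<Sum>i=m..<n. (cmod (a i))\<^sup>2)" unfolding real_norm_def by (rule abs_ge_self)
    also have "\<dots> < e\<^sup>2" using N that by blast
    finally show ?thesis by (rule power2_less_imp_less) (use \<open>e > 0\<close> in simp)
  qed
  thus "\<exists>N. \<forall>m\<ge>N. \<forall>n. norm (\<Sum>i=m..<n. a i *C g i) < e" by (intro exI[of _ N] allI impI)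
qed

definition embed :: "l2 \<Rightarrow> l2" where "embed x = (\<Sum>n. Rep_l2 x n *C g n)"

lemma embed_sums: "(\<lambda>n. Rep_l2 x n *C g n) sums embed x"
  unfolding embed_def by (rule summable_sums[OF summable_g]) (rule Rep_l2[of x, unfolded lp_2_iff])

lemma embed_add: "embed (x + y) = embed x + embed y"
proof -
  have "(\<lambda>n. Rep_l2 (x + y) n *C g n) sums (embed x + embed y)"
    using sums_add[OF embed_sums[of x] embed_sums[of y]] by (simp add: plus_l2.rep_eq cscale_add_left)
  thus ?thesis by (rule sums_unique2[OF embed_sums])
qed

lemma embed_cscale: "embed (c *C x) = c *C embed x"
proof -
  have "(\<lambda>n. Rep_l2 (c *C x) n *C g n) sums (c *C embed x)"
    using bounded_linear.sums[OF bounded_linear_cscale embed_sums[of x], of c] by (simp add: cscale.rep_eq)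
  thus ?thesis by (rule sums_unique2[OF embed_sums])
qed

lemma norm_embed: "norm (embed x) = norm x"
proof -
  have "(\<lambda>N. (norm (\<Sum>n<N. Rep_l2 x n *C g n))\<^sup>2) \<longlonglongrightarrow> (norm (embed x))\<^sup>2"
    using embed_sums[of x] unfolding sums_def by (intro tendsto_intros)
  hence "(\<lambda>n. (cmod (Rep_l2 x n))\<^sup>2) sums (norm (embed x))\<^sup>2"
    by (simp add: norm_sum_g sums_def)
  moreover have "(\<lambda>n. (cmod (Rep_l2 x n))\<^sup>2) sums (norm x)\<^sup>2"
    using Rep_l2[of x] lp_norm_powr[OF Rep_l2[of x]] by (simp add: lp_2_iff sums_iff norm_l2 psum_def)
  ultimately have "(norm (embed x))\<^sup>2 = (norm x)\<^sup>2" by (rule sums_unique2)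
  thus ?thesis by (simp add: power2_eq_iff_nonneg)
qed

lemma embed_finite:
  assumes "\<And>n. n \<ge> N \<Longrightarrow> Rep_l2 x n = 0" shows "embed x = (\<Sum>n<N. Rep_l2 x n *C g n)"
proof -
  have "(\<lambda>n. Rep_l2 x n *C g n) sums (\<Sum>n<N. Rep_l2 x n *C g n)"
    by (rule sums_finite) (use assms in \<open>auto simp: not_less\<close>)
  thus ?thesis by (rule sums_unique2[OF embed_sums])
qed

lemma bessel: "(\<Sum>n<N. (cmod (cinner y (g n)))\<^sup>2) \<le> (norm y)\<^sup>2"
proof -
  let ?s = "\<Sum>n<N. cinner y (g n) *C g n" and ?S = "\<Sum>n<N. (cmod (cinner y (g n)))\<^sup>2"
  have 1: "cinner ?s ?s = of_real ?S"
    unfolding cinner_same by (simp only: norm_sum_g[OF finite_lessThan])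
  have 2: "cinner y ?s = of_real ?S"
    unfolding cinner_sum_right cinner_cscale_right of_real_sum complex_norm_square
    by (rule sum.cong) (simp_all only: mult.commute)
  have 3: "cinner ?s y = of_real ?S"
    using cinner_commute[of ?s y] by (simp only: 2 complex_cnj_complex_of_real)
  have "cinner (y - ?s) (y - ?s) = cinner y y - of_real ?S"
    by (simp only: cinner_diff_left cinner_diff_right 1 2 3) simp
  hence "(norm (y - ?s))\<^sup>2 = (norm y)\<^sup>2 - (\<Sum>n<N. (cmod (cinner y (g n)))\<^sup>2)"
    unfolding cinner_same of_real_diff[symmetric] by (simp only: of_real_eq_iff)
  thus ?thesis using zero_le_power2[of "norm (y - ?s)"] by linarith
qed

text \<open>The candidate preimage is the sequence of Fourier coefficients of y, square-summable by
  Bessel; the difference is orthogonal to every \<open>g n\<close>.\<close>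

lemma embed_surj:
  assumes total: "\<And>z. (\<And>n. cinner z (g n) = 0) \<Longrightarrow> z = 0" shows "\<exists>x. embed x = y"
proof -
  let ?a = "\<lambda>n. cinner y (g n)"
  define x where "x = Abs_l2 ?a"
  have "?a \<in> lp 2" by (rule l2_of_bounded(1)[OF bessel]) simp
  hence Rep: "Rep_l2 x = ?a" by (simp add: x_def Abs_l2_inverse)
  have "y - embed x = 0"
  proof (rule total)
    fix m
    have lim: "(\<lambda>N. cinner (\<Sum>n<N. ?a n *C g n) (g m)) \<longlonglongrightarrow> cinner (embed x) (g m)"
      using embed_sums[of x] unfolding sums_def Rep by (rule tendsto_cinner)
    have eq: "cinner (\<Sum>n<N. ?a n *C g n) (g m) = ?a m" if "m < N" for N
    proof -
      have "cinner (\<Sum>n<N. ?a n *C g n) (g m) = (\<Sum>n<N. if n = m then ?a n else 0)"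
        unfolding cinner_sum_left by (intro sum.cong refl) (simp add: ortho)
      thus ?thesis using that by simp
    qed
    have "(\<lambda>N. cinner (\<Sum>n<N. ?a n *C g n) (g m)) \<longlonglongrightarrow> ?a m"
      by (intro tendsto_eventually eventually_sequentiallyI[of "Suc m"] eq) simp
    with lim have "cinner (embed x) (g m) = ?a m" by (rule LIMSEQ_unique)
    thus "cinner (y - embed x) (g m) = 0" by (simp add: cinner_diff_left)
  qed
  thus ?thesis by (intro exI[of _ x]) simp
qed

end

subsection \<open>Nearly orthonormal sequences\<close>

text \<open>The tolerances decay in both indices, so the off-diagonal entries of any row of the Gram
  matrix add up to at most 1 / 4, against diagonal entries above 3 / 4, however many vectors are
  taken.\<close>

locale near_orthonormal =
  fixes v :: "nat \<Rightarrow> l2"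
  assumes near_unit: "\<And>n. \<bar>(norm (v n))\<^sup>2 - 1\<bar> < 1 / 4"
    and near_ortho: "\<And>i n. i < n \<Longrightarrow> cmod (cinner (v n) (v i)) < 1 / 2 ^ (i + n + 3)"
begin

lemma near_ortho': "i \<noteq> n \<Longrightarrow> cmod (cinner (v i) (v n)) < 1 / 2 ^ (i + n + 3)"
  using near_ortho[of i n] near_ortho[of n i] cinner_commute[of "v i" "v n"]
  by (cases i n rule: linorder_cases) (auto simp: add.commute)

text \<open>Diagonal dominance of the Gram matrix.\<close>

lemma coefficient_bound:
  assumes y: "y = (\<Sum>i<n. b i *C v i)" and small: "\<And>m. m < n \<Longrightarrow> cmod (cinner y (v m)) \<le> \<delta>"
    and i: "i < n"
  shows "cmod (b i) \<le> 2 * \<delta>"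
proof -
  \<comment> \<open>The row of a coefficient of largest modulus is used. There 3 / 4 - 1 / 4 = 1 / 2
    survives, whence the factor 2.\<close>
  obtain m where m: "m < n" "\<And>i. i < n \<Longrightarrow> cmod (b i) \<le> cmod (b m)"
  proof -
    have "finite ((\<lambda>i. cmod (b i)) ` {..<n})" "(\<lambda>i. cmod (b i)) ` {..<n} \<noteq> {}" using i by auto
    from Max_in[OF this] obtain m where "m < n" "cmod (b m) = Max ((\<lambda>i. cmod (b i)) ` {..<n})" by auto
    thus thesis by (intro that[of m]) auto
  qed
  let ?R = "\<Sum>i\<in>{..<n} - {m}. b i * cinner (v i) (v m)"
  have "cinner y (v m) = b m * cinner (v m) (v m) + ?R"
    unfolding y cinner_sum_left using m(1) by (simp add: sum.remove[of _ m])
  hence "cmod (b m * cinner (v m) (v m)) \<le> cmod (cinner y (v m)) + cmod ?R"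
    by (metis add_diff_cancel_right' norm_triangle_ineq4)
  moreover have "cmod ?R \<le> (\<Sum>i\<in>{..<n} - {m}. cmod (b m) * (1 / 2 ^ (i + 3)))"
  proof (rule sum_norm_le)
    fix i assume "i \<in> {..<n} - {m}"
    hence i: "i < n" "i \<noteq> m" by auto
    have "cmod (cinner (v i) (v m)) \<le> 1 / 2 ^ (i + m + 3)" using near_ortho'[OF i(2)] by simp
    also have "\<dots> \<le> 1 / 2 ^ (i + 3)" by (intro divide_left_mono power_increasing) auto
    finally show "cmod (b i * cinner (v i) (v m)) \<le> cmod (b m) * (1 / 2 ^ (i + 3))"
      unfolding norm_mult using m(2)[OF i(1)] by (intro mult_mono) auto
  qed
  moreover have "(\<Sum>i\<in>{..<n} - {m}. cmod (b m) * (1 / 2 ^ (i + 3))) \<le> cmod (b m) * (1 / 4)"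
  proof -
    have "(\<Sum>i<n. 1 / 2 ^ (i + 3) :: real) = 1 / 4 - 1 / 2 ^ (n + 2)"
    proof (induction n)
      case (Suc n)
      show ?case unfolding sum.lessThan_Suc Suc by (simp add: power_add)
    qed simp
    moreover have "(\<Sum>i\<in>{..<n} - {m}. 1 / 2 ^ (i + 3) :: real) \<le> (\<Sum>i<n. 1 / 2 ^ (i + 3))"
      by (rule sum_mono2) auto
    moreover have "0 \<le> (1 / 2 ^ (n + 2) :: real)" by simp
    ultimately have "(\<Sum>i\<in>{..<n} - {m}. 1 / 2 ^ (i + 3) :: real) \<le> 1 / 4" by linarith
    thus ?thesis unfolding sum_distrib_left[symmetric] by (rule mult_left_mono) simp
  qed
  moreover have "cmod (b m) * (3 / 4) \<le> cmod (b m * cinner (v m) (v m))"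
    unfolding norm_mult cinner_same norm_of_real using near_unit[of m]
    by (intro mult_left_mono) (auto simp: abs_if split: if_splits)
  ultimately have "cmod (b m) \<le> 2 * \<delta>" using small[OF m(1)] by linarith
  thus ?thesis using m(2)[OF i] by linarith
qed

lemma norm_v_le: "norm (v n) \<le> 2"
proof -
  have "(norm (v n))\<^sup>2 \<le> 2\<^sup>2" using near_unit[of n] by (auto simp: abs_if split: if_splits)
  thus ?thesis by (rule power2_le_imp_le) simp
qed

lemma norm_combination_le:
  assumes y: "y = (\<Sum>i<n. b i *C v i)" and small: "\<And>m. m < n \<Longrightarrow> cmod (cinner y (v m)) \<le> \<delta>"
  shows "norm y \<le> 4 * real n * \<delta>"
proof -
  have "norm y \<le> (\<Sum>i<n. 4 * \<delta>)"
    unfolding y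
  proof (rule sum_norm_le)
    fix i assume "i \<in> {..<n}"
    hence b: "cmod (b i) \<le> 2 * \<delta>" using coefficient_bound[OF y small] by simp
    hence "0 \<le> 2 * \<delta>" using norm_ge_zero[of "b i"] by linarith
    hence "cmod (b i) * norm (v i) \<le> (2 * \<delta>) * 2" using b by (intro mult_mono norm_v_le) auto
    thus "norm (b i *C v i) \<le> 4 * \<delta>" by (simp add: norm_cscale)
  qed
  thus ?thesis by simp
qed

section \<open>Gram-Schmidt orthonormalization\<close>

definition proj_coeff :: "nat \<Rightarrow> nat \<Rightarrow> complex" where
  "proj_coeff n = (SOME b. \<forall>i<n. cinner (v n - (\<Sum>j<n. b j *C v j)) (v i) = 0)"

definition residual :: "nat \<Rightarrow> l2" where
  "residual n = v n - (\<Sum>j<n. proj_coeff n j *C v j)"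

text \<open>An ideal object: its coefficients are merely known to exist, and the algorithm
  approximates the vector without computing them.\<close>

definition gs :: "nat \<Rightarrow> l2" where
  "gs n = of_real (inverse (norm (residual n))) *C residual n"

lemma residual_ortho: "i < n \<Longrightarrow> cinner (residual n) (v i) = 0"
  using someI_ex[OF orthogonal_residual[of n "v n" v]] unfolding residual_def proj_coeff_def by blast

text \<open>A vanishing residual would be a vanishing combination with coefficient 1 at
  \<open>v n\<close>, which \<open>coefficient_bound\<close> with \<delta> = 0 excludes.\<close>

lemma residual_nonzero: "residual n \<noteq> 0"
proof
  assume 0: "residual n = 0"
  define b where "b = (\<lambda>i. if i = n then 1 else - proj_coeff n i)"
  have "(\<Sum>i<n. b i *C v i) = - (\<Sum>i<n. proj_coeff n i *C v i)"
    unfolding sum_negf[symmetric]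
  proof (rule sum.cong)
    fix i assume "i \<in> {..<n}"
    thus "b i *C v i = - (proj_coeff n i *C v i)"
      using cscale_diff_left[of 0 "proj_coeff n i" "v i"] by (simp add: b_def)
  qed simp
  hence "0 = (\<Sum>i<Suc n. b i *C v i)" using 0 by (simp add: residual_def b_def)
  from coefficient_bound[OF this, of 0 n] show False by (simp add: b_def)
qed

lemma v_eq: "v n = of_real (norm (residual n)) *C gs n + (\<Sum>j<n. proj_coeff n j *C v j)"
proof -
  have "of_real (norm (residual n)) *C gs n = residual n"
    using residual_nonzero[of n] by (simp add: gs_def flip: of_real_mult)
  thus ?thesis by (simp add: residual_def)
qed

lemma gs_ortho_v: "i < n \<Longrightarrow> cinner (gs n) (v i) = 0"
  by (simp add: gs_def residual_ortho)

lemma gs_ortho_gs: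
  assumes "i < n" shows "cinner (gs n) (gs i) = 0"
proof -
  have "cinner (gs n) (residual i) = 0"
    using assms by (simp add: residual_def cinner_diff_right cinner_sum_right gs_ortho_v)
  thus ?thesis by (simp add: gs_def[of i])
qed

lemma norm_gs: "norm (gs n) = 1"
  using residual_nonzero[of n] by (simp add: gs_def norm_cscale norm_inverse)

sublocale gs: orthonormal_seq gs
proof
  fix i j
  show "cinner (gs i) (gs j) = (if i = j then 1 else 0)"
    using gs_ortho_gs[of i j] gs_ortho_gs[of j i] cinner_commute[of "gs i" "gs j"]
    by (cases i j rule: linorder_cases) (auto simp: cinner_same norm_gs)
qed

text \<open>By triangularity, \<open>v n\<close> is a multiple of \<open>gs n\<close> plus earlier
  vectors. This carries totality from v over to \<open>gs\<close>.\<close>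

lemma ortho_v_if_ortho_gs:
  assumes "\<And>n. cinner z (gs n) = 0" shows "cinner z (v n) = 0"
proof (induction n rule: less_induct)
  case (less n)
  show ?case by (subst v_eq) (simp add: cinner_add_right cinner_sum_right assms less)
qed

text \<open>Writing \<open>c = \<alpha> gs n + y\<close> with \<open>\<alpha> > 0\<close> and \<open>y\<close> in the span of the earlier vectors, the inner
  products with these control \<open>y\<close>, and then the norm of \<open>c\<close> controls \<open>\<alpha>\<close>.\<close>

lemma near_gs:
  assumes c: "c = (\<Sum>i<n. a i *C v i) + of_real t *C v n" and t: "t > 0"
    and small: "\<And>i. i < n \<Longrightarrow> cmod (cinner c (v i)) \<le> \<delta>" and unit: "\<bar>(norm c)\<^sup>2 - 1\<bar> \<le> \<delta>"
    and \<delta>: "0 < \<delta>" "\<delta> \<le> 1"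
  shows "norm (c - gs n) < \<delta> * (4 * real n + 2)\<^sup>2"
proof -
  define y where "y = (\<Sum>i<n. (a i + of_real t * proj_coeff n i) *C v i)"
  define \<alpha> where "\<alpha> = t * norm (residual n)"
  have \<alpha>: "\<alpha> > 0" using t residual_nonzero[of n] by (simp add: \<alpha>_def)
  have c_eq: "c = of_real \<alpha> *C gs n + y"
    unfolding c by (subst v_eq) (simp add: y_def \<alpha>_def cscale_add_left cscale_add_right
      cscale_sum_right sum.distrib)
  have gy: "cinner (gs n) y = 0" "cinner y (gs n) = 0"
    using cinner_commute[of "gs n" y] by (simp_all add: y_def cinner_sum_right gs_ortho_v)
  have "cmod (cinner y (v m)) \<le> \<delta>" if "m < n" for m
    using small[OF that] gs_ortho_v[OF that] by (simp add: c_eq cinner_add_left)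
  hence ny: "norm y \<le> 4 * real n * \<delta>" by (rule norm_combination_le[OF y_def])
  have "cinner c c = of_real (\<alpha>\<^sup>2 + (norm y)\<^sup>2)"
    unfolding c_eq cinner_add_left cinner_add_right cinner_cscale_left cinner_cscale_right gy
    by (simp add: cinner_same[of "gs n"] cinner_same[of y] norm_gs power2_eq_square)
  hence nc: "(norm c)\<^sup>2 = \<alpha>\<^sup>2 + (norm y)\<^sup>2" unfolding cinner_same by (simp only: of_real_eq_iff)
  have "(norm y)\<^sup>2 \<le> (4 * real n * \<delta>)\<^sup>2" using ny by (intro power_mono) auto
  hence "\<bar>\<alpha>\<^sup>2 - 1\<bar> \<le> \<delta> + (4 * real n * \<delta>)\<^sup>2" using unit nc zero_le_power2[of "norm y"] by linarith
  moreover have "\<bar>\<alpha> - 1\<bar> \<le> \<bar>\<alpha>\<^sup>2 - 1\<bar>"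
  proof -
    have "\<alpha>\<^sup>2 - 1 = (\<alpha> - 1) * (\<alpha> + 1)" by (simp add: power2_eq_square algebra_simps)
    hence "\<bar>\<alpha>\<^sup>2 - 1\<bar> = \<bar>\<alpha> - 1\<bar> * (\<alpha> + 1)" using \<alpha> by (simp add: abs_mult)
    moreover have "\<bar>\<alpha> - 1\<bar> * 1 \<le> \<bar>\<alpha> - 1\<bar> * (\<alpha> + 1)" using \<alpha> by (intro mult_left_mono) auto
    ultimately show ?thesis by simp
  qed
  moreover have "norm (c - gs n) \<le> \<bar>\<alpha> - 1\<bar> + norm y"
  proof -
    have "c - gs n = of_real (\<alpha> - 1) *C gs n + y" by (simp add: c_eq cscale_diff_left)
    also have "norm \<dots> \<le> norm (of_real (\<alpha> - 1) *C gs n) + norm y" by (rule norm_triangle_ineq)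
    finally show ?thesis by (simp only: norm_cscale norm_of_real norm_gs mult_1_right)
  qed
  moreover have "(4 * real n * \<delta>)\<^sup>2 \<le> 16 * (real n)\<^sup>2 * \<delta>"
  proof -
    have "(4 * real n * \<delta>)\<^sup>2 = 16 * (real n)\<^sup>2 * (\<delta> * \<delta>)" by (simp add: power2_eq_square)
    also have "\<dots> \<le> 16 * (real n)\<^sup>2 * (\<delta> * 1)" using \<delta> by (intro mult_left_mono) auto
    finally show ?thesis by simp
  qed
  \<comment> \<open>The bound so far is \<delta> times a quadratic in n; the square of 4 n + 2
    dominates it strictly.\<close>
  ultimately have "norm (c - gs n) \<le> \<delta> + 16 * (real n)\<^sup>2 * \<delta> + 4 * real n * \<delta>" using ny by linarith
  also have "\<dots> = \<delta> * (1 + 16 * (real n)\<^sup>2 + 4 * real n)" by (simp add: algebra_simps)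
  also have "\<dots> < \<delta> * (4 * real n + 2)\<^sup>2"
    using \<delta>(1) by (intro mult_strict_left_mono) (auto simp: power2_eq_square algebra_simps)
  finally show ?thesis by simp
qed

text \<open>An exact vector of the shape demanded by \<open>near_gs\<close>, so that a search for
  approximate ones succeeds. Positivity of t fixes the phase: any unimodular multiple of
  \<open>gs n\<close> passes the tests of norm and orthogonality.\<close>

lemma gs_combination:
  obtains a t where "t > 0" "gs n = (\<Sum>i<n. a i *C v i) + of_real t *C v n"
proof
  define t where "t = inverse (norm (residual n))"
  show "t > 0" using residual_nonzero[of n] by (simp add: t_def)
  have "(\<Sum>i<n. (- of_real t * proj_coeff n i) *C v i) = - (of_real t *C (\<Sum>i<n. proj_coeff n i *C v i))"
    unfolding cscale_sum_right sum_negf[symmetric]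
  proof (rule sum.cong)
    fix i
    show "(- of_real t * proj_coeff n i) *C v i = - (of_real t *C (proj_coeff n i *C v i))"
      using cscale_diff_left[of 0 "of_real t * proj_coeff n i" "v i"] by simp
  qed simp
  thus "gs n = (\<Sum>i<n. (- of_real t * proj_coeff n i) *C v i) + of_real t *C v n"
    unfolding gs_def t_def[symmetric] unfolding residual_def cscale_diff_right by simp
qed

end

subsection \<open>Rational combinations\<close>

lemma rat_seq_tendsto:
  obtains q where "(\<lambda>k. of_rat (q k)) \<longlonglongrightarrow> (x::real)"
proof -
  have "\<exists>q. x < of_rat q \<and> of_rat q < x + 1 / Suc k" for k
    using of_rat_dense[of x "x + 1 / Suc k"] by simp
  then obtain q where q: "\<And>k. x < of_rat (q k)" "\<And>k. of_rat (q k) < x + 1 / Suc k" by metis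
  have "(\<lambda>k. of_rat (q k)) \<longlonglongrightarrow> x"
  proof (rule tendsto_sandwich)
    show "eventually (\<lambda>k. x \<le> of_rat (q k)) sequentially"
      and "eventually (\<lambda>k. of_rat (q k) \<le> x + 1 / real (Suc k)) sequentially"
      using q by (simp_all only: less_imp_le eventually_True)
    show "(\<lambda>k. x + 1 / real (Suc k)) \<longlonglongrightarrow> x"
      using tendsto_add[OF tendsto_const LIMSEQ_Suc[OF lim_1_over_n], of x] by simp
  qed simp
  thus thesis by (rule that)
qed

lemma point_seq_tendsto:
  obtains q where "(\<lambda>k. point (q k)) \<longlonglongrightarrow> z"
proof -
  obtain a where a: "(\<lambda>k. of_rat (a k)) \<longlonglongrightarrow> Re z" by (rule rat_seq_tendsto)
  obtain b where b: "(\<lambda>k. of_rat (b k)) \<longlonglongrightarrow> Im z" by (rule rat_seq_tendsto)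
  have "(\<lambda>k. point (a k, b k)) \<longlonglongrightarrow> Complex (Re z) (Im z)"
    unfolding point_def fst_conv snd_conv by (intro tendsto_Complex a b)
  thus thesis using that[of "\<lambda>k. (a k, b k)"] by simp
qed

lemma computable_upt [comp_intros]:
  assumes f: "computable f" shows "computable (\<lambda>x. [0..<f x])"
proof -
  have "computable (\<lambda>x. rec_nat [] (\<lambda>i r. r @ [i]) (f x))" by (intro comp_intros f)
  moreover have "rec_nat [] (\<lambda>i r. r @ [i]) n = [0..<n]" for n by (induction n) auto
  ultimately show ?thesis by simp
qed

text \<open>The sum of the lengths is a safe length for the result, so adding
  \<open>[(0, 0)]\<close> yields a nonempty list with the same value.\<close>

definition cadd :: "rat_point list \<Rightarrow> rat_point list \<Rightarrow> rat_point list" where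
  "cadd c d = map (\<lambda>i. padd (coeff_at c i) (coeff_at d i)) [0..<length c + length d]"

definition cmul :: "rat_point \<Rightarrow> rat_point list \<Rightarrow> rat_point list" where
  "cmul q c = map (pmult q) c"

definition lc :: "rat_point list \<Rightarrow> nat \<Rightarrow> (nat \<Rightarrow> rat_point list) \<Rightarrow> rat_point list" where
  "lc as n h = rec_nat [] (\<lambda>i acc. cadd acc (cmul (coeff_at as i) (h i))) n"

lemma computable_cadd [comp_intros]:
  assumes "computable f" "computable g" shows "computable (\<lambda>x. cadd (f x) (g x))"
  unfolding cadd_def by (intro comp_intros assms assms[THEN computable_comp])

lemma computable_cmul [comp_intros]:
  assumes "computable f" "computable g" shows "computable (\<lambda>x. cmul (f x) (g x))"
  unfolding cmul_def by (intro comp_intros assms assms[THEN computable_comp])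

lemma computable_lc [comp_intros]:
  assumes "computable as" "computable n" "computable (\<lambda>z. h (fst z) (snd z))"
  shows "computable (\<lambda>x. lc (as x) (n x) (h x))"
proof -
  have "computable (\<lambda>z. h (fst z) (fst (snd z)))"
    using computable_comp[OF assms(3), of "\<lambda>z. (fst z, fst (snd z))"] by (simp add: comp_intros)
  thus ?thesis unfolding lc_def by (intro comp_intros assms assms(1)[THEN computable_comp])
qed

locale l2_gens =
  fixes F :: "nat \<Rightarrow> l2"
  assumes dense: "\<And>x e. 0 < e \<Longrightarrow> \<exists>cs. norm (x - (\<Sum>j<length cs. cs ! j *C F j)) < e"
begin

definition val :: "rat_point list \<Rightarrow> l2" where
  "val c = (\<Sum>j<length c. point (c ! j) *C F j)"

lemma point_zero [simp]: "point (0, 0) = 0"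
  by (simp add: point_def complex_eq_iff)

lemma val_coeff_at: "length c \<le> N \<Longrightarrow> val c = (\<Sum>j<N. point (coeff_at c j) *C F j)"
  unfolding val_def by (rule sum.mono_neutral_cong_left) (auto simp: coeff_at_def)

lemma val_cadd: "val (cadd c d) = val c + val d"
proof -
  let ?N = "length c + length d"
  have "val (cadd c d) = (\<Sum>j<?N. point (padd (coeff_at c j) (coeff_at d j)) *C F j)"
    by (simp add: val_def cadd_def)
  also have "\<dots> = val c + val d"
    by (simp add: val_coeff_at[of c ?N] val_coeff_at[of d ?N] point_padd cscale_add_left sum.distrib)
  finally show ?thesis .
qed

lemma val_cmul: "val (cmul q c) = point q *C val c"
  by (simp add: val_def cmul_def point_pmult cscale_sum_right)

lemma val_Nil [simp]: "val [] = 0"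
  by (simp add: val_def)

lemma val_lc: "val (lc as n h) = (\<Sum>i<n. point (coeff_at as i) *C val (h i))"
  unfolding lc_def by (induction n) (simp_all add: val_cadd val_cmul)

lemma val_dense:
  assumes "e > 0" shows "\<exists>c. norm (x - val c) < e"
proof -
  obtain cs where cs: "norm (x - (\<Sum>j<length cs. cs ! j *C F j)) < e" using dense[OF assms] by blast
  have "\<forall>j. \<exists>q. (\<lambda>k. point (q k)) \<longlonglongrightarrow> cs ! j" using point_seq_tendsto by metis
  then obtain q where q: "\<And>j. (\<lambda>k. point (q j k)) \<longlonglongrightarrow> cs ! j" by metis
  have "(\<lambda>k. norm (x - (\<Sum>j<length cs. point (q j k) *C F j))) \<longlonglongrightarrow>
      norm (x - (\<Sum>j<length cs. cs ! j *C F j))"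
    by (intro tendsto_intros q)
  from order_tendstoD(2)[OF this cs] obtain k
    where "norm (x - (\<Sum>j<length cs. point (q j k) *C F j)) < e"
    by (auto simp: eventually_sequentially)
  thus ?thesis by (intro exI[of _ "map (\<lambda>j. q j k) [0..<length cs]"]) (simp add: val_def)
qed

lemma val_seq_tendsto:
  obtains c where "(\<lambda>k. val (c k)) \<longlonglongrightarrow> x"
proof -
  have "\<exists>c. norm (x - val c) < 1 / Suc k" for k by (rule val_dense) simp
  then obtain c where c: "\<And>k. norm (x - val (c k)) < 1 / Suc k" by metis
  have "(\<lambda>k. x - val (c k)) \<longlonglongrightarrow> 0"
    by (rule Lim_null_comparison[OF always_eventually LIMSEQ_Suc[OF lim_1_over_n]])
       (use c in \<open>auto intro: less_imp_le\<close>)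
  from tendsto_diff[OF tendsto_const[of x] this] have "(\<lambda>k. val (c k)) \<longlonglongrightarrow> x" by simp
  thus thesis by (rule that)
qed

lemma ortho_gens_imp_0:
  assumes "\<And>j. cinner z (F j) = 0" shows "z = 0"
proof (rule ccontr)
  assume "z \<noteq> 0"
  then obtain c where c: "norm (z - val c) < norm z" using val_dense[of "norm z" z] by auto
  have "cinner z (val c) = 0" by (simp add: val_def cinner_sum_right assms)
  hence "cinner z (z - val c) = of_real ((norm z)\<^sup>2)" by (simp add: cinner_diff_right cinner_same)
  hence "(norm z)\<^sup>2 = cmod (cinner z (z - val c))" by (simp only: norm_of_real) simp
  also have "\<dots> \<le> norm z * norm (z - val c)" by (rule norm_cinner_le)
  finally show False using c \<open>z \<noteq> 0\<close> by (simp add: power2_eq_square)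
qed

text \<open>By polarization twice the real part is a combination of squared norms, hence computable
  from the norms of combinations. Bounding both doubled parts by \<epsilon> bounds the modulus by
  \<epsilon>.\<close>

definition small :: "rat_point list \<Rightarrow> rat_point list \<Rightarrow> rat \<Rightarrow> bool" where
  "small c d \<epsilon> \<longleftrightarrow> \<bar>2 * Re (cinner (val c) (val d))\<bar> < of_rat \<epsilon> \<and> \<bar>2 * Im (cinner (val c) (val d))\<bar> < of_rat \<epsilon>"

definition nearly_unit :: "rat_point list \<Rightarrow> rat \<Rightarrow> bool" where
  "nearly_unit c \<epsilon> \<longleftrightarrow> \<bar>(norm (val c))\<^sup>2 - 1\<bar> < of_rat \<epsilon>"

lemma small_imp: "small c d \<epsilon> \<Longrightarrow> cmod (cinner (val c) (val d)) < of_rat \<epsilon>"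
  using cmod_le[of "cinner (val c) (val d)"] unfolding small_def by linarith

lemma eventually_small:
  assumes c: "(\<lambda>k. val (c k)) \<longlonglongrightarrow> w" and w: "cinner w (val d) = 0" and e: "\<epsilon> > 0"
  shows "eventually (\<lambda>k. small (c k) d \<epsilon>) sequentially"
proof -
  have e': "0 < (of_rat \<epsilon> :: real)" using e by simp
  have "(\<lambda>k. 2 * Re (cinner (val (c k)) (val d))) \<longlonglongrightarrow> 2 * Re (cinner w (val d))"
    and "(\<lambda>k. 2 * Im (cinner (val (c k)) (val d))) \<longlonglongrightarrow> 2 * Im (cinner w (val d))"
    by (intro tendsto_intros c)+
  from tendstoD[OF this(1) e'] tendstoD[OF this(2) e'] show ?thesis
    unfolding small_def by eventually_elim (simp add: w dist_real_def)
qed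

lemma eventually_nearly_unit:
  assumes c: "(\<lambda>k. val (c k)) \<longlonglongrightarrow> w" and w: "norm w = 1" and e: "\<epsilon> > 0"
  shows "eventually (\<lambda>k. nearly_unit (c k) \<epsilon>) sequentially"
proof -
  have e': "0 < (of_rat \<epsilon> :: real)" using e by simp
  have "(\<lambda>k. (norm (val (c k)))\<^sup>2) \<longlonglongrightarrow> (norm w)\<^sup>2" by (intro tendsto_intros c)
  from tendstoD[OF this e'] show ?thesis
    unfolding nearly_unit_def by eventually_elim (simp add: w dist_real_def)
qed

end

lemma Rep_l2_sum: "Rep_l2 (\<Sum>i\<in>A. f i) n = (\<Sum>i\<in>A. Rep_l2 (f i) n)"
  by (induction A rule: infinite_finite_induct) (simp_all add: zero_l2.rep_eq plus_l2.rep_eq)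

section \<open>Search for well-conditioned vectors\<close>

locale effective_l2_gens = l2_gens +
  assumes creal_norm: "creal (\<lambda>c. norm (val c))"
begin

lemma creal_norm_power2: "creal (\<lambda>c. (norm (val c))\<^sup>2)"
  by (rule creal_square[OF creal_norm]) simp

lemma semidec_nearly_unit:
  assumes "computable c" "computable \<epsilon>" shows "semidec (\<lambda>x. nearly_unit (c x) (\<epsilon> x))"
  unfolding nearly_unit_def abs_less_iff
  by (intro semi_intros creal_intros creal_comp[OF creal_norm_power2] assms)

lemma semidec_small:
  assumes c: "computable c" and d: "computable d" and e: "computable \<epsilon>"
  shows "semidec (\<lambda>x. small (c x) (d x) (\<epsilon> x))"
proof -
  have re: "2 * Re (cinner (val c) (val d)) = (norm (val (cadd c d)))\<^sup>2 - (norm (val c))\<^sup>2 - (norm (val d))\<^sup>2" for c d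
    by (simp add: Re_cinner val_cadd power2_norm_eq_inner inner_add_left inner_add_right inner_commute)
  have "point (0, 1) = \<i>" by (simp add: point_def complex_eq_iff)
  hence im: "2 * Im (cinner (val c) (val d)) = 2 * Re (cinner (val c) (val (cmul (0, 1) d)))" for c d
    by (simp add: val_cmul)
  show ?thesis unfolding small_def im re abs_less_iff
    by (intro semi_intros creal_intros creal_comp[OF creal_norm_power2] comp_intros assms)
qed

definition neg_gen :: "nat \<Rightarrow> rat_point list" where
  "neg_gen j = map (\<lambda>i. if i = j then (-1, 0) else (0, 0)) [0..<Suc j]"

lemma val_neg_gen: "val (neg_gen j) = - F j"
proof -
  have len: "length (neg_gen j) = Suc j" by (simp add: neg_gen_def)
  have nth: "i < Suc j \<Longrightarrow> neg_gen j ! i = (if i = j then (-1, 0) else (0, 0))" for i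
    unfolding neg_gen_def by (simp del: upt_Suc)
  have "val (neg_gen j) = (\<Sum>i<j. point (neg_gen j ! i) *C F i) + point (neg_gen j ! j) *C F j"
    by (simp add: val_def len)
  also have "(\<Sum>i<j. point (neg_gen j ! i) *C F i) = 0"
    by (rule sum.neutral) (simp add: nth)
  also have "point (neg_gen j ! j) = -1" by (simp add: nth point_def complex_eq_iff of_rat_minus)
  finally show ?thesis using cscale_diff_left[of 0 1 "F j"] by simp
qed

text \<open>Every j is the target of infinitely many stages, namely of all codes of pairs (j,
  N).\<close>

definition target :: "nat \<Rightarrow> nat" where "target n = fst (dec n :: nat \<times> nat)"

text \<open>The first two clauses secure \<open>near_orthonormal\<close>. The last puts the target
  generator within \<open>1 / 2 ^ n\<close> of the span of the first n + 1 vectors, n being the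
  length of \<open>us\<close>, which yields density.\<close>

definition step :: "rat_point list list \<Rightarrow> rat_point list \<Rightarrow> bool" where
  "step us c \<longleftrightarrow> nearly_unit c (1 / 4) \<and>
    (\<forall>i<length us. small c (lnth us i) (1 / 2 ^ (i + length us + 3))) \<and>
    (\<exists>as. norm (val (cadd (lc as (Suc (length us)) (\<lambda>i. lnth (us @ [c]) i)) (neg_gen (target (length us)))))
      < of_rat (1 / 2 ^ length us))"

lemma semidec_step: "semidec (\<lambda>z. step (fst z) (snd z))"
  unfolding step_def neg_gen_def target_def
  by (intro semi_intros semidec_nearly_unit semidec_small creal_upper[OF creal_norm] comp_intros)

lemma step_exists: "\<exists>c. step us c"
proof -
  define n where "n = length us"
  define U where "U i = val (lnth us i)" for i
  define f where "f = F (target n)"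
  obtain b where b: "\<And>i. i < n \<Longrightarrow> cinner (f - (\<Sum>j<n. b j *C U j)) (U i) = 0"
    using orthogonal_residual[of n f U] by blast
  define r where "r = f - (\<Sum>j<n. b j *C U j)"
  \<comment> \<open>The ideal new vector is the normalized residual of the target. If the target
    already lies in the span, any orthogonal unit vector serves, with \<beta> = 0.\<close>
  obtain w \<beta> where w: "norm w = 1" "\<And>i. i < n \<Longrightarrow> cinner w (U i) = 0" and r_eq: "r = \<beta> *C w"
  proof (cases "r = 0")
    case True
    obtain w where "norm w = 1" "\<And>i. i < n \<Longrightarrow> cinner w (U i) = 0"
      using unit_orthogonal_exists[of n U] by blast
    thus thesis using that[of w 0] True by simp
  next
    case False
    show thesis
    proof (rule that)
      show "norm (of_real (inverse (norm r)) *C r) = 1" using False by (simp add: norm_cscale norm_inverse)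
      show "cinner (of_real (inverse (norm r)) *C r) (U i) = 0" if "i < n" for i
        using b[OF that] by (simp add: r_def)
      show "r = of_real (norm r) *C (of_real (inverse (norm r)) *C r)"
        using False by (simp flip: of_real_mult)
    qed
  qed
  have f_eq: "f = (\<Sum>j<n. b j *C U j) + \<beta> *C w" using r_eq by (simp add: r_def algebra_simps)
  obtain c where c: "(\<lambda>k. val (c k)) \<longlonglongrightarrow> w" by (rule val_seq_tendsto)
  have "\<forall>j. \<exists>q. (\<lambda>k. point (q k)) \<longlonglongrightarrow> b j" using point_seq_tendsto by metis
  then obtain q where q: "\<And>j. (\<lambda>k. point (q j k)) \<longlonglongrightarrow> b j" by metis
  obtain q' where q': "(\<lambda>k. point (q' k)) \<longlonglongrightarrow> \<beta>" by (rule point_seq_tendsto)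
  define as where "as k = map (\<lambda>i. if i < n then q i k else q' k) [0..<Suc n]" for k
  have coeff: "coeff_at (as k) i = (if i < n then q i k else q' k)" if "i < Suc n" for i k
    using that by (simp add: as_def coeff_at_def del: upt_Suc)
  have lnth: "lnth (us @ [d]) i = (if i < n then lnth us i else d)" if "i < Suc n" for i d
    using that by (auto simp: lnth_def n_def nth_append)
  let ?e = "\<lambda>k. cadd (lc (as k) (Suc n) (\<lambda>i. lnth (us @ [c k]) i)) (neg_gen (target n))"
  have val_e: "val (?e k) = (\<Sum>i<n. point (q i k) *C U i) + point (q' k) *C val (c k) - f" for k
  proof -
    have "(\<Sum>i<n. point (coeff_at (as k) i) *C val (lnth (us @ [c k]) i)) = (\<Sum>i<n. point (q i k) *C U i)"
      by (rule sum.cong) (simp_all add: coeff lnth U_def)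
    thus ?thesis by (simp add: val_cadd val_lc val_neg_gen f_def coeff lnth)
  qed
  have "(\<lambda>k. norm (val (?e k))) \<longlonglongrightarrow> norm ((\<Sum>j<n. b j *C U j) + \<beta> *C w - f)"
    unfolding val_e by (intro tendsto_intros q q' c)
  hence "(\<lambda>k. norm (val (?e k))) \<longlonglongrightarrow> 0" by (simp add: f_eq)
  moreover have "0 < (of_rat (1 / 2 ^ n) :: real)" by simp
  ultimately have 1: "eventually (\<lambda>k. norm (val (?e k)) < of_rat (1 / 2 ^ n)) sequentially"
    by (rule order_tendstoD(2))
  have 2: "eventually (\<lambda>k. nearly_unit (c k) (1 / 4)) sequentially"
    by (rule eventually_nearly_unit[OF c w(1)]) simp
  have 3: "eventually (\<lambda>k. \<forall>i\<in>{..<n}. small (c k) (lnth us i) (1 / 2 ^ (i + n + 3))) sequentially"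
    by (intro eventually_ball_finite finite_lessThan ballI eventually_small[OF c]) (simp_all add: w(2)[unfolded U_def])
  have "eventually (\<lambda>k. step us (c k)) sequentially"
    using 1 2 3 unfolding step_def n_def[symmetric] by eventually_elim auto
  thus ?thesis by (auto simp: eventually_sequentially)
qed

lemma near_orthonormal_exists:
  obtains u where "computable u" "near_orthonormal (\<lambda>n. val (u n))"
    "\<And>z. (\<And>n. cinner z (val (u n)) = 0) \<Longrightarrow> z = 0"
proof -
  obtain st where st: "computable st" "\<And>us. step us (st us)"
    using semidec_choice[OF semidec_step step_exists] by blast
  \<comment> \<open>Each choice depends on all earlier ones, so the recursion carries the whole
    history as a list.\<close>
  define U where "U = (\<lambda>n. rec_nat [] (\<lambda>_ us. us @ [st us]) n)"
  define u where "u = (\<lambda>n. st (U n))"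
  have U: "U n = map u [0..<n]" for n by (induction n) (auto simp: U_def u_def)
  have "computable u" unfolding u_def U_def by (intro comp_intros computable_comp[OF st(1)])
  have len: "length (U n) = n" and nth: "\<And>i. i < n \<Longrightarrow> lnth (U n) i = u i" for n
    by (simp_all add: U)
  have step: "step (U n) (u n)" for n unfolding u_def by (rule st(2))
  have "\<bar>(norm (val (u n)))\<^sup>2 - 1\<bar> < 1 / 4" for n
    using step[of n] by (simp add: step_def nearly_unit_def of_rat_divide)
  moreover have "cmod (cinner (val (u n)) (val (u i))) < 1 / 2 ^ (i + n + 3)" if "i < n" for i n
  proof -
    have "small (u n) (lnth (U n) i) (1 / 2 ^ (i + n + 3))"
      using step[of n] that unfolding step_def len by blast
    hence "small (u n) (u i) (1 / 2 ^ (i + n + 3))" by (simp only: nth[OF that])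
    from small_imp[OF this] show ?thesis by (simp add: of_rat_divide of_rat_power)
  qed
  ultimately have "near_orthonormal (\<lambda>n. val (u n))" by unfold_locales
  moreover have "z = 0" if z: "\<And>n. cinner z (val (u n)) = 0" for z
  proof (rule ortho_gens_imp_0, rule ccontr)
    fix j assume nz: "cinner z (F j) \<noteq> 0"
    have "z \<noteq> 0" using nz by auto
    have lim: "(\<lambda>n. norm z * (1 / 2) ^ n) \<longlonglongrightarrow> norm z * 0"
      by (intro tendsto_intros LIMSEQ_realpow_zero) auto
    have "eventually (\<lambda>n. norm z * (1 / 2) ^ n < cmod (cinner z (F j))) sequentially"
      using nz by (intro order_tendstoD(2)[OF lim]) simp
    then obtain N where N: "\<And>n. n \<ge> N \<Longrightarrow> norm z * (1 / 2) ^ n < cmod (cinner z (F j))"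
      by (auto simp: eventually_sequentially)
    \<comment> \<open>A stage beyond N whose target is j: the code of a pair is at least its second
      component.\<close>
    define n where "n = enc (j, N)"
    have "n \<ge> N" unfolding n_def enc_prod_def by (simp add: enc_nat_def le_prod_encode_2)
    have "target n = j" by (simp add: target_def n_def)
    obtain as where as: "norm (val (cadd (lc as (Suc n) (\<lambda>i. lnth (U n @ [u n]) i)) (neg_gen j))) < of_rat (1 / 2 ^ n)"
      using step[of n] unfolding step_def len \<open>target n = j\<close> by blast
    have "lnth (U n @ [u n]) i = u i" if "i < Suc n" for i
      using that by (auto simp: lnth_def U nth_append less_Suc_eq)
    hence "cinner z (val (lc as (Suc n) (\<lambda>i. lnth (U n @ [u n]) i))) = 0"
      by (simp add: val_lc cinner_sum_right cinner_add_right z)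
    hence "cinner z (F j) = - cinner z (val (cadd (lc as (Suc n) (\<lambda>i. lnth (U n @ [u n]) i)) (neg_gen j)))"
      by (simp add: val_cadd val_neg_gen cinner_diff_right)
    hence "cmod (cinner z (F j)) \<le> norm z * norm (val (cadd (lc as (Suc n) (\<lambda>i. lnth (U n @ [u n]) i)) (neg_gen j)))"
      using norm_cinner_le by simp
    also have "\<dots> \<le> norm z * (1 / 2) ^ n"
      using as by (intro mult_left_mono) (auto simp: of_rat_divide of_rat_power power_divide)
    finally show False using N[OF \<open>n \<ge> N\<close>] by simp
  qed
  ultimately show thesis using that \<open>computable u\<close> by blast
qed

lemma gs_approximation:
  assumes u: "computable u" and near: "near_orthonormal (\<lambda>n. val (u n))"
  obtains G where "computable G"
    "\<And>n k. norm (val (G (n, k)) - near_orthonormal.gs (\<lambda>n. val (u n)) n) < 1 / 2 ^ k"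
proof -
  interpret near_orthonormal "\<lambda>n. val (u n)" by (rule near)
  \<comment> \<open>Chosen so that the bound of \<open>near_gs\<close>,
    \<open>\<delta> * (4 * n + 2)\<^sup>2\<close>, equals \<open>1 / 2 ^ k\<close>.\<close>
  define \<delta> :: "nat \<times> nat \<Rightarrow> rat" where "\<delta> = (\<lambda>z. 1 / (2 ^ snd z * (4 * of_nat (fst z) + 2) ^ 2))"
  \<comment> \<open>The last coefficient must be real and positive, as \<open>near_gs\<close>
    requires; being rational, it can be tested exactly.\<close>
  define P where "P = (\<lambda>z as. snd (coeff_at as (fst z)) = 0 \<and> 0 < fst (coeff_at as (fst z)) \<and>
    (\<forall>i<fst z. small (lc as (Suc (fst z)) u) (u i) (\<delta> z)) \<and> nearly_unit (lc as (Suc (fst z)) u) (\<delta> z))"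
  have \<delta>_comp: "computable \<delta>" unfolding \<delta>_def by (intro comp_intros)
  have "semidec (\<lambda>z. P (fst z) (snd z))"
    unfolding P_def
    by (intro semi_intros semidec_small semidec_nearly_unit comp_intros computable_comp[OF u] computable_comp[OF \<delta>_comp])
  moreover have "\<exists>as. P z as" for z
  proof -
    define n where "n = fst z"
    have \<delta>_pos: "\<delta> z > 0"
    proof -
      have "(0 :: rat) < 4 * of_nat (fst z) + 2" by (intro add_nonneg_pos) auto
      thus ?thesis unfolding \<delta>_def by (simp add: zero_less_mult_iff)
    qed
    obtain a t where t: "t > 0" and gs: "gs n = (\<Sum>i<n. a i *C val (u i)) + of_real t *C val (u n)"
      by (rule gs_combination)
    have "\<forall>j. \<exists>q. (\<lambda>k. point (q k)) \<longlonglongrightarrow> a j" using point_seq_tendsto by metis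
    then obtain q where q: "\<And>j. (\<lambda>k. point (q j k)) \<longlonglongrightarrow> a j" by metis
    obtain s where s: "(\<lambda>k. of_rat (s k)) \<longlonglongrightarrow> t" by (rule rat_seq_tendsto)
    define as where "as k = map (\<lambda>i. if i < n then q i k else (s k, 0)) [0..<Suc n]" for k
    have coeff: "coeff_at (as k) i = (if i < n then q i k else (s k, 0))" if "i < Suc n" for i k
      using that by (simp add: as_def coeff_at_def del: upt_Suc)
    have val: "val (lc (as k) (Suc n) u) = (\<Sum>i<n. point (q i k) *C val (u i)) + of_real (of_rat (s k)) *C val (u n)" for k
      by (simp add: val_lc coeff point_of_rat)
    have lim: "(\<lambda>k. val (lc (as k) (Suc n) u)) \<longlonglongrightarrow> gs n"
      unfolding val gs by (intro tendsto_intros q s)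
    have 1: "eventually (\<lambda>k. nearly_unit (lc (as k) (Suc n) u) (\<delta> z)) sequentially"
      by (rule eventually_nearly_unit[OF lim norm_gs \<delta>_pos])
    have 2: "eventually (\<lambda>k. \<forall>i\<in>{..<n}. small (lc (as k) (Suc n) u) (u i) (\<delta> z)) sequentially"
      by (intro eventually_ball_finite finite_lessThan ballI eventually_small[OF lim] gs_ortho_v \<delta>_pos) simp
    have 3: "eventually (\<lambda>k. 0 < (of_rat (s k) :: real)) sequentially"
      by (rule order_tendstoD(1)[OF s t])
    have "eventually (\<lambda>k. P z (as k)) sequentially"
      using 1 2 3 unfolding P_def n_def[symmetric] by eventually_elim (simp add: coeff)
    thus ?thesis by (auto simp: eventually_sequentially)
  qed
  ultimately obtain as where as: "computable as" "\<And>z. P z (as z)" by (rule semidec_choice) blast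
  define G where "G = (\<lambda>z. lc (as z) (Suc (fst z)) u)"
  have "computable G" unfolding G_def
    by (intro comp_intros computable_comp[OF u] computable_comp[OF as(1)])
  moreover have "norm (val (G (n, k)) - gs n) < 1 / 2 ^ k" for n k
  proof -
    define d :: real where "d = 1 / (2 ^ k * (4 * real n + 2)\<^sup>2)"
    have d: "of_rat (\<delta> (n, k)) = d"
      by (simp add: \<delta>_def d_def of_rat_divide of_rat_mult of_rat_power of_rat_add)
    have pos: "0 < 2 ^ k * (4 * real n + 2)\<^sup>2" by (simp add: add_nonneg_pos)
    have "1 * 1 \<le> 2 ^ k * (4 * real n + 2)\<^sup>2"
    proof (rule mult_mono)
      have "(1::real)\<^sup>2 \<le> (4 * real n + 2)\<^sup>2" by (rule power_mono) auto
      thus "1 \<le> (4 * real n + 2)\<^sup>2" by simp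
    qed auto
    hence d01: "0 < d" "d \<le> 1" using pos by (simp_all add: d_def)
    let ?a = "as (n, k)"
    have Pz: "snd (coeff_at ?a n) = 0" "0 < fst (coeff_at ?a n)"
      "\<And>i. i < n \<Longrightarrow> small (G (n, k)) (u i) (\<delta> (n, k))" "nearly_unit (G (n, k)) (\<delta> (n, k))"
      using as(2)[of "(n, k)"] by (simp_all add: P_def G_def)
    have "point (coeff_at ?a n) = of_real (of_rat (fst (coeff_at ?a n)))"
      using Pz(1) by (simp add: point_def complex_eq_iff)
    hence eq: "val (G (n, k)) = (\<Sum>i<n. point (coeff_at ?a i) *C val (u i)) +
        of_real (of_rat (fst (coeff_at ?a n))) *C val (u n)"
      by (simp add: G_def val_lc)
    have sm: "cmod (cinner (val (G (n, k))) (val (u i))) \<le> d" if "i < n" for i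
      using small_imp[OF Pz(3)[OF that]] by (simp add: d)
    have un: "\<bar>(norm (val (G (n, k))))\<^sup>2 - 1\<bar> \<le> d"
      using Pz(4) by (simp add: nearly_unit_def d)
    have tp: "0 < (of_rat (fst (coeff_at ?a n)) :: real)" using Pz(2) by simp
    have "norm (val (G (n, k)) - gs n) < d * (4 * real n + 2)\<^sup>2"
      by (rule near_gs[OF eq tp sm un d01])
    also have "\<dots> = 1 / 2 ^ k" using pos by (simp add: d_def)
    finally show ?thesis .
  qed
  ultimately show thesis by (rule that)
qed

end

section \<open>Passage between sequences and the Hilbert space type\<close>

lemma effective_l2_gensI:
  assumes "effective_generating_set 2 F"
  shows "effective_l2_gens (\<lambda>j. Abs_l2 (F j))"
    and "Rep_l2 (l2_gens.val (\<lambda>j. Abs_l2 (F j)) c) = lin_comb F (map point c)"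
proof -
  from assms have gen: "generating_set 2 F" unfolding effective_generating_set_def by simp
  hence F: "F j \<in> lp 2" for j unfolding generating_set_def by simp
  have Rep: "Rep_l2 (Abs_l2 (F j)) = F j" for j using F by (simp add: Abs_l2_inverse)
  have lin: "Rep_l2 (\<Sum>j<length cs. cs ! j *C Abs_l2 (F j)) = lin_comb F cs" for cs
    by (rule ext) (simp add: lin_comb_def Rep_l2_sum cscale.rep_eq Rep)
  interpret l2_gens "\<lambda>j. Abs_l2 (F j)"
  proof
    fix x and e :: real assume "0 < e"
    then obtain cs where "lin_comb F cs \<in> lp_ball 2 (Rep_l2 x) e"
      using gen Rep_l2[of x] unfolding generating_set_def by blast
    hence "lp_norm 2 (\<lambda>n. Rep_l2 x n - lin_comb F cs n) < e"
      by (simp add: lp_ball_def lp_norm_minus_commute[of 2 "Rep_l2 x"])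
    hence "norm (x - (\<Sum>j<length cs. cs ! j *C Abs_l2 (F j))) < e"
      by (simp add: norm_l2 minus_l2.rep_eq lin)
    thus "\<exists>cs. norm (x - (\<Sum>j<length cs. cs ! j *C Abs_l2 (F j))) < e" ..
  qed
  have val: "Rep_l2 (val c) = lin_comb F (map point c)" for c
    using lin[of "map point c"] by (simp add: val_def)
  thus "Rep_l2 (val c) = lin_comb F (map point c)" .
  obtain \<phi> where \<phi>: "partrec \<phi>" and ap: "\<And>zs k. zs \<noteq> [] \<Longrightarrow>
        (\<exists>q. \<phi> (prod_encode (points_code zs, k)) = Some (rat_code q) \<and>
             \<bar>of_rat q - lp_norm 2 (lin_comb F (map point zs))\<bar> < 1 / 2 ^ k)"
    using assms unfolding effective_generating_set_def by blast
  \<comment> \<open>The norm algorithm is guaranteed only on nonempty lists; \<open>[(0, 0)]\<close>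
    has the same value as the empty one.\<close>
  define ne where "ne = (\<lambda>c :: rat_point list. if c = [] then [(0, 0)] else c)"
  have ne: "ne c \<noteq> []" "val (ne c) = val c" for c by (simp_all add: ne_def val_def)
  have ne_comp: "computable ne" unfolding ne_def by (intro comp_intros)
  have "creal (\<lambda>c. norm (val c))"
  proof (rule creal_approx)
    show "semidec (\<lambda>z. \<phi> (enc (ne (fst z), fst (snd z) :: nat)) = Some (enc (snd (snd z) :: rat)))"
      by (intro semidec_partrec[OF \<phi>] comp_intros computable_comp[OF ne_comp])
    have ap': "\<exists>q. \<phi> (enc (ne c, k)) = Some (enc q) \<and> \<bar>of_rat q - norm (val c)\<bar> < 1 / 2 ^ k" for c and k :: nat
    proof -
      have "norm (val c) = lp_norm 2 (lin_comb F (map point (ne c)))"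
        by (simp only: norm_l2 val[symmetric] ne(2))
      moreover have "enc (ne c, k) = prod_encode (points_code (ne c), k)"
        by (simp add: enc_prod_def enc_eq_points_code enc_nat_def)
      ultimately show ?thesis using ap[OF ne(1)[of c], of k] by (simp only: enc_rat_eq_rat_code)
    qed
    show "\<exists>q. \<phi> (enc (ne c, k)) = Some (enc (q :: rat))" for c and k :: nat
      using ap' by blast
    show "\<bar>of_rat q - norm (val c)\<bar> < 1 / 2 ^ k" if "\<phi> (enc (ne c, k)) = Some (enc q)" for c k q
    proof -
      obtain q' where "\<phi> (enc (ne c, k)) = Some (enc q')" "\<bar>of_rat q' - norm (val c)\<bar> < 1 / 2 ^ k"
        using ap' by blast
      thus ?thesis using that by simp
    qed
  qed
  thus "effective_l2_gens (\<lambda>j. Abs_l2 (F j))" by unfold_locales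
qed

lemma generating_std_gen: "p \<ge> 1 \<Longrightarrow> generating_set p std_gen"
  unfolding generating_set_def
proof (intro conjI allI ballI impI std_gen_in_lp)
  fix f and \<epsilon> :: real assume p: "p \<ge> 1" and f: "f \<in> lp p" and "\<epsilon> > 0"
  obtain N where N: "\<And>M. M \<ge> N \<Longrightarrow> lp_norm p (\<lambda>n. if n < M then 0 else f n) < \<epsilon>"
    using lp_tail[OF f p \<open>\<epsilon> > 0\<close>] by blast
  let ?c = "lin_comb std_gen (map f [0..<N])"
  have "(\<lambda>n. f n - ?c n) = (\<lambda>n. if n < N then 0 else f n)" by (auto simp: lin_comb_std_gen)
  hence "?c \<in> lp_ball p f \<epsilon>"
    unfolding lp_ball_def using N[of N] lin_comb_in_lp[OF p std_gen_in_lp]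
    by (simp add: lp_norm_minus_commute[of p ?c])
  thus "\<exists>cs. lin_comb std_gen cs \<in> lp_ball p f \<epsilon>" ..
qed

lemma rat_combination_std_gen:
  assumes x: "0 < (e::real)" obtains zs where "zs \<noteq> []" "norm (y - Abs_l2 (lin_comb std_gen (map point zs))) < e"
proof -
  have lin: "(\<Sum>j<length cs. cs ! j *C basis_vec j) = Abs_l2 (lin_comb std_gen cs)" for cs
  proof -
    have "Rep_l2 (\<Sum>j<length cs. cs ! j *C basis_vec j) = lin_comb std_gen cs"
      by (rule ext) (simp add: lin_comb_def Rep_l2_sum cscale.rep_eq basis_vec.rep_eq)
    thus ?thesis by (metis Rep_l2_inverse)
  qed
  interpret l2_gens basis_vec
  proof
    fix x and e :: real assume "0 < e"
    moreover have "generating_set 2 std_gen" by (rule generating_std_gen) simp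
    ultimately obtain cs where cs: "lin_comb std_gen cs \<in> lp_ball 2 (Rep_l2 x) e"
      using Rep_l2[of x] unfolding generating_set_def by blast
    hence "lp_norm 2 (\<lambda>n. Rep_l2 x n - lin_comb std_gen cs n) < e"
      by (simp add: lp_ball_def lp_norm_minus_commute[of 2 "Rep_l2 x"])
    moreover have "lin_comb std_gen cs \<in> lp 2" using cs by (simp add: lp_ball_def)
    ultimately have "norm (x - (\<Sum>j<length cs. cs ! j *C basis_vec j)) < e"
      by (simp add: norm_l2 minus_l2.rep_eq lin Abs_l2_inverse)
    thus "\<exists>cs. norm (x - (\<Sum>j<length cs. cs ! j *C basis_vec j)) < e" ..
  qed
  obtain c where c: "norm (y - val c) < e" using val_dense[OF x] by blast
  \<comment> \<open>Rational balls require a nonempty coefficient list, hence the additional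
    zero.\<close>
  have "val (cadd c [(0, 0)]) = val c" unfolding val_cadd by (simp add: val_def)
  moreover have "val (cadd c [(0, 0)]) = Abs_l2 (lin_comb std_gen (map point (cadd c [(0, 0)])))"
    using lin[of "map point (cadd c [(0, 0)])"] by (simp add: val_def)
  ultimately show thesis using c by (intro that[of "cadd c [(0, 0)]"]) (simp_all add: cadd_def)
qed

section \<open>The computable isometry for p = 2\<close>

lemma computably_categorical_2: "computably_categorical 2"
  unfolding computably_categorical_def
proof (intro allI impI)
  fix F assume eff: "effective_generating_set 2 F"
  interpret effective_l2_gens "\<lambda>j. Abs_l2 (F j)" by (rule effective_l2_gensI(1)[OF eff])
  note Rep_val = effective_l2_gensI(2)[OF eff]
  obtain u where u: "computable u" "near_orthonormal (\<lambda>n. val (u n))"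
    and total: "\<And>z. (\<And>n. cinner z (val (u n)) = 0) \<Longrightarrow> z = 0"
    using near_orthonormal_exists by blast
  interpret near_orthonormal "\<lambda>n. val (u n)" by (rule u(2))
  obtain G where G: "computable G" "\<And>n k. norm (val (G (n, k)) - gs n) < 1 / 2 ^ k"
    using gs_approximation[OF u] by blast
  define T where "T f = Rep_l2 (gs.embed (Abs_l2 f))" for f
  have T_Rep: "T (Rep_l2 x) = Rep_l2 (gs.embed x)" for x by (simp add: T_def Rep_l2_inverse)
  have lp_obtain: "\<exists>x. f = Rep_l2 x" if "f \<in> lp 2" for f using that by (metis Abs_l2_inverse)
  have isometry: "surj_linear_isometry 2 T"
    unfolding surj_linear_isometry_def
  proof (intro conjI ballI allI)
    show "T ` lp 2 = lp 2"
    proof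
      show "T ` lp 2 \<subseteq> lp 2" using Rep_l2 by (auto simp: T_def)
      show "lp 2 \<subseteq> T ` lp 2"
      proof
        fix f assume "f \<in> lp 2"
        then obtain y where y: "f = Rep_l2 y" using lp_obtain by blast
        obtain x where "gs.embed x = y"
          using gs.embed_surj[OF total[OF ortho_v_if_ortho_gs]] by blast
        hence "f = T (Rep_l2 x)" by (simp add: T_Rep y)
        thus "f \<in> T ` lp 2" using Rep_l2 by blast
      qed
    qed
  next
    fix f g assume "f \<in> lp 2" "g \<in> lp 2"
    then obtain x y where "f = Rep_l2 x" "g = Rep_l2 y" using lp_obtain by blast
    thus "T (\<lambda>n. f n + g n) = (\<lambda>n. T f n + T g n)"
      by (simp only: plus_l2.rep_eq[symmetric] T_Rep gs.embed_add)
  next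
    fix c f assume "f \<in> lp 2"
    then obtain x where "f = Rep_l2 x" using lp_obtain by blast
    thus "T (\<lambda>n. c * f n) = (\<lambda>n. c * T f n)"
      by (simp only: cscale.rep_eq[symmetric] T_Rep gs.embed_cscale)
  next
    fix f assume "f \<in> lp 2"
    then obtain x where "f = Rep_l2 x" using lp_obtain by blast
    thus "lp_norm 2 (T f) = lp_norm 2 f"
      by (simp only: T_Rep norm_l2[symmetric] gs.norm_embed)
  qed
  \<comment> \<open>A rational bound for the sum of the moduli of the coefficients, hence for how
    much errors in the images of basis vectors are magnified.\<close>
  define bd where "bd = (\<lambda>zs :: rat_point list. \<Sum>i<length zs.
    (if fst (coeff_at zs i) < 0 then - fst (coeff_at zs i) else fst (coeff_at zs i)) +
    (if snd (coeff_at zs i) < 0 then - snd (coeff_at zs i) else snd (coeff_at zs i)))"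
  have bd_comp: "computable bd" unfolding bd_def by (intro comp_intros)
  have bd: "(\<Sum>i<length zs. cmod (point (coeff_at zs i))) \<le> of_rat (bd zs)" for zs
    unfolding bd_def of_rat_sum
  proof (rule sum_mono)
    fix i
    have "cmod (point z) \<le> \<bar>of_rat (fst z)\<bar> + \<bar>of_rat (snd z)\<bar>" for z
      using cmod_le[of "point z"] by (simp add: point_def)
    moreover have "\<bar>of_rat q :: real\<bar> = of_rat (if q < 0 then - q else q)" for q
      by (simp add: abs_if of_rat_minus)
    ultimately show "cmod (point (coeff_at zs i)) \<le> of_rat (
      (if fst (coeff_at zs i) < 0 then - fst (coeff_at zs i) else fst (coeff_at zs i)) +
      (if snd (coeff_at zs i) < 0 then - snd (coeff_at zs i) else snd (coeff_at zs i)))"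
      unfolding of_rat_add by simp
  qed
  \<comment> \<open>Such a k makes the error of replacing every \<open>gs i\<close> by
    \<open>G (i, k)\<close> smaller than the radius. The first disjunct lets a k exist also for
    pairs that are not rational balls.\<close>
  define Q where "Q = (\<lambda>(B :: rat_ball) (k :: nat). \<not> 0 < fst B \<or> bd (snd B) / 2 ^ k < fst B)"
  have "semidec (\<lambda>z. Q (fst z) (snd z))"
    unfolding Q_def by (intro semidec_computable comp_intros computable_comp[OF bd_comp])
  moreover have "\<exists>k. Q B k" for B
  proof (cases "0 < fst B")
    case True
    obtain n where n: "bd (snd B) / fst B < of_nat n" using reals_Archimedean2 by blast
    have "(of_nat n :: rat) \<le> 2 ^ n" by (metis less_exp less_imp_le of_nat_le_iff of_nat_numeral of_nat_power)
    hence "bd (snd B) / fst B < 2 ^ n" using n by linarith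
    hence "bd (snd B) / 2 ^ n < fst B" using True by (simp add: divide_less_eq mult.commute)
    thus ?thesis unfolding Q_def by blast
  qed (simp add: Q_def)
  ultimately obtain \<kappa> where \<kappa>: "computable \<kappa>" "\<And>B. Q B (\<kappa> B)" by (rule semidec_choice) blast
  \<comment> \<open>One radius is spent on the image of the input ball, one on the error of the new
    centre. The added zero keeps the list nonempty.\<close>
  define \<Phi> where "\<Phi> = (\<lambda>B :: rat_ball. (2 * fst B,
    cadd (lc (snd B) (length (snd B)) (\<lambda>i. G (i, \<kappa> B))) [(0, 0)]))"
  have \<Phi>_comp: "computable \<Phi>" unfolding \<Phi>_def
    by (intro comp_intros computable_comp[OF G(1)] computable_comp[OF \<kappa>(1)])
  have \<Phi>_ball: "\<Phi> B \<in> rat_balls" if "B \<in> rat_balls" for B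
    using that by (simp add: rat_balls_def \<Phi>_def cadd_def case_prod_unfold)
  define ctr where "ctr zs = Abs_l2 (lin_comb std_gen (map point zs))" for zs
  have Rep_ctr: "Rep_l2 (ctr zs) = lin_comb std_gen (map point zs)" for zs
    unfolding ctr_def by (intro Abs_l2_inverse lin_comb_in_lp std_gen_in_lp) simp
  have in_ball_E: "Rep_l2 x \<in> ball_set 2 std_gen B \<longleftrightarrow> norm (x - ctr (snd B)) < of_rat (fst B)" for x B
    by (simp add: ball_set_def lp_ball_def Rep_l2 norm_l2 minus_l2.rep_eq Rep_ctr)
  have in_ball_F: "Rep_l2 x \<in> ball_set 2 F B \<longleftrightarrow> norm (x - val (snd B)) < of_rat (fst B)" for x B
    by (simp add: ball_set_def lp_ball_def Rep_l2 norm_l2 minus_l2.rep_eq Rep_val)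
  have near: "norm (gs.embed (ctr (snd B)) - val (snd (\<Phi> B))) < of_rat (fst B)" if "B \<in> rat_balls" for B
  proof -
    let ?zs = "snd B" and ?k = "\<kappa> B"
    have pos: "0 < fst B" using that by (auto simp: rat_balls_def)
    have emb: "gs.embed (ctr ?zs) = (\<Sum>i<length ?zs. point (coeff_at ?zs i) *C gs i)"
    proof -
      have "gs.embed (ctr ?zs) = (\<Sum>i<length ?zs. Rep_l2 (ctr ?zs) i *C gs i)"
        by (rule gs.embed_finite) (simp add: Rep_ctr lin_comb_std_gen)
      also have "\<dots> = (\<Sum>i<length ?zs. point (coeff_at ?zs i) *C gs i)"
        by (rule sum.cong) (simp_all add: Rep_ctr lin_comb_std_gen point_coeff_at)
      finally show ?thesis .
    qed
    have "val (snd (\<Phi> B)) = (\<Sum>i<length ?zs. point (coeff_at ?zs i) *C val (G (i, ?k)))"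
      unfolding \<Phi>_def snd_conv val_cadd val_lc by (simp add: val_def)
    hence "norm (gs.embed (ctr ?zs) - val (snd (\<Phi> B))) =
        norm (\<Sum>i<length ?zs. point (coeff_at ?zs i) *C (gs i - val (G (i, ?k))))"
      by (simp add: emb cscale_diff_right sum_subtractf)
    also have "\<dots> \<le> (\<Sum>i<length ?zs. cmod (point (coeff_at ?zs i)) * (1 / 2 ^ ?k))"
    proof (rule sum_norm_le)
      fix i
      have "norm (gs i - val (G (i, ?k))) \<le> 1 / 2 ^ ?k"
        using G(2)[of i ?k] by (simp add: norm_minus_commute)
      thus "norm (point (coeff_at ?zs i) *C (gs i - val (G (i, ?k)))) \<le> cmod (point (coeff_at ?zs i)) * (1 / 2 ^ ?k)"
        unfolding norm_cscale by (rule mult_left_mono) simp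
    qed
    also have "\<dots> \<le> of_rat (bd ?zs) * (1 / 2 ^ ?k)"
      unfolding sum_distrib_right[symmetric] by (rule mult_right_mono[OF bd]) simp
    also have "\<dots> = of_rat (bd ?zs / 2 ^ ?k)" by (simp add: of_rat_divide of_rat_power)
    also have "\<dots> < of_rat (fst B)" using \<kappa>(2)[of B] pos by (simp add: Q_def of_rat_less)
    finally show ?thesis .
  qed
  have embed_diff: "norm (gs.embed x - gs.embed y) = norm (x - y)" for x y
  proof -
    have "gs.embed x = gs.embed (x - y) + gs.embed y" by (simp flip: gs.embed_add)
    thus ?thesis using gs.norm_embed[of "x - y"] by simp
  qed
  define \<phi> where "\<phi> = (\<lambda>n. Some (enc (\<Phi> (dec n))))"
  have \<phi>_code: "\<phi> (ball_code B) = Some (ball_code (\<Phi> B))" for B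
    by (simp add: \<phi>_def enc_eq_ball_code[symmetric])
  have "computable_map 2 std_gen F T"
    unfolding computable_map_def
  proof (intro exI[of _ \<phi>] conjI ballI allI impI)
    show "partrec \<phi>" using \<Phi>_comp unfolding \<phi>_def computable_def recursive_def .
  next
    fix B y assume B: "B \<in> rat_balls" "\<phi> (ball_code B) = Some y"
    have "y = ball_code (\<Phi> B)" using B(2) by (simp add: \<phi>_code)
    thus "y \<in> ball_code ` rat_balls" using \<Phi>_ball[OF B(1)] by (rule image_eqI)
  next
    fix B1 B2 f
    assume B: "B1 \<in> rat_balls" "\<phi> (ball_code B1) = Some (ball_code B2)" and f: "f \<in> ball_set 2 std_gen B1"
    have "ball_code (\<Phi> B1) = ball_code B2" using B(2) by (simp only: \<phi>_code option.inject)
    hence B2: "B2 = \<Phi> B1" by (simp add: enc_eq_ball_code[symmetric])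
    obtain x where x: "f = Rep_l2 x" using f lp_obtain by (auto simp: ball_set_def lp_ball_def)
    have "norm (gs.embed x - gs.embed (ctr (snd B1))) < of_rat (fst B1)"
      using f by (simp add: x in_ball_E embed_diff)
    hence "norm (gs.embed x - val (snd (\<Phi> B1))) < of_rat (fst B1) + of_rat (fst B1)"
      using near[OF B(1)] norm_diff_triangle_less by blast
    hence "norm (gs.embed x - val (snd B2)) < of_rat (fst B2)"
      unfolding B2 by (simp add: \<Phi>_def of_rat_mult)
    thus "T f \<in> ball_set 2 F B2" by (simp add: x T_Rep in_ball_F)
  next
    fix f U assume f: "f \<in> lp 2" and "lp_neighborhood 2 (T f) U"
    then obtain \<epsilon> where \<epsilon>: "\<epsilon> > 0" "lp_ball 2 (T f) \<epsilon> \<subseteq> U" unfolding lp_neighborhood_def by blast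
    obtain x where x: "f = Rep_l2 x" using lp_obtain[OF f] by blast
    \<comment> \<open>A point of the output ball is within 2 r of its centre, the centre within r of
      the image of the input centre, and that within r of the image of x: together 4 r.\<close>
    obtain r where r: "0 < (of_rat r :: real)" "of_rat r < \<epsilon> / 4"
      using of_rat_dense[of 0 "\<epsilon> / 4"] \<epsilon>(1) by auto
    obtain zs where zs: "zs \<noteq> []" "norm (x - ctr zs) < of_rat r"
      unfolding ctr_def using rat_combination_std_gen[OF r(1)] by blast
    let ?B = "(r, zs)"
    have B: "?B \<in> rat_balls" using r zs by (simp add: rat_balls_def)
    have fB: "f \<in> ball_set 2 std_gen ?B" using zs by (simp add: x in_ball_E)
    have "ball_set 2 F (\<Phi> ?B) \<subseteq> U"
    proof
      fix h assume h: "h \<in> ball_set 2 F (\<Phi> ?B)"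
      then obtain y where y: "h = Rep_l2 y" using lp_obtain by (auto simp: ball_set_def lp_ball_def)
      have 1: "norm (y - val (snd (\<Phi> ?B))) < 2 * of_rat r"
        using h by (simp add: y in_ball_F) (simp add: \<Phi>_def of_rat_mult)
      have 2: "norm (gs.embed (ctr zs) - val (snd (\<Phi> ?B))) < of_rat r" using near[OF B] by simp
      have 3: "norm (gs.embed x - gs.embed (ctr zs)) < of_rat r" using zs by (simp add: embed_diff)
      have "y - gs.embed x = (y - val (snd (\<Phi> ?B))) - (gs.embed (ctr zs) - val (snd (\<Phi> ?B)))
          - (gs.embed x - gs.embed (ctr zs))" by simp
      also have "norm \<dots> \<le> norm (y - val (snd (\<Phi> ?B))) + norm (gs.embed (ctr zs) - val (snd (\<Phi> ?B)))
          + norm (gs.embed x - gs.embed (ctr zs))"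
        by (intro order_trans[OF norm_triangle_ineq4] add_right_mono norm_triangle_ineq4)
      finally have "norm (y - gs.embed x) < \<epsilon>" using 1 2 3 r by linarith
      hence "h \<in> lp_ball 2 (T f) \<epsilon>"
        by (simp add: y x T_Rep lp_ball_def Rep_l2 norm_l2 minus_l2.rep_eq)
      thus "h \<in> U" using \<epsilon>(2) by blast
    qed
    thus "\<exists>B1\<in>rat_balls. \<exists>B2\<in>rat_balls. f \<in> ball_set 2 std_gen B1 \<and>
        \<phi> (ball_code B1) = Some (ball_code B2) \<and> ball_set 2 F B2 \<subseteq> U"
      using B fB \<Phi>_ball[OF B] \<phi>_code by blast
  qed
  thus "\<exists>T. surj_linear_isometry 2 T \<and> computable_map 2 std_gen F T" using isometry by blast
qed

theorem theorem1p1: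
  fixes p :: real
  assumes "computable_real p" and "p \<ge> 1"
  shows "computably_categorical p \<longleftrightarrow> p = 2"
  using not_computably_categorical[OF assms] computably_categorical_2 by blast

end
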